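(* Let $(\mathsf X,\mathcal B)$ be a measurable space and let $\mathcal P$ and $\mathcal Q$ be nonempty sets of probability measures on it. The following statements are equivalent. (i) The pair $(\mathcal P,\mathcal Q)$ is sequentially testable. (ii) For every $\eta>0$, there exists an optionally ARL-valid family $(T_\gamma)_{\gamma\ge1}$ for $\mathcal P$ satisfying $$\gamma\le\inf_{P\in\mathcal P}\mathbb E_{P^\infty}T_\gamma\le\sup_{P\in\mathcal P}\mathbb E_{P^\infty}T_\gamma\le(1+\eta)\gamma+1\qquad\text{for all }\gamma\ge1,$$ and, for every fixed $Q\in\mathcal Q$, there are finite constants $A_{Q,\eta}$ (depending on $Q$ and $\eta$) and $B_Q$ (depending on $Q$ but not on $\eta$) such that $\mathcal J_Q(T_\gamma)\le A_{Q,\eta}+B_Q\log\gamma$ for all $\gamma\ge2$. (iii) There exists an optionally ARL-valid family $(T_\gamma)_{\gamma\ge1}$ for $\mathcal P$ such that $\mathcal J_Q(T_\gamma)/\gamma\to0$ as $\gamma\to\infty$ for every fixed $Q\in\mathcal Q$. (iv) There exists an optionally ARL-valid family $(T_\gamma)_{\gamma\ge1}$ for $\mathcal P$ such that, for every $Q\in\mathcal Q$, some integer $\gamma\ge3$ satisfies $\mathcal J_Q(T_\gamma)<\gamma/2$. (v) There exist nonempty subfamilies $\mathcal A_m\subseteq\mathcal Q$ and integers $n_m\ge1$ $(m\ge1)$ such that $\mathcal Q=\bigcup_{m\ge1}\mathcal A_m$ and $d_{\mathrm{TV}}(\mathscr C_{n_m},\mathscr D_{n_m}(\mathcal A_m))>0$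 for every $m$. Moreover, whenever these conditions hold, for every $\eta>0$ the family in (ii) may be chosen as the full threshold family of one e-detector, i.e. there is an e-detector $(\mathcal D_t)_{t\ge 0}$ for $\mathcal P$ such that $T_\gamma=\inf\{t\ge1:\mathcal D_t\ge\gamma\}$, $\gamma\ge1$, is a family as in (ii). Consequently, one may choose an optionally ARL-valid family for which $\mathbb E_{P^\infty}T_\gamma<\infty$ for every $P\in\mathcal P$ and $\gamma\ge1$, and such that for every fixed $Q\in\mathcal Q$ one has $\mathcal J_Q(T_\gamma)<\inf_{P\in\mathcal P}\mathbb E_{P^\infty}T_\gamma$ for all sufficiently large $\gamma$ (how large may depend on $Q$).
   Context: **Testing.** For a probability measure $R$ on $(\mathsf X,\mathcal B)$, $R^n$ and $R^\infty$ denote i.i.d. product laws on $\mathsf X^n$ and $\mathsf X^{\mathbb N}$; $(X_i)_{i\ge1}$ is the coordinate process. A sequential test is a stopping time $\tau$ with values in $\{1,2,\dots\}\cup\{\infty\}$ for the filtration $(\sigma(X_1,\dots,X_n))_{n}$. It is level-$\alpha$ for $\mathcal P$ if $\sup_{P\in\mathcal P}P^\infty(\tau<\infty)\le\alpha$, and has power one against $\mathcal Q$ if $Q^\infty(\tau<\infty)=1$ for every $Q\in\mathcal Q$. The pair $(\mathcal P,\mathcal Q)$ is called sequentially testable if the following equivalent conditions hold: for some $\alpha\in(0,1)$ there is a level-$\alpha$ test with power one against $\mathcal Q$; for every $\alpha\in(0,1)$ there is such a test; there is a countable family $(n_m,h_m)_{m\ge1}$ of bounded measurable $h_m:\mathsf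 X^{n_m}\to\mathbb R$ with $\sup_{P\in\mathcal P}\mathbb E_{P^{n_m}}h_m\le0$ for every $m$ and such that each $Q\in\mathcal Q$ has $\mathbb E_{Q^{n_m}}h_m>0$ for some $m$. **Change-detection model.** Procedures may use auxiliary randomization independent of the observations under every law: the sample space is $\mathsf X^{\mathbb N}$, possibly times an auxiliary probability space, and $(\mathcal F_t)_{t\ge0}$ is the filtration generated by $X_1,\dots,X_t$ together with the auxiliary variables revealed through time $t$ (without randomization, the coordinate filtration with $\mathcal F_0$ trivial). All probabilities and expectations (including those under $P^\infty$) include the auxiliary randomization as an independent product factor. For $P\in\mathcal P$, $Q\in\mathcal Q$, $\nu\ge1$, $\mathbb P_\nu^{P,Q}$ (expectation $\mathbb E_\nu^{P,Q}$) is the law under which the observations have law $P^{\nu-1}\otimes Q^\infty$, i.e. $X_1,\dots,X_{\nu-1}$ are i.i.d. $P$ and $X_\nu,X_{\nu+1},\dots$ are i.i.d. $Q$, all independent. An alarm time is an $(\mathcal F_t)$-stopping time with values in $\{1,2,\dots\}\cup\{\infty\}$. "There exists a family" includes the choice of auxiliary randomization. An alarm time $T$ is optionally ARL-valid at scale $\gamma\ge1$ for $\mathcal P$ if $\mathbb P_{P^\infty}(T\le\sigma)\le\mathbb E_{P^\infty}\sigma/\gamma$ for every $P\in\mathcal P$ and every $(\mathcal F_t)$-stopping time $\sigma$, where $\{T\le\sigma\}$ means $\{T<\infty,\,T\le\sigma\}$. A family $(T_\gamma)_{\gamma\ge1}$ (indexed by real $\gamma\ge1$) is optionally ARL-valid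 if $T_\gamma$ is optionally ARL-valid at scale $\gamma$ for every $\gamma\ge1$. An e-detector for $\mathcal P$ is an $(\mathcal F_t)$-adapted process $(\mathcal D_t)_{t\ge0}$ with values in $[0,\infty]$, $\mathcal D_0=0$, such that $\mathbb E_{P^\infty}\mathcal D_\tau\le\mathbb E_{P^\infty}\tau$ for every $P\in\mathcal P$ and every stopping time $\tau$, with $\mathcal D_\infty:=\liminf_t\mathcal D_t$ (the inequality being automatic if $\mathbb E_{P^\infty}\tau=\infty$). Robust Lorden delay: $$\mathcal J_Q(T):=\sup_{P\in\mathcal P}\sup_{\nu\ge1}\operatorname{ess\,sup}\,\mathbb E_\nu^{P,Q}\big[(T-\nu+1)^+\mid\mathcal F_{\nu-1}\big].$$ **Geometry.** Let $\mathcal L_n$ be the Banach space of bounded $\mathcal B^{\otimes n}$-measurable real functions on $\mathsf X^n$ with the supremum norm, and $\mathrm{ba}_n=\mathcal L_n^*$ its dual (bounded finitely additive signed measures) with the weak-$*$ topology $\sigma(\mathrm{ba}_n,\mathcal L_n)$. For nonempty $\mathcal A\subseteq\mathcal Q$, $\mathscr C_n$ is the weak-$*$ closure of the convex hull of $\{P^n:P\in\mathcal P\}$ and $\mathscr D_n(\mathcal A)$ is the weak-$*$ closure of the convex hull of $\{Q^n:Q\in\mathcal A\}$ in $\mathrm{ba}_n$; their elements are finitely additive probability measures. For such $\mu,\nu$, $d_{\mathrm{TV}}(\mu,\nu)=\sup\{\mathbb E_\mu f-\mathbb E_\nu f: f\in\mathcal L_n,\ 0\le f\le1\}$, and the distance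 between two sets is the infimum over pairs. *)

theory Defs
  imports "HOL-Probability.Probability"
begin

section \<open>Laws and filtrations\<close>

text \<open>The observation X_t (t = 1, 2, ...) is coordinate t - 1 of a sequence in
  \<^term>\<open>space (PiM (UNIV :: nat set) (\<lambda>_. M))\<close>.  In the whole development the measure M only serves
  as a measurable space, and laws on it are elements of \<^term>\<open>space (prob_algebra M)\<close>.\<close>

definition iid_n :: "nat \<Rightarrow> 'a measure \<Rightarrow> (nat \<Rightarrow> 'a) measure" where
  "iid_n n R = PiM {..<n} (\<lambda>_. R)"

definition iid :: "'a measure \<Rightarrow> (nat \<Rightarrow> 'a) measure" where
  "iid R = PiM UNIV (\<lambda>_. R)"

definition obs_filtration :: "'a measure \<Rightarrow> nat \<Rightarrow> (nat \<Rightarrow> 'a) measure" where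
  "obs_filtration M t =
     vimage_algebra (space (PiM UNIV (\<lambda>_. M))) (\<lambda>\<omega>. restrict \<omega> {..<t}) (PiM {..<t} (\<lambda>_. M))"

text \<open>The library's \<^const>\<open>stopping_time\<close> takes its values in the index set of the filtration;
  here the index set is nat and the value \<open>\<infinity>\<close> is allowed.\<close>

definition ext_stopping_time :: "(nat \<Rightarrow> 'w measure) \<Rightarrow> ('w \<Rightarrow> enat) \<Rightarrow> bool" where
  "ext_stopping_time F T \<longleftrightarrow> (\<forall>t. Measurable.pred (F t) (\<lambda>\<omega>. T \<omega> \<le> enat t))"

section \<open>Sequential testability\<close>

definition sequential_test :: "'a measure \<Rightarrow> ((nat \<Rightarrow> 'a) \<Rightarrow> enat) \<Rightarrow> bool" where
  "sequential_test M \<tau> \<longleftrightarrow> ext_stopping_time (obs_filtration M) \<tau> \<and>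
     (\<forall>\<omega>\<in>space (PiM UNIV (\<lambda>_. M)). 1 \<le> \<tau> \<omega>)"

definition level_test :: "'a measure set \<Rightarrow> real \<Rightarrow> ((nat \<Rightarrow> 'a) \<Rightarrow> enat) \<Rightarrow> bool" where
  "level_test \<P> \<alpha> \<tau> \<longleftrightarrow>
     (SUP P\<in>\<P>. emeasure (iid P) {\<omega>\<in>space (iid P). \<tau> \<omega> < \<infinity>}) \<le> ennreal \<alpha>"

definition power_one_test :: "'a measure set \<Rightarrow> ((nat \<Rightarrow> 'a) \<Rightarrow> enat) \<Rightarrow> bool" where
  "power_one_test \<Q> \<tau> \<longleftrightarrow> (\<forall>Q\<in>\<Q>. emeasure (iid Q) {\<omega>\<in>space (iid Q). \<tau> \<omega> < \<infinity>} = 1)"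

definition sequentially_testable :: "'a measure \<Rightarrow> 'a measure set \<Rightarrow> 'a measure set \<Rightarrow> bool" where
  "sequentially_testable M \<P> \<Q> \<longleftrightarrow>
     (\<exists>\<alpha>::real. 0 < \<alpha> \<and> \<alpha> < 1 \<and>
       (\<exists>\<tau>. sequential_test M \<tau> \<and> level_test \<P> \<alpha> \<tau> \<and> power_one_test \<Q> \<tau>))"

section \<open>Change-detection model\<close>

text \<open>The auxiliary randomization is a probability space U with a filtration G, where G t is
  generated by the auxiliary variables revealed through time t.\<close>

definition aux_randomization :: "'b measure \<Rightarrow> (nat \<Rightarrow> 'b measure) \<Rightarrow> bool" where
  "aux_randomization U G \<longleftrightarrow>
     prob_space U \<and> filtration (space U) G \<and> (\<forall>t. sets (G t) \<subseteq> sets U)"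

definition full_filtration ::
  "'a measure \<Rightarrow> (nat \<Rightarrow> 'b measure) \<Rightarrow> nat \<Rightarrow> ((nat \<Rightarrow> 'a) \<times> 'b) measure" where
  "full_filtration M G t = obs_filtration M t \<Otimes>\<^sub>M G t"

definition sample_space :: "'a measure \<Rightarrow> 'b measure \<Rightarrow> ((nat \<Rightarrow> 'a) \<times> 'b) set" where
  "sample_space M U = space (PiM UNIV (\<lambda>_. M)) \<times> space U"

definition null_law :: "'b measure \<Rightarrow> 'a measure \<Rightarrow> ((nat \<Rightarrow> 'a) \<times> 'b) measure" where
  "null_law U P = iid P \<Otimes>\<^sub>M U"

text \<open>\<open>X\<^sub>1, ..., X\<^bsub>\<nu>-1\<^esub>\<close> have law P and \<open>X\<^sub>\<nu>, X\<^bsub>\<nu>+1\<^esub>, ...\<close> have law Q; coordinate i is \<open>X\<^bsub>i+1\<^esub>\<close>.\<close>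

definition change_law ::
  "'b measure \<Rightarrow> 'a measure \<Rightarrow> 'a measure \<Rightarrow> nat \<Rightarrow> ((nat \<Rightarrow> 'a) \<times> 'b) measure" where
  "change_law U P Q \<nu> = PiM UNIV (\<lambda>i. if i + 1 < \<nu> then P else Q) \<Otimes>\<^sub>M U"

definition mean_time :: "'w measure \<Rightarrow> ('w \<Rightarrow> enat) \<Rightarrow> ennreal" where
  "mean_time L T = (\<integral>\<^sup>+ \<omega>. ennreal_of_enat (T \<omega>) \<partial>L)"

definition alarm_time ::
  "'a measure \<Rightarrow> 'b measure \<Rightarrow> (nat \<Rightarrow> 'b measure) \<Rightarrow> ((nat \<Rightarrow> 'a) \<times> 'b \<Rightarrow> enat) \<Rightarrow> bool" where
  "alarm_time M U G T \<longleftrightarrow> ext_stopping_time (full_filtration M G) T \<and>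
     (\<forall>\<omega>\<in>sample_space M U. 1 \<le> T \<omega>)"

definition optionally_ARL_valid ::
  "'a measure \<Rightarrow> 'b measure \<Rightarrow> (nat \<Rightarrow> 'b measure) \<Rightarrow> 'a measure set \<Rightarrow> real
    \<Rightarrow> ((nat \<Rightarrow> 'a) \<times> 'b \<Rightarrow> enat) \<Rightarrow> bool" where
  "optionally_ARL_valid M U G \<P> \<gamma> T \<longleftrightarrow> alarm_time M U G T \<and>
     (\<forall>P\<in>\<P>. \<forall>\<sigma>. ext_stopping_time (full_filtration M G) \<sigma> \<longrightarrow>
        emeasure (null_law U P) {\<omega>\<in>space (null_law U P). T \<omega> < \<infinity> \<and> T \<omega> \<le> \<sigma> \<omega>}
          \<le> mean_time (null_law U P) \<sigma> / ennreal \<gamma>)"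

definition optionally_ARL_valid_family ::
  "'a measure \<Rightarrow> 'b measure \<Rightarrow> (nat \<Rightarrow> 'b measure) \<Rightarrow> 'a measure set
    \<Rightarrow> (real \<Rightarrow> (nat \<Rightarrow> 'a) \<times> 'b \<Rightarrow> enat) \<Rightarrow> bool" where
  "optionally_ARL_valid_family M U G \<P> T \<longleftrightarrow>
     (\<forall>\<gamma>\<ge>1. optionally_ARL_valid M U G \<P> \<gamma> (T \<gamma>))"

text \<open>Subtraction on enat is truncated and satisfies \<open>\<infinity> - n = \<infinity>\<close> for finite n, so
  \<open>T \<omega> + 1 - \<nu>\<close> is the positive part of \<open>T - \<nu> + 1\<close>.\<close>

definition lorden_delay ::
  "'a measure \<Rightarrow> 'b measure \<Rightarrow> (nat \<Rightarrow> 'b measure) \<Rightarrow> 'a measure set \<Rightarrow> 'a measure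
    \<Rightarrow> ((nat \<Rightarrow> 'a) \<times> 'b \<Rightarrow> enat) \<Rightarrow> ennreal" where
  "lorden_delay M U G \<P> Q T =
     (SUP P\<in>\<P>. SUP \<nu>\<in>{1..}. esssup (change_law U P Q \<nu>)
        (nn_cond_exp (change_law U P Q \<nu>) (full_filtration M G (\<nu> - 1))
           (\<lambda>\<omega>. ennreal_of_enat (T \<omega> + 1 - enat \<nu>))))"

section \<open>E-detectors\<close>

definition stopped_value :: "(nat \<Rightarrow> 'w \<Rightarrow> ennreal) \<Rightarrow> ('w \<Rightarrow> enat) \<Rightarrow> 'w \<Rightarrow> ennreal" where
  "stopped_value D \<tau> \<omega> = (case \<tau> \<omega> of enat t \<Rightarrow> D t \<omega> | \<infinity> \<Rightarrow> liminf (\<lambda>t. D t \<omega>))"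

definition e_detector ::
  "'a measure \<Rightarrow> 'b measure \<Rightarrow> (nat \<Rightarrow> 'b measure) \<Rightarrow> 'a measure set
    \<Rightarrow> (nat \<Rightarrow> (nat \<Rightarrow> 'a) \<times> 'b \<Rightarrow> ennreal) \<Rightarrow> bool" where
  "e_detector M U G \<P> D \<longleftrightarrow>
     (\<forall>t. D t \<in> borel_measurable (full_filtration M G t)) \<and>
     (\<forall>\<omega>\<in>sample_space M U. D 0 \<omega> = 0) \<and>
     (\<forall>P\<in>\<P>. \<forall>\<tau>. ext_stopping_time (full_filtration M G) \<tau> \<longrightarrow>
        (\<integral>\<^sup>+ \<omega>. stopped_value D \<tau> \<omega> \<partial>null_law U P) \<le> mean_time (null_law U P) \<tau>)"

definition threshold_family :: "(nat \<Rightarrow> 'w \<Rightarrow> ennreal) \<Rightarrow> real \<Rightarrow> 'w \<Rightarrow> enat" where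
  "threshold_family D \<gamma> \<omega> = Inf (enat ` {t. 1 \<le> t \<and> ennreal \<gamma> \<le> D t \<omega>})"

text \<open>The requirement on a family in the second condition of the equivalence, at level \<open>\<eta>\<close> and with
  slopes B; B is a parameter because it must be chosen before \<open>\<eta>\<close>.\<close>

definition log_delay_family ::
  "'a measure \<Rightarrow> 'b measure \<Rightarrow> (nat \<Rightarrow> 'b measure) \<Rightarrow> 'a measure set \<Rightarrow> 'a measure set
    \<Rightarrow> real \<Rightarrow> ('a measure \<Rightarrow> real) \<Rightarrow> (real \<Rightarrow> (nat \<Rightarrow> 'a) \<times> 'b \<Rightarrow> enat) \<Rightarrow> bool" where
  "log_delay_family M U G \<P> \<Q> \<eta> B T \<longleftrightarrow>
     optionally_ARL_valid_family M U G \<P> T \<and>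
     (\<forall>\<gamma>\<ge>1. ennreal \<gamma> \<le> (INF P\<in>\<P>. mean_time (null_law U P) (T \<gamma>)) \<and>
        (INF P\<in>\<P>. mean_time (null_law U P) (T \<gamma>))
          \<le> (SUP P\<in>\<P>. mean_time (null_law U P) (T \<gamma>)) \<and>
        (SUP P\<in>\<P>. mean_time (null_law U P) (T \<gamma>)) \<le> ennreal ((1 + \<eta>) * \<gamma> + 1)) \<and>
     (\<forall>Q\<in>\<Q>. \<exists>A::real. \<forall>\<gamma>\<ge>2.
        enn2ereal (lorden_delay M U G \<P> Q (T \<gamma>)) \<le> ereal (A + B Q * ln \<gamma>))"

section \<open>Geometry\<close>

text \<open>Functions on \<^term>\<open>space N\<close> are represented by their extension by zero.\<close>

definition bdd_meas :: "'b measure \<Rightarrow> ('b \<Rightarrow> real) set" where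
  "bdd_meas N = {f \<in> borel_measurable N. bounded (f ` space N) \<and> (\<forall>x. x \<notin> space N \<longrightarrow> f x = 0)}"

definition supremum_norm :: "'b measure \<Rightarrow> ('b \<Rightarrow> real) \<Rightarrow> real" where
  "supremum_norm N f = (SUP x\<in>space N. \<bar>f x\<bar>)"

definition ba :: "'b measure \<Rightarrow> (('b \<Rightarrow> real) \<Rightarrow> real) set" where
  "ba N = {\<phi> \<in> extensional (bdd_meas N).
     (\<forall>f\<in>bdd_meas N. \<forall>g\<in>bdd_meas N. \<phi> (\<lambda>x. f x + g x) = \<phi> f + \<phi> g) \<and>
     (\<forall>c. \<forall>f\<in>bdd_meas N. \<phi> (\<lambda>x. c * f x) = c * \<phi> f) \<and>
     (\<exists>C. \<forall>f\<in>bdd_meas N. \<bar>\<phi> f\<bar> \<le> C * supremum_norm N f)}"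

text \<open>The weak-* topology \<open>\<sigma>(ba, bdd_meas)\<close> is pointwise convergence on \<^const>\<open>bdd_meas\<close>.\<close>

definition weak_star :: "'b measure \<Rightarrow> (('b \<Rightarrow> real) \<Rightarrow> real) topology" where
  "weak_star N = subtopology (product_topology (\<lambda>_. euclideanreal) (bdd_meas N)) (ba N)"

definition expectation_functional :: "'b measure \<Rightarrow> 'b measure \<Rightarrow> ('b \<Rightarrow> real) \<Rightarrow> real" where
  "expectation_functional N R = (\<lambda>f\<in>bdd_meas N. \<integral>x. f x \<partial>R)"

definition functional_convex_hull ::
  "'b measure \<Rightarrow> (('b \<Rightarrow> real) \<Rightarrow> real) set \<Rightarrow> (('b \<Rightarrow> real) \<Rightarrow> real) set" where
  "functional_convex_hull N \<Phi> =
     {(\<lambda>f\<in>bdd_meas N. \<Sum>\<phi>\<in>S. c \<phi> * \<phi> f) | S c.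
        finite S \<and> S \<subseteq> \<Phi> \<and> (\<forall>\<phi>\<in>S. 0 \<le> c \<phi>) \<and> sum c S = 1}"

text \<open>For \<open>\<R> = \<P>\<close> this is \<open>\<C>\<^sub>n\<close>, for \<open>\<R> = \<A>\<close> it is \<open>\<D>\<^sub>n(\<A>)\<close>.\<close>

definition closed_mixtures ::
  "'a measure \<Rightarrow> nat \<Rightarrow> 'a measure set \<Rightarrow> (((nat \<Rightarrow> 'a) \<Rightarrow> real) \<Rightarrow> real) set" where
  "closed_mixtures M n \<R> =
     weak_star (iid_n n M) closure_of
       functional_convex_hull (iid_n n M)
         ((\<lambda>R. expectation_functional (iid_n n M) (iid_n n R)) ` \<R>)"

definition tv_dist :: "'b measure \<Rightarrow> (('b \<Rightarrow> real) \<Rightarrow> real) \<Rightarrow> (('b \<Rightarrow> real) \<Rightarrow> real) \<Rightarrow> ereal" where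
  "tv_dist N \<mu> \<nu> =
     (SUP f\<in>{f \<in> bdd_meas N. \<forall>x\<in>space N. 0 \<le> f x \<and> f x \<le> 1}. ereal (\<mu> f - \<nu> f))"

definition tv_set_dist ::
  "'b measure \<Rightarrow> (('b \<Rightarrow> real) \<Rightarrow> real) set \<Rightarrow> (('b \<Rightarrow> real) \<Rightarrow> real) set \<Rightarrow> ereal" where
  "tv_set_dist N A B = (INF \<mu>\<in>A. INF \<nu>\<in>B. tv_dist N \<mu> \<nu>)"

end

theory Submission
  imports Defs
begin

text \<open>All conditions are compared with the existence of countably many bounded functions \<open>h\<close> on finite
  blocks whose mean is at most 0 under every null law and positive, for some \<open>h\<close>, under each
  alternative.  For small \<open>c\<close> the bet \<open>1 + c h\<close> has mean at most 1 under the null, whereas its inverse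
  has mean \<open>\<rho> < 1\<close> under the alternative; hence the product of \<open>k\<close> independent bets is below \<open>b\<close> with
  probability at most \<open>b \<rho>\<^sup>k\<close>, which makes the delay logarithmic in the threshold.  A test rejects when
  some product is large.  A detector sums the products over all starting times, mixes over the
  countable family, and adds a multiple of \<open>t\<close> that caps the alarm times.

  Conversely, an alarm that is valid at scale \<open>k\<close> satisfies \<open>P (T \<le> t) \<le> t / k\<close>, so the mean of
  \<open>min T k\<close> is at least \<open>(k + 1) / 2\<close> under the null; if it is below \<open>k / 2\<close> under the alternative, then
  \<open>h = (k + 1) / 2 - min T k\<close>, averaged over the randomization, is such a function.  For the
  geometric condition, weak-* compactness reduces the positive distance to finitely many test
  functions, where an elementary convexity argument gives a separating linear combination.\<close>


section \<open>Filtrations and blocks of observations\<close>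

text \<open>The worst-case delay conditions on everything before the change and takes an essential
  supremum, so no favourable past can be relied on. This is why a product is started at every time:
  the one started at the change point uses post-change blocks only, is independent of the past and
  begins with wealth 1.

  The size \<open>c\<close> of a bet must be small against the unknown mean \<mu> of
  \<open>h\<close> under the alternative: the gain is \<open>c * \<mu>\<close>, the second-order
  loss at most \<open>2 * c^2\<close>. No single \<open>c\<close> serves all alternatives, so all
  bets with \<open>c\<close> a power of 1/2 enter the countable family. The decay rate \<rho> of the
  bet selected for \<open>Q\<close> fixes the slope \<open>B\<close>; \<eta> and the mixture weights
  only rescale the threshold, and the logarithm turns this into a shift of the additive constant.

  Randomization is allowed throughout but does not enlarge the class of solvable problems: in the
  converse it is averaged out, and the constructed detectors live on a one-point auxiliary
  law.\<close>

definition obs_law :: "'b measure \<Rightarrow> (nat \<Rightarrow> 'a measure) \<Rightarrow> ((nat \<Rightarrow> 'a) \<times> 'b) measure" where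
  "obs_law U R = PiM UNIV R \<Otimes>\<^sub>M U"

definition block :: "nat \<Rightarrow> nat \<Rightarrow> (nat \<Rightarrow> 'a) \<Rightarrow> nat \<Rightarrow> 'a" where
  "block n t \<omega> = (\<lambda>i\<in>{..<n}. \<omega> (t + i))"

lemma null_law_eq: "null_law U P = obs_law U (\<lambda>_. P)"
  by (simp add: null_law_def iid_def obs_law_def)

lemma change_law_eq: "change_law U P Q \<nu> = obs_law U (\<lambda>i. if i + 1 < \<nu> then P else Q)"
  by (simp add: change_law_def obs_law_def)

lemma prob_algebraD:
  assumes "P \<in> space (prob_algebra M)"
  shows "prob_space P" "sets P = sets M" "space P = space M"
  using assms sets_eq_imp_space_eq by (auto simp: space_prob_algebra)

lemma space_obs_filtration [simp]: "space (obs_filtration M t) = space (PiM UNIV (\<lambda>_. M))"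
  by (simp add: obs_filtration_def)

lemma restrict_in_space_PiM:
  "\<omega> \<in> space (PiM UNIV (\<lambda>_. M)) \<Longrightarrow> restrict \<omega> {..<t} \<in> space (PiM {..<t} (\<lambda>_. M))"
  by (auto simp: space_PiM)

lemma sets_obs_filtration:
  "sets (obs_filtration M t) = {(\<lambda>\<omega>. restrict \<omega> {..<t}) -` A \<inter> space (PiM UNIV (\<lambda>_. M)) | A.
     A \<in> sets (PiM {..<t} (\<lambda>_. M))}"
  unfolding obs_filtration_def by (rule sets_vimage_algebra2) (auto intro: restrict_in_space_PiM)

lemma measurable_restrict_obs_filtration:
  "(\<lambda>\<omega>. restrict \<omega> {..<t}) \<in> measurable (obs_filtration M t) (PiM {..<t} (\<lambda>_. M))"
  unfolding obs_filtration_def by (rule measurable_vimage_algebra1) (auto intro: restrict_in_space_PiM)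

lemma measurable_obs_filtrationI:
  assumes "g \<in> space N \<rightarrow> space (PiM UNIV (\<lambda>_. M))"
    and "(\<lambda>x. restrict (g x) {..<t}) \<in> measurable N (PiM {..<t} (\<lambda>_. M))"
  shows "g \<in> measurable N (obs_filtration M t)"
  unfolding obs_filtration_def by (intro measurable_vimage_algebra2 assms)

lemma measurable_ident_obs_filtration:
  "(\<lambda>\<omega>. \<omega>) \<in> measurable (PiM UNIV (\<lambda>_. M)) (obs_filtration M t)"
  by (rule measurable_obs_filtrationI) (auto intro: measurable_restrict_subset)

lemma measurable_obs_filtration_mono:
  assumes "s \<le> t"
  shows "(\<lambda>\<omega>. \<omega>) \<in> measurable (obs_filtration M t) (obs_filtration M s)"
proof (rule measurable_obs_filtrationI)
  have "(\<lambda>\<omega>. restrict (restrict \<omega> {..<t}) {..<s})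
      \<in> measurable (obs_filtration M t) (PiM {..<s} (\<lambda>_. M))"
    using assms
    by (intro measurable_compose[OF measurable_restrict_obs_filtration measurable_restrict_subset]) auto
  then show "(\<lambda>\<omega>. restrict \<omega> {..<s}) \<in> measurable (obs_filtration M t) (PiM {..<s} (\<lambda>_. M))"
    using assms by (simp add: Int_absorb1 restrict_restrict)
qed simp

lemma measurable_block_obs_filtration:
  assumes "s + n \<le> t"
  shows "block n s \<in> measurable (obs_filtration M t) (iid_n n M)"
proof -
  have *: "(\<lambda>x. \<lambda>i\<in>{..<n}. x (s + i)) \<in> measurable (PiM {..<t} (\<lambda>_. M)) (PiM {..<n} (\<lambda>_. M))"
    using assms by (intro measurable_restrict measurable_component_singleton) auto
  have "(\<lambda>\<omega>. \<lambda>i\<in>{..<n}. restrict \<omega> {..<t} (s + i)) \<in> measurable (obs_filtration M t) (PiM {..<n} (\<lambda>_. M))"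
    by (rule measurable_compose[OF measurable_restrict_obs_filtration *])
  also have "(\<lambda>\<omega>. \<lambda>i\<in>{..<n}. restrict \<omega> {..<t} (s + i)) = (block n s :: (nat \<Rightarrow> 'a) \<Rightarrow> nat \<Rightarrow> 'a)"
    using assms by (auto simp: block_def fun_eq_iff)
  finally show ?thesis by (simp add: iid_n_def)
qed

text \<open>Doob-Dynkin with an explicit factor: extend the prefix by a fixed point and apply
  \<open>f\<close>. A T1 target makes \<open>{f \<omega>}\<close> closed, so its preimage is a
  cylinder over the prefix and contains the modified sequence as well.\<close>

lemma obs_filtration_factor:
  assumes "f \<in> borel_measurable (obs_filtration M t)"
    and "space M \<noteq> {}"
  obtains F where "F \<in> borel_measurable (PiM {..<t} (\<lambda>_. M))"
    and "\<And>\<omega>. \<omega> \<in> space (PiM UNIV (\<lambda>_. M)) \<Longrightarrow> f \<omega> = (F (restrict \<omega> {..<t}) :: 'c :: t1_space)"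
proof -
  obtain x0 where x0: "x0 \<in> space M" using assms(2) by auto
  define ext where "ext y = (\<lambda>i. if i < t then y i else x0)" for y
  have sp: "ext y \<in> space (PiM UNIV (\<lambda>_. M))" if "y \<in> space (PiM {..<t} (\<lambda>_. M))" for y
    using that x0 by (auto simp: ext_def space_PiM PiE_iff)
  have re: "restrict (ext y) {..<t} = y" if "y \<in> space (PiM {..<t} (\<lambda>_. M))" for y
    using that by (auto simp: ext_def space_PiM PiE_iff fun_eq_iff extensional_def)
  have "ext \<in> measurable (PiM {..<t} (\<lambda>_. M)) (obs_filtration M t)"
    by (rule measurable_obs_filtrationI) (auto simp: sp re cong: measurable_cong)
  then have 1: "(\<lambda>y. f (ext y)) \<in> borel_measurable (PiM {..<t} (\<lambda>_. M))"
    using assms(1) by (rule measurable_compose)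
  have "f \<omega> = f (ext (restrict \<omega> {..<t}))" if \<omega>: "\<omega> \<in> space (PiM UNIV (\<lambda>_. M))" for \<omega>
  proof -
    have "f -` {f \<omega>} \<inter> space (obs_filtration M t) \<in> sets (obs_filtration M t)"
      using assms(1) by (rule measurable_sets) simp
    then obtain A where A: "f -` {f \<omega>} \<inter> space (PiM UNIV (\<lambda>_. M)) =
        (\<lambda>\<omega>. restrict \<omega> {..<t}) -` A \<inter> space (PiM UNIV (\<lambda>_. M))"
      by (auto simp: sets_obs_filtration)
    have r: "restrict (ext (restrict \<omega> {..<t})) {..<t} = restrict \<omega> {..<t}"
      by (rule re[OF restrict_in_space_PiM[OF \<omega>]])
    have "\<omega> \<in> f -` {f \<omega>} \<inter> space (PiM UNIV (\<lambda>_. M))" using \<omega> by simp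
    then have "ext (restrict \<omega> {..<t}) \<in> f -` {f \<omega>} \<inter> space (PiM UNIV (\<lambda>_. M))"
      unfolding A using r sp[OF restrict_in_space_PiM[OF \<omega>]] by auto
    then show ?thesis by simp
  qed
  with 1 show ?thesis by (rule that)
qed

section \<open>Independence of the past from the next block\<close>

context
  fixes R :: "nat \<Rightarrow> 'a measure" and M :: "'a measure"
  assumes R: "\<And>i. R i \<in> space (prob_algebra M)"
begin

lemma sets_PiM_law: "sets (PiM I R) = sets (PiM I (\<lambda>_. M))"
  by (intro sets_PiM_cong) (auto simp: prob_algebraD(2)[OF R])

lemma space_PiM_law: "space (PiM I R) = space (PiM I (\<lambda>_. M))"
  by (intro sets_eq_imp_space_eq sets_PiM_law)

text \<open>Only the coordinates \<open>t, ..., t + n - 1\<close> need a common law, so the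
  statement serves the null law and the laws after a change alike. It is Fubini on the disjoint
  index sets \<open>{..<t}\<close> and \<open>{t..<t+n}\<close>, after all other coordinates have
  been marginalized.\<close>

lemma nn_integral_restrict_times_block:
  assumes F: "F \<in> borel_measurable (PiM {..<t} (\<lambda>_. M))"
    and g: "g \<in> borel_measurable (iid_n n M)"
    and S: "\<And>i. i < n \<Longrightarrow> R (t + i) = S"
  shows "(\<integral>\<^sup>+\<omega>. F (restrict \<omega> {..<t}) * g (block n t \<omega>) \<partial>PiM UNIV R)
    = (\<integral>\<^sup>+\<omega>. F (restrict \<omega> {..<t}) \<partial>PiM UNIV R) * (\<integral>\<^sup>+x. g x \<partial>iid_n n S)"
proof -
  have R': "prob_space (R i)" for i using prob_algebraD(1)[OF R] .
  interpret product_prob_space R UNIV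
    by (intro product_prob_spaceI R')
  let ?I = "{..<t}" and ?J = "{t..<t+n}"
  have dist: "distr (PiM UNIV R) (PiM K R) (\<lambda>\<omega>. restrict \<omega> K) = PiM K R" for K
    using distr_PiM_reindex[of UNIV R "\<lambda>x. x" K] R' by simp
  have F': "F \<in> borel_measurable (PiM ?I R)"
    using F by (subst measurable_cong_sets[OF sets_PiM_law refl])
  have iid_J: "distr (PiM ?J R) (iid_n n S) (\<lambda>y. \<lambda>i\<in>{..<n}. y (t + i)) = iid_n n S"
  proof -
    have "PiM {..<n} (\<lambda>i. R (t + i)) = iid_n n S"
      unfolding iid_n_def using S by (intro PiM_cong) auto
    then show ?thesis
      using distr_PiM_reindex[of ?J R "\<lambda>i. t + i" "{..<n}"] R' by (simp add: inj_on_def)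
  qed
  \<comment> \<open>For \<open>n = 0\<close> nothing ties \<open>S\<close> to \<open>M\<close>, but
    then both products are over the empty index set.\<close>
  have sets_S: "sets (iid_n n S) = sets (iid_n n M)"
  proof (cases "n = 0")
    case False
    then have "S = R (t + 0)" using S[of 0] by simp
    then show ?thesis unfolding iid_n_def
      using prob_algebraD(2)[OF R] by (intro sets_PiM_cong) auto
  qed (simp add: iid_n_def PiM_empty)
  have g': "g \<in> borel_measurable (iid_n n S)"
    using g by (subst measurable_cong_sets[OF sets_S refl])
  have shift: "(\<lambda>y. \<lambda>i\<in>{..<n}. y (t + i)) \<in> measurable (PiM K R) (iid_n n S)" if "?J \<subseteq> K" for K
  proof -
    have "(\<lambda>y. \<lambda>i\<in>{..<n}. y (t + i)) \<in> measurable (PiM K (\<lambda>_. M)) (iid_n n M)"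
      unfolding iid_n_def using that by (intro measurable_restrict measurable_component_singleton) auto
    then show ?thesis
      by (subst measurable_cong_sets[OF sets_PiM_law sets_S])
  qed
  have Fr: "(\<lambda>z. F (restrict z ?I)) \<in> borel_measurable (PiM K R)" if "?I \<subseteq> K" for K
    using that by (intro measurable_compose[OF measurable_restrict_subset F'])
  have Fg: "(\<lambda>z. F (restrict z ?I) * g (\<lambda>i\<in>{..<n}. z (t + i))) \<in> borel_measurable (PiM (?I \<union> ?J) R)"
    by (rule borel_measurable_times_ennreal[OF Fr measurable_compose[OF shift g']]) auto
  have "(\<integral>\<^sup>+\<omega>. F (restrict \<omega> ?I) * g (block n t \<omega>) \<partial>PiM UNIV R) =
    (\<integral>\<^sup>+\<omega>. (\<lambda>z. F (restrict z ?I) * g (\<lambda>i\<in>{..<n}. z (t + i))) (restrict \<omega> (?I \<union> ?J)) \<partial>PiM UNIV R)"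
  proof (intro nn_integral_cong)
    fix \<omega> :: "nat \<Rightarrow> 'a"
    have "block n t \<omega> = (\<lambda>i\<in>{..<n}. restrict \<omega> (?I \<union> ?J) (t + i))"
      by (auto simp: block_def fun_eq_iff)
    moreover have "restrict (restrict \<omega> (?I \<union> ?J)) ?I = restrict \<omega> ?I"
      by (auto simp: fun_eq_iff)
    ultimately show "F (restrict \<omega> ?I) * g (block n t \<omega>) =
      (\<lambda>z. F (restrict z ?I) * g (\<lambda>i\<in>{..<n}. z (t + i))) (restrict \<omega> (?I \<union> ?J))" by simp
  qed
  also have "\<dots> = (\<integral>\<^sup>+z. F (restrict z ?I) * g (\<lambda>i\<in>{..<n}. z (t + i))
      \<partial>distr (PiM UNIV R) (PiM (?I \<union> ?J) R) (\<lambda>\<omega>. restrict \<omega> (?I \<union> ?J)))"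
    by (intro nn_integral_distr[symmetric] measurable_restrict_subset subset_UNIV)
      (use Fg in \<open>simp add: measurable_distr_eq1\<close>)
  also have "\<dots> = (\<integral>\<^sup>+z. F (restrict z ?I) * g (\<lambda>i\<in>{..<n}. z (t + i)) \<partial>PiM (?I \<union> ?J) R)"
    by (simp only: dist)
  also have "\<dots> = (\<integral>\<^sup>+x. (\<integral>\<^sup>+y. F (restrict (merge ?I ?J (x, y)) ?I) *
        g (\<lambda>i\<in>{..<n}. merge ?I ?J (x, y) (t + i)) \<partial>PiM ?J R) \<partial>PiM ?I R)"
    by (rule product_nn_integral_fold[OF _ _ _ Fg]) auto
  also have "\<dots> = (\<integral>\<^sup>+x. (\<integral>\<^sup>+y. F x * g (\<lambda>i\<in>{..<n}. y (t + i)) \<partial>PiM ?J R) \<partial>PiM ?I R)"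
  proof (intro nn_integral_cong)
    fix x y assume x: "x \<in> space (PiM ?I R)" and y: "y \<in> space (PiM ?J R)"
    have "restrict (merge ?I ?J (x, y)) ?I = x"
      using x by (auto simp: merge_def fun_eq_iff space_PiM PiE_iff extensional_def)
    moreover have "(\<lambda>i\<in>{..<n}. merge ?I ?J (x, y) (t + i)) = (\<lambda>i\<in>{..<n}. y (t + i))"
      by (auto simp: merge_def fun_eq_iff)
    ultimately show "F (restrict (merge ?I ?J (x, y)) ?I) *
        g (\<lambda>i\<in>{..<n}. merge ?I ?J (x, y) (t + i)) = F x * g (\<lambda>i\<in>{..<n}. y (t + i))" by simp
  qed
  also have "\<dots> = (\<integral>\<^sup>+x. F x * (\<integral>\<^sup>+y. g (\<lambda>i\<in>{..<n}. y (t + i)) \<partial>PiM ?J R) \<partial>PiM ?I R)"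
    by (intro nn_integral_cong nn_integral_cmult measurable_compose[OF shift g']) auto
  also have "(\<integral>\<^sup>+y. g (\<lambda>i\<in>{..<n}. y (t + i)) \<partial>PiM ?J R) = (\<integral>\<^sup>+x. g x \<partial>iid_n n S)"
    by (subst iid_J[symmetric], intro nn_integral_distr[symmetric] shift order_refl)
      (use g' in \<open>simp add: measurable_distr_eq1\<close>)
  also have "(\<integral>\<^sup>+x. F x * (\<integral>\<^sup>+x. g x \<partial>iid_n n S) \<partial>PiM ?I R)
      = (\<integral>\<^sup>+x. F x \<partial>PiM ?I R) * (\<integral>\<^sup>+x. g x \<partial>iid_n n S)"
    by (intro nn_integral_multc F')
  also have "(\<integral>\<^sup>+x. F x \<partial>PiM ?I R) = (\<integral>\<^sup>+\<omega>. F (restrict \<omega> ?I) \<partial>PiM UNIV R)"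
    by (subst dist[symmetric], intro nn_integral_distr measurable_restrict_subset subset_UNIV)
      (use F' in \<open>simp add: measurable_distr_eq1\<close>)
  finally show ?thesis .
qed

end

section \<open>The joint filtration of observations and randomization\<close>

locale change_model =
  fixes M :: "'a measure" and U :: "'b measure" and G :: "nat \<Rightarrow> 'b measure"
  assumes aux: "aux_randomization U G" and space_nonempty: "space M \<noteq> {}"
begin

abbreviation F :: "nat \<Rightarrow> ((nat \<Rightarrow> 'a) \<times> 'b) measure" where
  "F \<equiv> full_filtration M G"

lemma prob_U: "prob_space U" and space_G [simp]: "space (G t) = space U"
  and sets_G: "sets (G t) \<subseteq> sets U" and sets_G_mono: "s \<le> t \<Longrightarrow> sets (G s) \<subseteq> sets (G t)"
  using aux by (auto simp: aux_randomization_def filtration_def)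

lemma space_F [simp]: "space (F t) = sample_space M U"
  by (simp add: full_filtration_def sample_space_def space_pair_measure)

lemma measurable_ident_F_mono:
  assumes "s \<le> t"
  shows "(\<lambda>\<omega>. \<omega>) \<in> measurable (F t) (F s)"
proof -
  have "(\<lambda>u. u) \<in> measurable (G t) (G s)"
    using sets_G_mono[OF assms] by (auto simp: measurable_def dest: sets.sets_into_space)
  then have "(\<lambda>\<omega>. (fst \<omega>, snd \<omega>)) \<in> measurable (F t) (F s)"
    unfolding full_filtration_def
    by (intro measurable_Pair measurable_compose[OF measurable_fst]
        measurable_compose[OF measurable_snd] measurable_obs_filtration_mono assms)
  then show ?thesis by simp
qed

lemma measurable_F_mono:
  "f \<in> measurable (F s) N \<Longrightarrow> s \<le> t \<Longrightarrow> f \<in> measurable (F t) N"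
  using measurable_compose[OF measurable_ident_F_mono] by blast

lemma measurable_block_F:
  "s + n \<le> t \<Longrightarrow> (\<lambda>\<omega>. block n s (fst \<omega>)) \<in> measurable (F t) (iid_n n M)"
  unfolding full_filtration_def
  by (intro measurable_compose[OF measurable_fst measurable_block_obs_filtration])

lemma ext_stopping_time_const: "ext_stopping_time F (\<lambda>_. c)"
  by (simp add: ext_stopping_time_def)

lemma ext_stopping_time_enat:
  assumes "ext_stopping_time F T"
  shows "s \<le> t \<Longrightarrow> Measurable.pred (F t) (\<lambda>\<omega>. T \<omega> \<le> enat s)"
    and "s \<le> t \<Longrightarrow> Measurable.pred (F t) (\<lambda>\<omega>. enat s < T \<omega>)"
    and "s \<le> t \<Longrightarrow> Measurable.pred (F t) (\<lambda>\<omega>. T \<omega> = enat s)"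
proof -
  have 1: "Measurable.pred (F t) (\<lambda>\<omega>. T \<omega> \<le> enat s)" if "s \<le> t" for s t
    by (rule measurable_F_mono[OF _ that]) (use assms in \<open>simp add: ext_stopping_time_def\<close>)
  then show "s \<le> t \<Longrightarrow> Measurable.pred (F t) (\<lambda>\<omega>. T \<omega> \<le> enat s)" .
  have 2: "Measurable.pred (F t) (\<lambda>\<omega>. enat s < T \<omega>)" if "s \<le> t" for s t
    using pred_intros_logic(2)[OF 1[OF that]] by (simp add: not_le)
  then show "s \<le> t \<Longrightarrow> Measurable.pred (F t) (\<lambda>\<omega>. enat s < T \<omega>)" .
  assume "s \<le> t"
  have "(T \<omega> = enat s) \<longleftrightarrow> T \<omega> \<le> enat s \<and> (s = 0 \<or> enat (s - 1) < T \<omega>)" for \<omega>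
    by (cases "T \<omega>"; cases s) auto
  then show "Measurable.pred (F t) (\<lambda>\<omega>. T \<omega> = enat s)"
    using 1[of s t] 2[of "s - 1" t] \<open>s \<le> t\<close> by (cases "s = 0") (auto intro!: pred_intros_logic)
qed

lemma ext_stopping_time_min:
  assumes "ext_stopping_time F S" "ext_stopping_time F T"
  shows "ext_stopping_time F (\<lambda>\<omega>. min (S \<omega>) (T \<omega>))"
  using assms unfolding ext_stopping_time_def min_le_iff_disj by (auto intro!: pred_intros_logic)

context
  fixes R :: "nat \<Rightarrow> 'a measure"
  assumes R: "\<And>i. R i \<in> space (prob_algebra M)"
begin

lemma space_obs_law: "space (obs_law U R) = sample_space M U"
  by (simp add: obs_law_def sample_space_def space_pair_measure space_PiM_law[OF R])

lemma prob_space_PiM_law: "prob_space (PiM UNIV R)"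
  using prob_algebraD(1)[OF R] by (intro prob_space_PiM) auto

lemma prob_space_obs_law: "prob_space (obs_law U R)"
proof -
  interpret U: prob_space U by (rule prob_U)
  interpret X: prob_space "PiM UNIV R" by (rule prob_space_PiM_law)
  interpret pair_prob_space "PiM UNIV R" U ..
  show ?thesis unfolding obs_law_def by (rule P.prob_space_axioms)
qed

lemma measurable_ident_obs_law: "(\<lambda>\<omega>. \<omega>) \<in> measurable (obs_law U R) (F t)"
proof -
  have 1: "(\<lambda>u. u) \<in> measurable U (G t)"
    using sets_G by (auto simp: measurable_def dest: sets.sets_into_space)
  have "(\<lambda>\<omega>. \<omega>) \<in> measurable (PiM UNIV R) (obs_filtration M t)"
    using measurable_ident_obs_filtration[of M t]
    by (subst measurable_cong_sets[OF sets_PiM_law[OF R] refl])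
  then have "(\<lambda>\<omega>. (fst \<omega>, snd \<omega>)) \<in> measurable (obs_law U R) (F t)"
    unfolding full_filtration_def obs_law_def
    by (intro measurable_Pair measurable_compose[OF measurable_fst]
        measurable_compose[OF measurable_snd] 1)
  then show ?thesis by simp
qed

lemma measurable_F_obs_law: "f \<in> measurable (F t) N \<Longrightarrow> f \<in> measurable (obs_law U R) N"
  using measurable_compose[OF measurable_ident_obs_law] by blast

lemma subalgebra_F: "subalgebra (obs_law U R) (F t)"
proof -
  have "A \<in> sets (obs_law U R)" if "A \<in> sets (F t)" for A
    using measurable_sets[OF measurable_ident_obs_law that] sets.sets_into_space[OF that]
    by (simp add: space_obs_law Int_absorb2)
  then show ?thesis by (auto simp: subalgebra_def space_obs_law)
qed

lemma sigma_finite_subalgebra_F: "sigma_finite_subalgebra (obs_law U R) (F t)"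
proof -
  interpret prob_space "obs_law U R" by (rule prob_space_obs_law)
  show ?thesis
    by (intro finite_measure_subalgebra_is_sigma_finite finite_measure_subalgebra.intro
        finite_measure_axioms finite_measure_subalgebra_axioms.intro subalgebra_F)
qed

lemma measurable_block_obs_law: "(\<lambda>\<omega>. block n s (fst \<omega>)) \<in> measurable (obs_law U R) (iid_n n M)"
  by (rule measurable_F_obs_law[OF measurable_block_F[OF order_refl]])

text \<open>The auxiliary coordinate is frozen and integrated last: each section of an
  \<open>F t\<close>-measurable \<open>f\<close> depends only on the first \<open>t\<close>
  observations, so independence under the product law applies to it.\<close>

lemma nn_integral_F_times_block:
  assumes f: "f \<in> borel_measurable (F t)" and g: "g \<in> borel_measurable (iid_n n M)"
    and S: "\<And>i. i < n \<Longrightarrow> R (t + i) = S"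
  shows "(\<integral>\<^sup>+\<omega>. f \<omega> * g (block n t (fst \<omega>)) \<partial>obs_law U R)
    = (\<integral>\<^sup>+\<omega>. f \<omega> \<partial>obs_law U R) * (\<integral>\<^sup>+x. g x \<partial>iid_n n S)"
proof -
  interpret U: prob_space U by (rule prob_U)
  interpret X: prob_space "PiM UNIV R" by (rule prob_space_PiM_law)
  interpret pair_prob_space "PiM UNIV R" U ..
  have f': "f \<in> borel_measurable (PiM UNIV R \<Otimes>\<^sub>M U)"
    using measurable_F_obs_law[OF f] by (simp add: obs_law_def)
  have fg: "(\<lambda>\<omega>. f \<omega> * g (block n t (fst \<omega>))) \<in> borel_measurable (PiM UNIV R \<Otimes>\<^sub>M U)"
    using f' measurable_compose[OF measurable_block_obs_law g]
    by (simp add: obs_law_def borel_measurable_times_ennreal)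
  have "(\<integral>\<^sup>+\<omega>. f \<omega> * g (block n t (fst \<omega>)) \<partial>obs_law U R)
    = (\<integral>\<^sup>+u. (\<integral>\<^sup>+x. f (x, u) * g (block n t x) \<partial>PiM UNIV R) \<partial>U)"
    unfolding obs_law_def using nn_integral_snd[OF fg] by simp
  also have "\<dots> = (\<integral>\<^sup>+u. (\<integral>\<^sup>+x. f (x, u) \<partial>PiM UNIV R) * (\<integral>\<^sup>+x. g x \<partial>iid_n n S) \<partial>U)"
  proof (intro nn_integral_cong)
    \<comment> \<open>\<open>H\<close> is chosen separately for every \<open>u\<close>; joint
      measurability is not an issue because \<open>H\<close> is eliminated again before the integral
      over \<open>u\<close>.\<close>
    fix u assume u: "u \<in> space U"
    have "(\<lambda>x. f (x, u)) \<in> borel_measurable (obs_filtration M t)"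
      by (rule measurable_Pair1[OF f[unfolded full_filtration_def]]) (simp add: u)
    from obs_filtration_factor[OF this space_nonempty] obtain H where
      H: "H \<in> borel_measurable (PiM {..<t} (\<lambda>_. M))"
        "\<And>x. x \<in> space (PiM UNIV (\<lambda>_. M)) \<Longrightarrow> f (x, u) = H (restrict x {..<t})"
      by blast
    have *: "(\<integral>\<^sup>+x. f (x, u) * h x \<partial>PiM UNIV R) = (\<integral>\<^sup>+x. H (restrict x {..<t}) * h x \<partial>PiM UNIV R)" for h
      by (intro nn_integral_cong) (simp add: H(2) space_PiM_law[OF R])
    show "(\<integral>\<^sup>+x. f (x, u) * g (block n t x) \<partial>PiM UNIV R) =
      (\<integral>\<^sup>+x. f (x, u) \<partial>PiM UNIV R) * (\<integral>\<^sup>+x. g x \<partial>iid_n n S)"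
      using nn_integral_restrict_times_block[of R M H t g n S, OF R H(1) g S] *[of "\<lambda>_. 1"]
      by (simp add: *)
  qed
  also have "\<dots> = (\<integral>\<^sup>+u. (\<integral>\<^sup>+x. f (x, u) \<partial>PiM UNIV R) \<partial>U) * (\<integral>\<^sup>+x. g x \<partial>iid_n n S)"
    using f' by (intro nn_integral_multc) (auto intro!: X.borel_measurable_nn_integral simp: split_beta)
  also have "(\<integral>\<^sup>+u. (\<integral>\<^sup>+x. f (x, u) \<partial>PiM UNIV R) \<partial>U) = (\<integral>\<^sup>+\<omega>. f \<omega> \<partial>obs_law U R)"
    unfolding obs_law_def using nn_integral_snd[OF f'] by simp
  finally show ?thesis .
qed

end

end

section \<open>Detectors from betting functions\<close>

text \<open>The wealth of a gambler who starts after \<open>s\<close> observations and stakes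
  everything on each block; for a change at \<nu> the relevant start is
  \<open>s = \<nu> - 1\<close>.\<close>

definition block_prod :: "((nat \<Rightarrow> 'a) \<Rightarrow> ennreal) \<Rightarrow> nat \<Rightarrow> nat \<Rightarrow> nat \<Rightarrow> (nat \<Rightarrow> 'a) \<Rightarrow> ennreal" where
  "block_prod e n s k \<omega> = (\<Prod>i<k. e (block n (s + i * n) \<omega>))"

text \<open>In the middle of a block the wealth counts as 0, not as its last value: a stopping time could
  end in the middle of exactly the unfavourable blocks, and the last value would not stay fair.\<close>

definition block_detector :: "((nat \<Rightarrow> 'a) \<Rightarrow> ennreal) \<Rightarrow> nat \<Rightarrow> nat \<Rightarrow> (nat \<Rightarrow> 'a) \<Rightarrow> ennreal" where
  "block_detector e n t \<omega> = (\<Sum>s<t. if n dvd t - s then block_prod e n s ((t - s) div n) \<omega> else 0)"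

text \<open>The deterministic part \<open>(1 - \<delta>) t\<close> bounds the alarm times, so that no randomization is needed
  for the upper bound on the mean times.\<close>

definition mixture_detector ::
  "real \<Rightarrow> (nat \<Rightarrow> (nat \<Rightarrow> 'a) \<Rightarrow> ennreal) \<Rightarrow> (nat \<Rightarrow> nat) \<Rightarrow> nat \<Rightarrow> (nat \<Rightarrow> 'a) \<times> 'b \<Rightarrow> ennreal" where
  "mixture_detector \<delta> e n t \<omega> = ennreal (1 - \<delta>) * of_nat t +
     ennreal \<delta> * (\<Sum>m. ennreal ((1/2) ^ Suc m) * block_detector (e m) (n m) t (fst \<omega>))"

lemma borel_measurable_of_bool:
  assumes [measurable]: "Measurable.pred N Q"
  shows "(\<lambda>\<omega>. of_bool (Q \<omega>) :: ennreal) \<in> borel_measurable N"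
  unfolding of_bool_def by measurable

lemma suminf_half_powers: "(\<Sum>m. ennreal ((1/2) ^ Suc m) * c) = c"
proof -
  have "(\<Sum>m. ennreal ((1/2::real) ^ Suc m)) = ennreal 1"
    using power_half_series by (intro suminf_ennreal_eq) auto
  then show ?thesis by simp
qed

lemma measurable_block_prod_obs_filtration:
  assumes "e \<in> borel_measurable (iid_n n M)" "s + k * n \<le> t"
  shows "block_prod e n s k \<in> borel_measurable (obs_filtration M t)"
proof -
  have "s + i * n + n \<le> t" if "i < k" for i
  proof -
    have "Suc i * n \<le> k * n" using that by (intro mult_le_mono1) auto
    then show ?thesis using assms(2) by simp
  qed
  then have "(\<lambda>\<omega>. block_prod e n s k \<omega>) \<in> borel_measurable (obs_filtration M t)"
    unfolding block_prod_def
    by (intro borel_measurable_prod_ennreal measurable_compose[OF measurable_block_obs_filtration assms(1)]) auto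
  then show ?thesis .
qed

text \<open>Turns the divisibility test into a double series over the start and the number of
  completed blocks. In this form a random time can replace \<open>t\<close>, and expectation and
  summation can be exchanged. The series runs over \<open>Suc k\<close> because
  \<open>s < t\<close>.\<close>

lemma block_detector_eq_suminf:
  assumes "1 \<le> n"
  shows "block_detector e n t \<omega> =
    (\<Sum>s. \<Sum>k. block_prod e n s (Suc k) \<omega> * indicator {t} (s + Suc k * n))"
proof -
  have "(\<Sum>k. block_prod e n s (Suc k) \<omega> * indicator {t} (s + Suc k * n)) =
    (if s < t \<and> n dvd t - s then block_prod e n s ((t - s) div n) \<omega> else 0)" for s
  proof (cases "s < t \<and> n dvd t - s")
    case True
    then obtain k where k: "t - s = n * k" by (auto elim: dvdE)
    with True obtain k' where k': "k = Suc k'" by (cases k) auto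
    have t: "t = s + Suc k' * n" using k k' True by (auto simp: algebra_simps)
    have "(\<Sum>k. block_prod e n s (Suc k) \<omega> * indicator {t} (s + Suc k * n)) =
      (\<Sum>k\<in>{k'}. block_prod e n s (Suc k) \<omega> * indicator {t} (s + Suc k * n))"
      using assms by (intro suminf_finite) (auto simp: t indicator_def)
    also have "\<dots> = block_prod e n s ((t - s) div n) \<omega>"
      using k k' assms by (simp add: t)
    finally show ?thesis using True by simp
  next
    case False
    then have "s + Suc k * n \<noteq> t" for k using assms by auto
    then show ?thesis using False by (auto simp: indicator_def)
  qed
  then have "(\<Sum>s. \<Sum>k. block_prod e n s (Suc k) \<omega> * indicator {t} (s + Suc k * n)) =
    (\<Sum>s. if s < t \<and> n dvd t - s then block_prod e n s ((t - s) div n) \<omega> else 0)" by simp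
  also have "\<dots> = (\<Sum>s<t. if s < t \<and> n dvd t - s then block_prod e n s ((t - s) div n) \<omega> else 0)"
    by (intro suminf_finite) auto
  also have "\<dots> = block_detector e n t \<omega>"
    unfolding block_detector_def by (intro sum.cong) auto
  finally show ?thesis by simp
qed

context change_model
begin

lemma measurable_block_prod:
  assumes "e \<in> borel_measurable (iid_n n M)" "s + k * n \<le> t"
  shows "(\<lambda>\<omega>. block_prod e n s k (fst \<omega>)) \<in> borel_measurable (F t)"
  unfolding full_filtration_def
  by (rule measurable_compose[OF measurable_fst measurable_block_prod_obs_filtration[OF assms]])

text \<open>The factor \<open>f\<close>, known at time \<open>s\<close>, stands for the
  conditioning: with the indicator of an event of \<open>F s\<close> this computes a conditional
  expectation without forming one.\<close>

lemma nn_integral_block_prod: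
  assumes R: "\<And>i. R i \<in> space (prob_algebra M)" and S: "\<And>i. s \<le> i \<Longrightarrow> R i = S"
    and e: "e \<in> borel_measurable (iid_n n M)" and f: "f \<in> borel_measurable (F s)"
  shows "(\<integral>\<^sup>+\<omega>. f \<omega> * block_prod e n s k (fst \<omega>) \<partial>obs_law U R)
    = (\<integral>\<^sup>+\<omega>. f \<omega> \<partial>obs_law U R) * (\<integral>\<^sup>+x. e x \<partial>iid_n n S) ^ k"
proof (induction k)
  case 0
  then show ?case by (simp add: block_prod_def)
next
  case (Suc k)
  have m: "(\<lambda>\<omega>. f \<omega> * block_prod e n s k (fst \<omega>)) \<in> borel_measurable (F (s + k * n))"
    by (intro borel_measurable_times_ennreal measurable_block_prod e measurable_F_mono[OF f]) auto
  have "(\<integral>\<^sup>+\<omega>. f \<omega> * block_prod e n s (Suc k) (fst \<omega>) \<partial>obs_law U R) =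
    (\<integral>\<^sup>+\<omega>. f \<omega> * block_prod e n s k (fst \<omega>) * e (block n (s + k * n) (fst \<omega>)) \<partial>obs_law U R)"
    by (simp add: block_prod_def mult.assoc)
  also have "\<dots> = (\<integral>\<^sup>+\<omega>. f \<omega> * block_prod e n s k (fst \<omega>) \<partial>obs_law U R) * (\<integral>\<^sup>+x. e x \<partial>iid_n n S)"
    using S by (intro nn_integral_F_times_block R m e) auto
  also have "\<dots> = (\<integral>\<^sup>+\<omega>. f \<omega> \<partial>obs_law U R) * (\<integral>\<^sup>+x. e x \<partial>iid_n n S) ^ Suc k"
    by (simp add: Suc ac_simps)
  finally show ?case .
qed

lemma measurable_enat_obs_law:
  assumes "\<And>i. R i \<in> space (prob_algebra M)" "ext_stopping_time F \<tau>"
  shows "\<tau> \<in> measurable (obs_law U R) (count_space UNIV)"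
proof (rule measurable_count_space_eq2_countable[THEN iffD2], intro conjI ballI)
  have eq: "\<tau> -` {enat t} \<inter> space (obs_law U R) \<in> sets (obs_law U R)" for t
  proof -
    have "Measurable.pred (obs_law U R) (\<lambda>\<omega>. \<tau> \<omega> = enat t)"
      by (rule measurable_F_obs_law[OF assms(1) ext_stopping_time_enat(3)[OF assms(2) order_refl]])
    then have "{\<omega>\<in>space (obs_law U R). \<tau> \<omega> = enat t} \<in> sets (obs_law U R)" by measurable
    then show ?thesis by (simp add: vimage_def Int_def conj_commute)
  qed
  fix a
  show "\<tau> -` {a} \<inter> space (obs_law U R) \<in> sets (obs_law U R)"
  proof (cases a)
    case infinity
    have "\<tau> -` {a} \<inter> space (obs_law U R) =
        space (obs_law U R) - (\<Union>t. \<tau> -` {enat t} \<inter> space (obs_law U R))"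
      unfolding infinity by (auto simp: not_infinity_eq)
    moreover have "(\<Union>t. \<tau> -` {enat t} \<inter> space (obs_law U R)) \<in> sets (obs_law U R)"
      by (rule sets.countable_nat_UN) (use eq in blast)
    ultimately show ?thesis by (metis sets.compl_sets)
  qed (simp add: eq)
qed auto

text \<open>Rounding the stopping time up to the end of the current block gives a stopping time for the block
  filtration, along which the products form a supermartingale; the induction telescopes this.\<close>

lemma stopped_block_prod_bound:
  assumes P: "P \<in> space (prob_algebra M)" and e: "e \<in> borel_measurable (iid_n n M)"
    and e1: "(\<integral>\<^sup>+x. e x \<partial>iid_n n P) \<le> 1" and n: "1 \<le> n" and \<tau>: "ext_stopping_time F \<tau>"
  shows "(\<Sum>k. \<integral>\<^sup>+\<omega>. block_prod e n s (Suc k) (fst \<omega>) *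
      of_bool (\<tau> \<omega> = enat (s + Suc k * n)) \<partial>null_law U P)
    \<le> emeasure (null_law U P) {\<omega>\<in>space (null_law U P). enat s < \<tau> \<omega>}"
proof -
  let ?L = "obs_law U (\<lambda>_. P)"
  note mb = measurable_block_prod[OF e]
  note toL = measurable_F_obs_law[of "\<lambda>_. P", OF P]
  \<comment> \<open>\<open>a k\<close> is the mean wealth still in play after \<open>k\<close>
    blocks, \<open>b k\<close> the part cashed by stopping exactly at the end of the next block;
    wealth stopped inside a block is forfeited.\<close>
  define a where "a k = (\<integral>\<^sup>+\<omega>. block_prod e n s k (fst \<omega>) * of_bool (enat (s + k * n) < \<tau> \<omega>) \<partial>?L)" for k
  define b where "b k = (\<integral>\<^sup>+\<omega>. block_prod e n s (Suc k) (fst \<omega>) * of_bool (\<tau> \<omega> = enat (s + Suc k * n)) \<partial>?L)" for k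
  have step: "b k + a (Suc k) \<le> a k" for k
  proof -
    have m: "(\<lambda>\<omega>. block_prod e n s k (fst \<omega>) * of_bool (enat (s + k * n) < \<tau> \<omega>)) \<in> borel_measurable (F (s + k * n))"
      by (intro borel_measurable_times_ennreal mb borel_measurable_of_bool ext_stopping_time_enat[OF \<tau>]) auto
    have "b k + a (Suc k) = (\<integral>\<^sup>+\<omega>. block_prod e n s (Suc k) (fst \<omega>) * of_bool (\<tau> \<omega> = enat (s + Suc k * n)) +
        block_prod e n s (Suc k) (fst \<omega>) * of_bool (enat (s + Suc k * n) < \<tau> \<omega>) \<partial>?L)"
      unfolding a_def b_def
      by (intro nn_integral_add[symmetric] toL[of _ "s + Suc k * n"] borel_measurable_times_ennreal mb borel_measurable_of_bool
          ext_stopping_time_enat[OF \<tau>]) auto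
    \<comment> \<open>The two events on the left are disjoint and, as \<open>n \<ge> 1\<close>, both
      lie in \<open>{s + k * n < \<tau>}\<close>.\<close>
    also have "\<dots> \<le> (\<integral>\<^sup>+\<omega>. block_prod e n s k (fst \<omega>) * of_bool (enat (s + k * n) < \<tau> \<omega>) * e (block n (s + k * n) (fst \<omega>)) \<partial>?L)"
    proof (intro nn_integral_mono)
      fix \<omega>
      show "block_prod e n s (Suc k) (fst \<omega>) * of_bool (\<tau> \<omega> = enat (s + Suc k * n)) +
        block_prod e n s (Suc k) (fst \<omega>) * of_bool (enat (s + Suc k * n) < \<tau> \<omega>)
        \<le> block_prod e n s k (fst \<omega>) * of_bool (enat (s + k * n) < \<tau> \<omega>) * e (block n (s + k * n) (fst \<omega>))"
        using n by (cases "\<tau> \<omega>") (auto simp: block_prod_def)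
    qed
    also have "\<dots> = a k * (\<integral>\<^sup>+x. e x \<partial>iid_n n P)"
      unfolding a_def using P by (intro nn_integral_F_times_block m e) auto
    also have "\<dots> \<le> a k" using mult_left_mono[OF e1, of "a k"] by simp
    finally show ?thesis .
  qed
  have "(\<Sum>k<K. b k) + a K \<le> a 0" for K
  proof (induction K)
    case (Suc K)
    have "(\<Sum>k<Suc K. b k) + a (Suc K) = (\<Sum>k<K. b k) + (b K + a (Suc K))" by (simp add: add.assoc)
    also have "\<dots> \<le> (\<Sum>k<K. b k) + a K" by (intro add_left_mono step)
    also have "\<dots> \<le> a 0" by (rule Suc.IH)
    finally show ?case .
  qed simp
  then have "(\<Sum>k<K. b k) \<le> a 0" for K
    by (metis add_increasing2 dual_order.trans order_refl zero_le)
  then have "suminf b \<le> a 0" by (intro suminf_le_const) auto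
  also have "a 0 = emeasure ?L {\<omega>\<in>space ?L. enat s < \<tau> \<omega>}"
  proof -
    have meas: "{\<omega>\<in>space ?L. enat s < \<tau> \<omega>} \<in> sets ?L"
      using toL[OF ext_stopping_time_enat(2)[OF \<tau> order_refl, of s]] by measurable
    have "a 0 = (\<integral>\<^sup>+\<omega>. indicator {\<omega>\<in>space ?L. enat s < \<tau> \<omega>} \<omega> \<partial>?L)"
      unfolding a_def by (intro nn_integral_cong) (auto simp: block_prod_def indicator_def)
    then show ?thesis using meas by simp
  qed
  finally show ?thesis unfolding b_def null_law_eq .
qed

text \<open>Each start \<open>s\<close> contributes at most the probability of
  \<open>s < \<tau>\<close>, and these tail probabilities sum to the mean of \<tau>. This is what
  makes the sum over all starts satisfy the e-detector inequality.\<close>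

lemma stopped_block_detector_bound:
  assumes P: "P \<in> space (prob_algebra M)" and e: "e \<in> borel_measurable (iid_n n M)"
    and e1: "(\<integral>\<^sup>+x. e x \<partial>iid_n n P) \<le> 1" and n: "1 \<le> n" and \<tau>: "ext_stopping_time F \<tau>"
  shows "(\<integral>\<^sup>+\<omega>. (\<Sum>s. \<Sum>k. block_prod e n s (Suc k) (fst \<omega>) *
      of_bool (\<tau> \<omega> = enat (s + Suc k * n))) \<partial>null_law U P) \<le> mean_time (null_law U P) \<tau>"
    and "(\<lambda>\<omega>. \<Sum>s. \<Sum>k. block_prod e n s (Suc k) (fst \<omega>) *
      of_bool (\<tau> \<omega> = enat (s + Suc k * n)) :: ennreal) \<in> borel_measurable (null_law U P)"
proof -
  have m: "(\<lambda>\<omega>. block_prod e n s (Suc k) (fst \<omega>) * of_bool (\<tau> \<omega> = enat (s + Suc k * n)) :: ennreal)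
    \<in> borel_measurable (null_law U P)" for s k
    unfolding null_law_eq
    by (intro measurable_F_obs_law[of _ _ "s + Suc k * n"] P borel_measurable_times_ennreal
        measurable_block_prod[OF e] borel_measurable_of_bool ext_stopping_time_enat(3)[OF \<tau>]) auto
  then show "(\<lambda>\<omega>. \<Sum>s. \<Sum>k. block_prod e n s (Suc k) (fst \<omega>) *
      of_bool (\<tau> \<omega> = enat (s + Suc k * n)) :: ennreal) \<in> borel_measurable (null_law U P)"
    by measurable
  have "(\<integral>\<^sup>+\<omega>. (\<Sum>s. \<Sum>k. block_prod e n s (Suc k) (fst \<omega>) *
      of_bool (\<tau> \<omega> = enat (s + Suc k * n))) \<partial>null_law U P) =
    (\<Sum>s. \<Sum>k. \<integral>\<^sup>+\<omega>. block_prod e n s (Suc k) (fst \<omega>) *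
      of_bool (\<tau> \<omega> = enat (s + Suc k * n)) \<partial>null_law U P)"
    using m by (subst nn_integral_suminf, measurable) (simp add: nn_integral_suminf)
  also have "\<dots> \<le> (\<Sum>s. emeasure (null_law U P) {\<omega>\<in>space (null_law U P). enat s < \<tau> \<omega>})"
    by (intro suminf_le stopped_block_prod_bound assms) auto
  also have "\<dots> = mean_time (null_law U P) \<tau>"
    unfolding mean_time_def null_law_eq
    by (rule nn_integral_enat_function[symmetric], rule measurable_enat_obs_law) (use P \<tau> in auto)
  finally show "(\<integral>\<^sup>+\<omega>. (\<Sum>s. \<Sum>k. block_prod e n s (Suc k) (fst \<omega>) *
      of_bool (\<tau> \<omega> = enat (s + Suc k * n))) \<partial>null_law U P) \<le> mean_time (null_law U P) \<tau>" .
qed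

text \<open>The defining inequality is preserved by convex combinations: time itself satisfies it
  with equality, every block detector satisfies it, and both the pair \<open>1 - \<delta>\<close>,
  \<delta> and the halving weights sum to 1.\<close>

lemma mixture_detector_e_detector:
  assumes \<P>: "\<P> \<subseteq> space (prob_algebra M)" and \<delta>: "0 \<le> \<delta>" "\<delta> \<le> 1"
    and e: "\<And>m. e m \<in> borel_measurable (iid_n (n m) M)" and n: "\<And>m. 1 \<le> n m"
    and e1: "\<And>m P. P \<in> \<P> \<Longrightarrow> (\<integral>\<^sup>+x. e m x \<partial>iid_n (n m) P) \<le> 1"
  shows "e_detector M U G \<P> (mixture_detector \<delta> e n)"
  unfolding e_detector_def
proof (intro conjI ballI allI impI)
  fix t
  have "(\<lambda>\<omega>. block_detector (e m) (n m) t (fst \<omega>)) \<in> borel_measurable (F t)" for m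
    unfolding block_detector_def
  proof (intro borel_measurable_sum)
    fix s assume "s \<in> {..<t}"
    then show "(\<lambda>\<omega>. if n m dvd t - s then block_prod (e m) (n m) s ((t - s) div n m) (fst \<omega>) else 0)
        \<in> borel_measurable (F t)"
      by (cases "n m dvd t - s") (auto intro!: measurable_block_prod[OF e])
  qed
  then show "mixture_detector \<delta> e n t \<in> borel_measurable (F t)"
    unfolding mixture_detector_def by measurable
next
  fix \<omega> show "mixture_detector \<delta> e n 0 \<omega> = 0"
    by (simp add: mixture_detector_def block_detector_def)
next
  fix P \<tau> assume P: "P \<in> \<P>" and \<tau>: "ext_stopping_time F \<tau>"
  let ?L = "null_law U P"
  have P': "P \<in> space (prob_algebra M)" using P \<P> by auto
  have \<tau>m [measurable]: "\<tau> \<in> measurable ?L (count_space UNIV)"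
    unfolding null_law_eq using P' by (intro measurable_enat_obs_law \<tau>)
  show "(\<integral>\<^sup>+\<omega>. stopped_value (mixture_detector \<delta> e n) \<tau> \<omega> \<partial>?L) \<le> mean_time ?L \<tau>"
  \<comment> \<open>With infinite mean the claim is trivial; with finite mean \<tau> is almost
    surely finite, so the liminf value at \<infinity> is almost surely not met.\<close>
  proof (cases "mean_time ?L \<tau> = \<infinity>")
    case False
    then have "AE \<omega> in ?L. ennreal_of_enat (\<tau> \<omega>) \<noteq> \<infinity>"
      unfolding mean_time_def by (intro nn_integral_PInf_AE) auto
    define X where "X m \<omega> = (\<Sum>s. \<Sum>k. block_prod (e m) (n m) s (Suc k) (fst \<omega>) *
      of_bool (\<tau> \<omega> = enat (s + Suc k * n m)) :: ennreal)" for m and \<omega> :: "(nat \<Rightarrow> 'a) \<times> 'b"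
    have Xm [measurable]: "X m \<in> borel_measurable ?L" for m
      unfolding X_def by (intro stopped_block_detector_bound P' e e1 P n \<tau>)
    have XI: "(\<integral>\<^sup>+\<omega>. X m \<omega> \<partial>?L) \<le> mean_time ?L \<tau>" for m
      unfolding X_def by (intro stopped_block_detector_bound P' e e1 P n \<tau>)
    have "(\<integral>\<^sup>+\<omega>. stopped_value (mixture_detector \<delta> e n) \<tau> \<omega> \<partial>?L) =
      (\<integral>\<^sup>+\<omega>. ennreal (1 - \<delta>) * ennreal_of_enat (\<tau> \<omega>) +
        ennreal \<delta> * (\<Sum>m. ennreal ((1/2) ^ Suc m) * X m \<omega>) \<partial>?L)"
    proof (intro nn_integral_cong_AE, use \<open>AE \<omega> in ?L. ennreal_of_enat (\<tau> \<omega>) \<noteq> \<infinity>\<close> in eventually_elim)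
      fix \<omega> assume "ennreal_of_enat (\<tau> \<omega>) \<noteq> \<infinity>"
      then obtain t where t: "\<tau> \<omega> = enat t" by (cases "\<tau> \<omega>") auto
      have "block_detector (e m) (n m) t (fst \<omega>) = X m \<omega>" for m
        unfolding X_def block_detector_eq_suminf[OF n] t by (simp add: indicator_def of_bool_def eq_commute)
      then show "stopped_value (mixture_detector \<delta> e n) \<tau> \<omega> =
          ennreal (1 - \<delta>) * ennreal_of_enat (\<tau> \<omega>) +
          ennreal \<delta> * (\<Sum>m. ennreal ((1/2) ^ Suc m) * X m \<omega>)"
        by (simp add: stopped_value_def t mixture_detector_def)
    qed
    also have "\<dots> = ennreal (1 - \<delta>) * mean_time ?L \<tau> +
        ennreal \<delta> * (\<Sum>m. ennreal ((1/2) ^ Suc m) * (\<integral>\<^sup>+\<omega>. X m \<omega> \<partial>?L))"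
      unfolding mean_time_def
      by (simp add: nn_integral_add nn_integral_cmult nn_integral_suminf del: power_Suc)
    also have "\<dots> \<le> ennreal (1 - \<delta>) * mean_time ?L \<tau> +
        ennreal \<delta> * (\<Sum>m. ennreal ((1/2) ^ Suc m) * mean_time ?L \<tau>)"
      by (intro add_left_mono mult_left_mono suminf_le XI) auto
    also have "\<dots> = (ennreal (1 - \<delta>) + ennreal \<delta>) * mean_time ?L \<tau>"
      unfolding suminf_half_powers by (simp add: distrib_right)
    also have "ennreal (1 - \<delta>) + ennreal \<delta> = 1"
      using \<delta> by (simp flip: ennreal_plus)
    finally show ?thesis by simp
  qed simp
qed

end

section \<open>Alarms raised at a threshold\<close>

lemma threshold_family_le_iff:
  "threshold_family D \<gamma> \<omega> \<le> enat t \<longleftrightarrow> (\<exists>s\<in>{1..t}. ennreal \<gamma> \<le> D s \<omega>)"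
proof
  assume le: "threshold_family D \<gamma> \<omega> \<le> enat t"
  let ?A = "enat ` {t. 1 \<le> t \<and> ennreal \<gamma> \<le> D t \<omega>}"
  have "?A \<noteq> {}"
  proof
    assume "?A = {}"
    then have "threshold_family D \<gamma> \<omega> = Inf {}" by (simp only: threshold_family_def)
    with le show False by (simp add: Inf_enat_def)
  qed
  then have "Inf ?A \<in> ?A" unfolding Inf_enat_def by (auto intro: LeastI)
  then show "\<exists>s\<in>{1..t}. ennreal \<gamma> \<le> D s \<omega>" using le by (auto simp: threshold_family_def)
next
  assume "\<exists>s\<in>{1..t}. ennreal \<gamma> \<le> D s \<omega>"
  then obtain s where "1 \<le> s" "s \<le> t" "ennreal \<gamma> \<le> D s \<omega>" by auto
  then have "threshold_family D \<gamma> \<omega> \<le> enat s"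
    unfolding threshold_family_def by (intro Inf_lower) auto
  also have "enat s \<le> enat t" using \<open>s \<le> t\<close> by simp
  finally show "threshold_family D \<gamma> \<omega> \<le> enat t" .
qed

lemma threshold_family_eqD:
  assumes "threshold_family D \<gamma> \<omega> = enat t"
  shows "ennreal \<gamma> \<le> D t \<omega>"
proof -
  obtain s where s: "s \<in> {1..t}" "ennreal \<gamma> \<le> D s \<omega>"
    using threshold_family_le_iff[of D \<gamma> \<omega> t] assms by auto
  then have "threshold_family D \<gamma> \<omega> \<le> enat s"
    by (subst threshold_family_le_iff) auto
  then have "s = t" using assms s(1) by auto
  with s show ?thesis by simp
qed

lemma le_divide_ennrealI:
  fixes a b :: ennreal
  assumes "a * c \<le> b" "c \<noteq> 0" "c \<noteq> \<infinity>"
  shows "a \<le> b / c"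
  using divide_right_mono_ennreal[OF assms(1), of c] assms(2,3)
  by (simp add: ennreal_mult_divide_eq)

context change_model
begin

lemma threshold_family_alarm_time:
  assumes "\<And>t. D t \<in> borel_measurable (F t)"
  shows "alarm_time M U G (threshold_family D \<gamma>)"
  unfolding alarm_time_def ext_stopping_time_def
proof (intro conjI allI ballI)
  fix t
  have "Measurable.pred (F t) (\<lambda>\<omega>. ennreal \<gamma> \<le> D s \<omega>)" if "s \<in> {1..t}" for s
  proof -
    have [measurable]: "D s \<in> borel_measurable (F t)" using measurable_F_mono[OF assms] that by simp
    show ?thesis by measurable
  qed
  then show "Measurable.pred (F t) (\<lambda>\<omega>. threshold_family D \<gamma> \<omega> \<le> enat t)"
    unfolding threshold_family_le_iff by (intro pred_intros_finite) auto
next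
  fix \<omega> show "1 \<le> threshold_family D \<gamma> \<omega>"
    unfolding threshold_family_def by (intro Inf_greatest) (auto simp: one_enat_def)
qed

text \<open>Markov's inequality for the detector stopped at the minimum of alarm and \<sigma>: where
  the alarm is finite and comes no later than \<sigma>, the stopped value is at least
  \<gamma>.\<close>

lemma threshold_family_optionally_ARL_valid:
  assumes D: "e_detector M U G \<P> D" and \<gamma>: "1 \<le> \<gamma>"
  shows "optionally_ARL_valid M U G \<P> \<gamma> (threshold_family D \<gamma>)"
  unfolding optionally_ARL_valid_def
proof (intro conjI ballI allI impI)
  show al: "alarm_time M U G (threshold_family D \<gamma>)"
    using D by (intro threshold_family_alarm_time) (simp add: e_detector_def)
  fix P \<sigma> assume P: "P \<in> \<P>" and \<sigma>: "ext_stopping_time F \<sigma>"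
  let ?L = "null_law U P" and ?T = "threshold_family D \<gamma>"
  define A where "A = {\<omega>\<in>space ?L. ?T \<omega> < \<infinity> \<and> ?T \<omega> \<le> \<sigma> \<omega>}"
  show "emeasure ?L {\<omega>\<in>space ?L. ?T \<omega> < \<infinity> \<and> ?T \<omega> \<le> \<sigma> \<omega>} \<le> mean_time ?L \<sigma> / ennreal \<gamma>"
  \<comment> \<open>A set outside the sigma-algebra has \<open>emeasure\<close> 0, which settles
    that case without an argument about \<sigma>.\<close>
  proof (cases "A \<in> sets ?L")
    case True
    define \<tau> where "\<tau> \<omega> = min (?T \<omega>) (\<sigma> \<omega>)" for \<omega>
    have \<tau>: "ext_stopping_time F \<tau>"
      unfolding \<tau>_def using al \<sigma> by (intro ext_stopping_time_min) (auto simp: alarm_time_def)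
    have "emeasure ?L A * ennreal \<gamma> = (\<integral>\<^sup>+\<omega>. ennreal \<gamma> * indicator A \<omega> \<partial>?L)"
      using True by (simp add: nn_integral_cmult_indicator mult.commute)
    also have "\<dots> \<le> (\<integral>\<^sup>+\<omega>. stopped_value D \<tau> \<omega> \<partial>?L)"
    proof (intro nn_integral_mono)
      fix \<omega>
      show "ennreal \<gamma> * indicator A \<omega> \<le> stopped_value D \<tau> \<omega>"
      proof (cases "\<omega> \<in> A")
        case True
        then obtain t where t: "?T \<omega> = enat t" "\<tau> \<omega> = enat t"
          by (auto simp: A_def \<tau>_def min_def)
        then show ?thesis using threshold_family_eqD[OF t(1)] True by (simp add: stopped_value_def)
      qed simp
    qed
    also have "\<dots> \<le> mean_time ?L \<tau>" using D P \<tau> by (simp add: e_detector_def)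
    also have "\<dots> \<le> mean_time ?L \<sigma>" unfolding mean_time_def \<tau>_def by (intro nn_integral_mono) simp
    finally show ?thesis unfolding A_def using \<gamma> by (intro le_divide_ennrealI) auto
  next
    case False
    then show ?thesis unfolding A_def by (simp add: emeasure_notin_sets)
  qed
qed

text \<open>The lower bound is the e-detector inequality at the alarm time itself: the detector is
  at least \<gamma> there. The deterministic bound \<open>K\<close> guarantees that the alarm is
  always raised, so the value at \<infinity> never intervenes.\<close>

lemma threshold_family_mean_time:
  assumes P: "P \<in> space (prob_algebra M)" "P \<in> \<P>" and D: "e_detector M U G \<P> D"
    and le: "\<And>\<omega>. threshold_family D \<gamma> \<omega> \<le> enat K"
  shows "ennreal \<gamma> \<le> mean_time (null_law U P) (threshold_family D \<gamma>)"
    and "mean_time (null_law U P) (threshold_family D \<gamma>) \<le> of_nat K"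
proof -
  let ?T = "threshold_family D \<gamma>"
  interpret prob_space "null_law U P" unfolding null_law_eq using P(1) by (intro prob_space_obs_law)
  have "ennreal \<gamma> = (\<integral>\<^sup>+\<omega>. ennreal \<gamma> \<partial>null_law U P)" by (simp add: emeasure_space_1)
  also have "\<dots> \<le> (\<integral>\<^sup>+\<omega>. stopped_value D ?T \<omega> \<partial>null_law U P)"
  proof (intro nn_integral_mono)
    fix \<omega>
    obtain t where "?T \<omega> = enat t" using le[of \<omega>] by (cases "?T \<omega>") auto
    then show "ennreal \<gamma> \<le> stopped_value D ?T \<omega>"
      using threshold_family_eqD[of D \<gamma> \<omega> t] by (simp add: stopped_value_def)
  qed
  also have "\<dots> \<le> mean_time (null_law U P) ?T"
    using D P threshold_family_alarm_time[of D \<gamma>] by (auto simp: e_detector_def alarm_time_def)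
  finally show "ennreal \<gamma> \<le> mean_time (null_law U P) ?T" .
  have "mean_time (null_law U P) ?T \<le> (\<integral>\<^sup>+\<omega>. ennreal_of_enat (enat K) \<partial>null_law U P)"
    unfolding mean_time_def using le by (intro nn_integral_mono) (subst ennreal_of_enat_le_iff)
  also have "\<dots> = of_nat K" by (simp add: emeasure_space_1)
  finally show "mean_time (null_law U P) ?T \<le> of_nat K" .
qed

end

section \<open>Detection delay\<close>

text \<open>The integrated bound is tested on the event where the conditional expectation exceeds
  \<open>c\<close>, which itself belongs to \<open>F\<close>.\<close>

lemma (in sigma_finite_subalgebra) nn_cond_exp_AE_le:
  assumes g [measurable]: "g \<in> borel_measurable M" and c: "c \<noteq> \<infinity>" and fin: "emeasure M (space M) \<noteq> \<infinity>"
    and le: "\<And>A. A \<in> sets F \<Longrightarrow> (\<integral>\<^sup>+x. indicator A x * g x \<partial>M) \<le> c * emeasure M A"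
  shows "AE x in M. nn_cond_exp M F g x \<le> c"
proof -
  define Z where "Z = nn_cond_exp M F g"
  have ZF [measurable]: "Z \<in> borel_measurable F" and [measurable]: "Z \<in> borel_measurable M"
    by (auto simp: Z_def)
  define A where "A = {x\<in>space F. c < Z x}"
  have AF [measurable]: "A \<in> sets F" unfolding A_def by measurable
  have [measurable]: "A \<in> sets M" using AF subalg by (auto simp: subalgebra_def)
  \<comment> \<open>Subtraction on \<open>ennreal\<close> is truncated, so the excess over
    \<open>c\<close> is split off on \<open>A\<close> only; finiteness of
    \<open>c * emeasure M A\<close> then allows cancelling.\<close>
  have "c * emeasure M A + (\<integral>\<^sup>+x. (Z x - c) * indicator A x \<partial>M) =
      (\<integral>\<^sup>+x. c * indicator A x + (Z x - c) * indicator A x \<partial>M)"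
    by (simp add: nn_integral_add nn_integral_cmult_indicator)
  also have "\<dots> = (\<integral>\<^sup>+x. indicator A x * Z x \<partial>M)"
    by (intro nn_integral_cong)
      (auto simp: A_def indicator_def diff_add_cancel_ennreal add.commute less_imp_le)
  also have "\<dots> = (\<integral>\<^sup>+x. indicator A x * g x \<partial>M)"
    unfolding Z_def by (intro nn_cond_exp_intg) auto
  also have "\<dots> \<le> c * emeasure M A" by (intro le AF)
  finally have "c * emeasure M A + (\<integral>\<^sup>+x. (Z x - c) * indicator A x \<partial>M) \<le> c * emeasure M A + 0"
    by simp
  moreover have "c * emeasure M A \<noteq> \<infinity>"
    using c fin emeasure_space[of M A] by (auto simp: ennreal_mult_eq_top_iff top_unique)
  ultimately have "(\<integral>\<^sup>+x. (Z x - c) * indicator A x \<partial>M) = 0"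
    using ennreal_add_left_cancel_le by fastforce
  then have "AE x in M. (Z x - c) * indicator A x = 0"
    by (subst (asm) nn_integral_0_iff_AE) auto
  then show ?thesis
  proof (rule AE_mp, intro AE_I2 impI)
    fix x assume x: "x \<in> space M" "(Z x - c) * indicator A x = 0"
    show "nn_cond_exp M F g x \<le> c"
    proof (rule ccontr)
      assume "\<not> ?thesis"
      then have "c < Z x" by (simp add: Z_def not_le)
      then have "Z x - c = 0" using x subalg by (auto simp: A_def subalgebra_def)
      then show False using \<open>c < Z x\<close> by (auto simp: diff_eq_0_iff_ennreal)
    qed
  qed
qed

text \<open>Terms are bounded by 1 before the first index \<open>K\<close> with
  \<open>b * \<rho> ^ K \<le> 1\<close>, which is \<open>ln b / ln (1 / \<rho>)\<close> rounded up,
  and by a geometric series from there on. This is the source of the logarithm in the delay.\<close>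

lemma suminf_min_geometric_le:
  fixes b \<rho> :: real
  assumes \<rho>: "0 < \<rho>" "\<rho> < 1" and b: "1 \<le> b"
  shows "(\<Sum>k. ennreal (min 1 (b * \<rho> ^ k))) \<le> ennreal (ln b / ln (1 / \<rho>) + 1 + 1 / (1 - \<rho>))"
proof (rule suminf_le_const)
  define K where "K = nat \<lceil>ln b / ln (1 / \<rho>)\<rceil>"
  have l: "0 < ln (1 / \<rho>)" using \<rho> by simp
  have lb: "0 \<le> ln b / ln (1 / \<rho>)" using b l by simp
  have K: "ln b / ln (1 / \<rho>) \<le> real K" "real K \<le> ln b / ln (1 / \<rho>) + 1"
    unfolding K_def using lb by linarith+
  have bK: "b * \<rho> ^ K \<le> 1"
  proof -
    have "ln b \<le> real K * ln (1 / \<rho>)" using K(1) l by (simp add: pos_divide_le_eq)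
    also have "\<dots> = - ln (\<rho> ^ K)" using \<rho> by (simp add: ln_realpow ln_div)
    finally have "ln (b * \<rho> ^ K) \<le> 0" using b \<rho> by (subst ln_mult_pos) auto
    then show ?thesis using b \<rho> by (subst (asm) ln_le_zero_iff) auto
  qed
  fix N
  have nn: "0 \<le> min 1 (b * \<rho> ^ k)" for k using b \<rho> by simp
  \<comment> \<open>The range is enlarged to \<open>K + N\<close> so that it can be split at
    \<open>K\<close> whatever \<open>N\<close> is.\<close>
  have "(\<Sum>k<N. min 1 (b * \<rho> ^ k)) \<le> (\<Sum>k\<in>{0..<K+N}. min 1 (b * \<rho> ^ k))"
    using nn by (intro sum_mono2) auto
  also have "\<dots> = (\<Sum>k\<in>{0..<K}. min 1 (b * \<rho> ^ k)) + (\<Sum>k\<in>{K..<K+N}. min 1 (b * \<rho> ^ k))"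
    by (intro sum.atLeastLessThan_concat[symmetric]) auto
  also have "(\<Sum>k\<in>{K..<K+N}. min 1 (b * \<rho> ^ k)) = (\<Sum>j<N. min 1 (b * \<rho> ^ (j + K)))"
    using sum.shift_bounds_nat_ivl[of "\<lambda>k. min 1 (b * \<rho> ^ k)" 0 K N]
    by (simp add: add.commute lessThan_atLeast0)
  also have "\<dots> \<le> (\<Sum>j<N. \<rho> ^ j)"
  proof (intro sum_mono)
    fix j
    have "b * \<rho> ^ (j + K) = \<rho> ^ j * (b * \<rho> ^ K)" by (simp add: power_add ac_simps)
    also have "\<dots> \<le> \<rho> ^ j" using bK \<rho> by (intro mult_left_le) auto
    finally show "min 1 (b * \<rho> ^ (j + K)) \<le> \<rho> ^ j" by simp
  qed
  also have "\<dots> \<le> 1 / (1 - \<rho>)"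
    using \<rho> by (simp add: sum_gp_strict divide_right_mono)
  also have "(\<Sum>k\<in>{0..<K}. min 1 (b * \<rho> ^ k)) \<le> (\<Sum>k\<in>{0..<K}. 1)"
    by (intro sum_mono) simp
  finally have "(\<Sum>k<N. min 1 (b * \<rho> ^ k)) \<le> real K + 1 / (1 - \<rho>)" by simp
  then have "(\<Sum>k<N. min 1 (b * \<rho> ^ k)) \<le> ln b / ln (1 / \<rho>) + 1 + 1 / (1 - \<rho>)"
    using K(2) by simp
  then show "(\<Sum>k<N. ennreal (min 1 (b * \<rho> ^ k))) \<le> ennreal (ln b / ln (1 / \<rho>) + 1 + 1 / (1 - \<rho>))"
    using nn by (subst sum_ennreal) (auto intro!: ennreal_leI)
qed simp

text \<open>\<open>T + 1 - enat (Suc s)\<close> is the positive part of \<open>T - s\<close>. It is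
  counted in blocks: every boundary \<open>s + k * n\<close> strictly before \<open>T\<close> pays
  for \<open>n\<close> time units.\<close>

lemma enat_minus_le_suminf:
  assumes n: "1 \<le> n" and T: "T \<noteq> \<infinity>"
  shows "ennreal_of_enat (T + 1 - enat (Suc s)) \<le> of_nat n * (\<Sum>k. of_bool (enat (s + k * n) < T))"
proof -
  obtain t where t: "T = enat t" using T by (cases T) auto
  show ?thesis
  proof (cases "s < t")
    case True
    \<comment> \<open>\<open>(t - s) / n\<close> rounded up, which is the number of boundaries
      before \<open>t\<close>.\<close>
    define K where "K = Suc ((t - s - 1) div n)"
    have "t - s - 1 = n * ((t - s - 1) div n) + (t - s - 1) mod n" by simp
    moreover have "(t - s - 1) mod n < n" using n by simp
    ultimately have K: "t - s \<le> n * K" unfolding K_def mult_Suc_right by linarith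
    have "ennreal_of_enat (T + 1 - enat (Suc s)) = of_nat (t - s)"
      by (simp add: t one_enat_def)
    also have "\<dots> \<le> of_nat n * of_nat K" using K by (metis of_nat_mono of_nat_mult)
    also have "of_nat K = (\<Sum>k<K. of_bool (enat (s + k * n) < T) :: ennreal)"
    proof -
      have "enat (s + k * n) < T" if "k < K" for k
      proof -
        have "k * n \<le> ((t - s - 1) div n) * n" using that by (intro mult_le_mono1) (simp add: K_def)
        also have "\<dots> \<le> t - s - 1" by (rule div_times_less_eq_dividend)
        finally show ?thesis using True by (simp add: t)
      qed
      then show ?thesis by simp
    qed
    also have "of_nat n * \<dots> \<le> of_nat n * (\<Sum>k. of_bool (enat (s + k * n) < T))"
      by (intro mult_left_mono sum_le_suminf) auto
    finally show ?thesis .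
  qed (simp add: t one_enat_def)
qed

lemma block_prod_inverse:
  assumes "\<And>x. e x \<noteq> 0" "\<And>x. e x \<noteq> \<infinity>"
  shows "block_prod e n s k \<omega> * block_prod (\<lambda>x. inverse (e x)) n s k \<omega> = 1"
proof -
  have "e x * inverse (e x) = 1" for x
    using assms[of x] by (simp add: ennreal_inverse_mult divide_ennreal_def[symmetric] ennreal_divide_self top.not_eq_extremum)
  then show ?thesis unfolding block_prod_def by (simp flip: prod.distrib)
qed

context change_model
begin

text \<open>If no alarm has sounded by \<open>s + k * n\<close>, the wealth is at most
  \<open>b\<close>, so 1 is at most \<open>b\<close> times the product of the inverses, whose mean
  given \<open>F s\<close> is at most \<open>\<rho> ^ k\<close>. Summing
  \<open>min 1 (b * \<rho> ^ k)\<close> over the blocks bounds the delay. The bound involves neither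
  the past nor the laws before \<open>s\<close>, so it survives the essential supremum and the
  suprema over null laws and change points.\<close>

lemma nn_cond_exp_delay_le:
  assumes R: "\<And>i. R i \<in> space (prob_algebra M)" and Q: "\<And>i. s \<le> i \<Longrightarrow> R i = Q"
    and e: "e \<in> borel_measurable (iid_n n M)" "\<And>x. e x \<noteq> 0" "\<And>x. e x \<noteq> \<infinity>"
    and n: "1 \<le> n" and \<rho>: "0 < \<rho>" "\<rho> < 1" "(\<integral>\<^sup>+x. inverse (e x) \<partial>iid_n n Q) \<le> ennreal \<rho>"
    and T: "ext_stopping_time F T" "\<And>\<omega>. T \<omega> \<noteq> \<infinity>" and b: "1 \<le> b"
    and hit: "\<And>k \<omega>. 1 \<le> k \<Longrightarrow> enat (s + k * n) < T \<omega> \<Longrightarrow> block_prod e n s k (fst \<omega>) \<le> ennreal b"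
  shows "AE \<omega> in obs_law U R. nn_cond_exp (obs_law U R) (F s)
      (\<lambda>\<omega>. ennreal_of_enat (T \<omega> + 1 - enat (Suc s))) \<omega>
    \<le> ennreal (real n * (ln b / ln (1 / \<rho>) + 1 + 1 / (1 - \<rho>)))"
proof -
  let ?L = "obs_law U R"
  interpret sigma_finite_subalgebra ?L "F s" by (rule sigma_finite_subalgebra_F[OF R])
  interpret L: prob_space ?L by (rule prob_space_obs_law[OF R])
  have Tm [measurable]: "T \<in> measurable ?L (count_space UNIV)"
    by (rule measurable_enat_obs_law[OF R T(1)])
  let ?i = "\<lambda>x. inverse (e x)"
  have i: "?i \<in> borel_measurable (iid_n n M)" using e(1) by measurable
  define C where "C = ln b / ln (1 / \<rho>) + 1 + 1 / (1 - \<rho>)"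
  have C0: "0 \<le> C" unfolding C_def using \<rho> b by simp
  have "AE \<omega> in ?L. nn_cond_exp ?L (F s) (\<lambda>\<omega>. ennreal_of_enat (T \<omega> + 1 - enat (Suc s))) \<omega>
      \<le> of_nat n * ennreal C"
  proof (rule nn_cond_exp_AE_le)
    fix A assume A: "A \<in> sets (F s)"
    then have AL [measurable]: "A \<in> sets ?L" using subalg by (auto simp: subalgebra_def)
    have ind: "(indicator A :: _ \<Rightarrow> ennreal) \<in> borel_measurable (F s)" using A by measurable
    have one: "(\<integral>\<^sup>+\<omega>. indicator A \<omega> * of_bool (enat (s + k * n) < T \<omega>) \<partial>?L)
      \<le> ennreal (min 1 (b * \<rho> ^ k)) * emeasure ?L A" for k
    proof -
      have 1: "of_bool (enat (s + k * n) < T \<omega>) \<le> ennreal b * block_prod ?i n s k (fst \<omega>)" for \<omega>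
      proof (cases "enat (s + k * n) < T \<omega>")
        case True
        \<comment> \<open>For \<open>k = 0\<close> the assumption \<open>hit\<close> is silent; the
          empty product is 1, which is at most \<open>b\<close>.\<close>
        have "block_prod e n s k (fst \<omega>) \<le> ennreal b"
          using hit[OF _ True] b by (cases "k = 0") (auto simp: block_prod_def)
        then have "block_prod e n s k (fst \<omega>) * block_prod ?i n s k (fst \<omega>)
            \<le> ennreal b * block_prod ?i n s k (fst \<omega>)"
          by (intro mult_right_mono) auto
        then show ?thesis using block_prod_inverse[of e, OF e(2,3)] by (simp add: True)
      qed simp
      have "(\<integral>\<^sup>+\<omega>. indicator A \<omega> * of_bool (enat (s + k * n) < T \<omega>) \<partial>?L) \<le>
        (\<integral>\<^sup>+\<omega>. indicator A \<omega> * (ennreal b * block_prod ?i n s k (fst \<omega>)) \<partial>?L)"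
        by (intro nn_integral_mono mult_left_mono 1) auto
      also have "\<dots> = ennreal b * (\<integral>\<^sup>+\<omega>. indicator A \<omega> * block_prod ?i n s k (fst \<omega>) \<partial>?L)"
        by (subst nn_integral_cmult[symmetric])
          (auto intro!: borel_measurable_times_ennreal measurable_F_obs_law[OF R measurable_block_prod[OF i order_refl]]
            simp: ac_simps)
      also have "\<dots> = ennreal b * (emeasure ?L A * (\<integral>\<^sup>+x. ?i x \<partial>iid_n n Q) ^ k)"
        by (subst nn_integral_block_prod[OF R Q i ind]) auto
      also have "\<dots> \<le> ennreal b * (emeasure ?L A * ennreal \<rho> ^ k)"
        by (intro mult_left_mono power_mono \<rho>) auto
      also have "\<dots> = ennreal (b * \<rho> ^ k) * emeasure ?L A"
        using b \<rho> by (simp add: ennreal_mult ennreal_power ac_simps)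
      finally have 2: "(\<integral>\<^sup>+\<omega>. indicator A \<omega> * of_bool (enat (s + k * n) < T \<omega>) \<partial>?L)
          \<le> ennreal (b * \<rho> ^ k) * emeasure ?L A" .
      have "(\<integral>\<^sup>+\<omega>. indicator A \<omega> * of_bool (enat (s + k * n) < T \<omega>) \<partial>?L) \<le> (\<integral>\<^sup>+\<omega>. indicator A \<omega> \<partial>?L)"
        by (intro nn_integral_mono) (auto simp: indicator_def)
      then show ?thesis using 2 by (simp add: min_def)
    qed
    have "(\<integral>\<^sup>+\<omega>. indicator A \<omega> * ennreal_of_enat (T \<omega> + 1 - enat (Suc s)) \<partial>?L)
      \<le> (\<integral>\<^sup>+\<omega>. indicator A \<omega> * (of_nat n * (\<Sum>k. of_bool (enat (s + k * n) < T \<omega>))) \<partial>?L)"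
      by (intro nn_integral_mono mult_left_mono enat_minus_le_suminf n T) auto
    also have "\<dots> = of_nat n * (\<Sum>k. \<integral>\<^sup>+\<omega>. indicator A \<omega> * of_bool (enat (s + k * n) < T \<omega>) \<partial>?L)"
    proof -
      define B where "B k \<omega> = (indicator A \<omega> * of_bool (enat (s + k * n) < T \<omega>) :: ennreal)" for k \<omega>
      have [measurable]: "B k \<in> borel_measurable ?L" for k
        unfolding B_def
        by (intro borel_measurable_times_ennreal borel_measurable_of_bool borel_measurable_indicator AL
            measurable_F_obs_law[OF R ext_stopping_time_enat(2)[OF T(1) order_refl]])
      have "(\<integral>\<^sup>+\<omega>. indicator A \<omega> * (of_nat n * (\<Sum>k. of_bool (enat (s + k * n) < T \<omega>))) \<partial>?L) =
        (\<integral>\<^sup>+\<omega>. of_nat n * (\<Sum>k. B k \<omega>) \<partial>?L)"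
        unfolding B_def by (intro nn_integral_cong) (simp add: ac_simps)
      also have "\<dots> = of_nat n * (\<Sum>k. \<integral>\<^sup>+\<omega>. B k \<omega> \<partial>?L)"
        by (simp add: nn_integral_cmult nn_integral_suminf)
      also have "\<dots> = of_nat n * (\<Sum>k. \<integral>\<^sup>+\<omega>. indicator A \<omega> * of_bool (enat (s + k * n) < T \<omega>) \<partial>?L)"
        by (simp add: B_def)
      finally show ?thesis .
    qed
    also have "\<dots> \<le> of_nat n * (\<Sum>k. ennreal (min 1 (b * \<rho> ^ k)) * emeasure ?L A)"
      by (intro mult_left_mono suminf_le one) auto
    also have "\<dots> = of_nat n * ((\<Sum>k. ennreal (min 1 (b * \<rho> ^ k))) * emeasure ?L A)" by simp
    also have "\<dots> \<le> of_nat n * (ennreal C * emeasure ?L A)"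
      unfolding C_def by (intro mult_left_mono mult_right_mono suminf_min_geometric_le \<rho> b) auto
    finally show "(\<integral>\<^sup>+\<omega>. indicator A \<omega> * ennreal_of_enat (T \<omega> + 1 - enat (Suc s)) \<partial>?L)
      \<le> of_nat n * ennreal C * emeasure ?L A" by (simp add: mult.assoc)
  next
    show "(\<lambda>\<omega>. ennreal_of_enat (T \<omega> + 1 - enat (Suc s))) \<in> borel_measurable ?L" by measurable
    show "of_nat n * ennreal C \<noteq> \<infinity>" by (simp add: ennreal_mult_eq_top_iff of_nat_less_top less_imp_neq)
    show "emeasure ?L (space ?L) \<noteq> \<infinity>" by (simp add: L.emeasure_space_1)
  qed
  also have "of_nat n * ennreal C = ennreal (real n * C)" using C0 by (simp add: ennreal_mult ennreal_of_nat_eq_real_of_nat)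
  finally show ?thesis unfolding C_def .
qed

end

section \<open>Betting families\<close>

text \<open>Bets are positive and finite at every argument, on and off the sample space, so that
  products can be inverted pointwise. A positive \<rho> keeps \<open>ln (1 / \<rho>)\<close>
  meaningful as a rate.\<close>

definition betting_family :: "'a measure \<Rightarrow> 'a measure set \<Rightarrow> 'a measure set \<Rightarrow> (nat \<Rightarrow> nat) \<Rightarrow>
    (nat \<Rightarrow> (nat \<Rightarrow> 'a) \<Rightarrow> ennreal) \<Rightarrow> bool" where
  "betting_family M \<P> \<Q> n e \<longleftrightarrow>
     (\<forall>m. 1 \<le> n m \<and> e m \<in> borel_measurable (iid_n (n m) M) \<and> (\<forall>x. e m x \<noteq> 0 \<and> e m x \<noteq> \<infinity>) \<and>
        (\<forall>P\<in>\<P>. (\<integral>\<^sup>+x. e m x \<partial>iid_n (n m) P) \<le> 1)) \<and>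
     (\<forall>Q\<in>\<Q>. \<exists>m. \<exists>\<rho>::real. 0 < \<rho> \<and> \<rho> < 1 \<and> (\<integral>\<^sup>+x. inverse (e m x) \<partial>iid_n (n m) Q) \<le> ennreal \<rho>)"

lemma block_prod_le_block_detector:
  assumes "1 \<le> n" "1 \<le> k"
  shows "block_prod e n s k \<omega> \<le> block_detector e n (s + k * n) \<omega>"
proof -
  let ?f = "\<lambda>s'. if n dvd s + k * n - s' then block_prod e n s' ((s + k * n - s') div n) \<omega> else 0"
  have "?f s \<le> (\<Sum>s'<s + k * n. ?f s')"
    using assms by (intro member_le_sum) auto
  then show ?thesis using assms by (simp add: block_detector_def)
qed

lemma mixture_detector_ge_block_prod:
  assumes "1 \<le> n m" "1 \<le> k" "0 \<le> \<delta>"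
  shows "ennreal (\<delta> * (1/2) ^ Suc m) * block_prod (e m) (n m) s k (fst \<omega>)
    \<le> mixture_detector \<delta> e n (s + k * n m) \<omega>"
proof -
  let ?f = "\<lambda>m. ennreal ((1/2) ^ Suc m) * block_detector (e m) (n m) (s + k * n m) (fst \<omega>)"
  have "ennreal ((1/2) ^ Suc m) * block_prod (e m) (n m) s k (fst \<omega>)
      \<le> ennreal ((1/2) ^ Suc m) * block_detector (e m) (n m) (s + k * n m) (fst \<omega>)"
    using assms by (intro mult_left_mono block_prod_le_block_detector) auto
  also have "\<dots> = (\<Sum>i\<in>{m}. ennreal ((1/2) ^ Suc i) * block_detector (e i) (n i) (s + k * n m) (fst \<omega>))" by simp
  also have "\<dots> \<le> (\<Sum>i. ennreal ((1/2) ^ Suc i) * block_detector (e i) (n i) (s + k * n m) (fst \<omega>))"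
    by (intro sum_le_suminf) auto
  finally have "ennreal \<delta> * (ennreal ((1/2) ^ Suc m) * block_prod (e m) (n m) s k (fst \<omega>)) \<le>
    ennreal \<delta> * (\<Sum>i. ennreal ((1/2) ^ Suc i) * block_detector (e i) (n i) (s + k * n m) (fst \<omega>))"
    by (intro mult_left_mono) auto
  also have "\<dots> \<le> mixture_detector \<delta> e n (s + k * n m) \<omega>"
    unfolding mixture_detector_def by (simp add: add_increasing)
  finally show ?thesis using assms(3) by (simp add: ennreal_mult mult.assoc del: power_Suc)
qed

context change_model
begin

text \<open>The choice \<open>\<delta> = \<eta> / (1 + \<eta>)\<close> makes the deterministic drift
  \<open>t / (1 + \<eta>)\<close>, which reaches \<gamma> at \<open>(1 + \<eta>) * \<gamma>\<close>
  rounded up; this bounds the mean times from above. The slope involves only the bet selected for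
  \<open>Q\<close>, while \<eta> and the mixture weight enter through \<open>ln (1 / c)\<close>
  alone, that is, through the additive constant.\<close>

lemma betting_family_log_delay:
  assumes \<P>: "\<P> \<subseteq> space (prob_algebra M)" "\<P> \<noteq> {}" and \<Q>: "\<Q> \<subseteq> space (prob_algebra M)"
    and bet: "betting_family M \<P> \<Q> n e"
    and m\<rho>: "\<And>Q. Q \<in> \<Q> \<Longrightarrow> 0 < \<rho> Q \<and> \<rho> Q < 1 \<and>
      (\<integral>\<^sup>+x. inverse (e (m Q) x) \<partial>iid_n (n (m Q)) Q) \<le> ennreal (\<rho> Q)"
    and \<eta>: "0 < \<eta>"
  defines "D \<equiv> mixture_detector (\<eta> / (1 + \<eta>)) e n"
  shows "e_detector M U G \<P> D"
    and "log_delay_family M U G \<P> \<Q> \<eta> (\<lambda>Q. real (n (m Q)) / ln (1 / \<rho> Q)) (threshold_family D)"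
proof -
  define \<delta> where "\<delta> = \<eta> / (1 + \<eta>)"
  have \<delta>: "0 < \<delta>" "\<delta> \<le> 1" and \<delta>': "1 - \<delta> = 1 / (1 + \<eta>)" using \<eta> by (auto simp: \<delta>_def field_simps)
  have D_def: "D = mixture_detector \<delta> e n" by (simp add: D_def \<delta>_def)
  have n: "1 \<le> n i" and e: "e i \<in> borel_measurable (iid_n (n i) M)"
    and e0: "e i x \<noteq> 0" "e i x \<noteq> \<infinity>" and e1: "P \<in> \<P> \<Longrightarrow> (\<integral>\<^sup>+x. e i x \<partial>iid_n (n i) P) \<le> 1" for i x P
    using bet by (auto simp: betting_family_def)
  show det: "e_detector M U G \<P> D"
    unfolding D_def using \<delta> by (intro mixture_detector_e_detector \<P> e n e1) auto
  have bounded: "threshold_family D \<gamma> \<omega> \<le> enat (nat \<lceil>(1 + \<eta>) * \<gamma>\<rceil>)" if \<gamma>: "1 \<le> \<gamma>" for \<gamma> \<omega>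
  proof -
    define K where "K = nat \<lceil>(1 + \<eta>) * \<gamma>\<rceil>"
    have g: "1 < (1 + \<eta>) * \<gamma>" using mult_strict_right_mono[of 1 "1 + \<eta>" \<gamma>] \<eta> \<gamma> by linarith
    then have K: "1 \<le> K" "(1 + \<eta>) * \<gamma> \<le> real K" unfolding K_def by linarith+
    have "\<gamma> \<le> (1 - \<delta>) * real K" using K(2) \<eta> by (simp add: \<delta>' field_simps)
    then have "ennreal \<gamma> \<le> ennreal (1 - \<delta>) * of_nat K"
      using \<delta> by (simp add: ennreal_of_nat_eq_real_of_nat ennreal_leI flip: ennreal_mult)
    also have "\<dots> \<le> D K \<omega>" by (simp add: D_def mixture_detector_def)
    finally show ?thesis unfolding threshold_family_le_iff K_def[symmetric] using K by auto
  qed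
  show "log_delay_family M U G \<P> \<Q> \<eta> (\<lambda>Q. real (n (m Q)) / ln (1 / \<rho> Q)) (threshold_family D)"
    unfolding log_delay_family_def
  proof (intro conjI allI impI ballI)
    show "optionally_ARL_valid_family M U G \<P> (threshold_family D)"
      unfolding optionally_ARL_valid_family_def
      by (intro allI impI threshold_family_optionally_ARL_valid det)
  next
    fix \<gamma> :: real assume \<gamma>: "1 \<le> \<gamma>"
    note mt = threshold_family_mean_time[OF _ _ det bounded[OF \<gamma>]]
    show "ennreal \<gamma> \<le> (INF P\<in>\<P>. mean_time (null_law U P) (threshold_family D \<gamma>))"
      using \<P> by (intro INF_greatest mt) auto
    obtain P0 where "P0 \<in> \<P>" using \<P> by auto
    then show "(INF P\<in>\<P>. mean_time (null_law U P) (threshold_family D \<gamma>)) \<le>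
        (SUP P\<in>\<P>. mean_time (null_law U P) (threshold_family D \<gamma>))"
      by (intro INF_lower2[OF _ SUP_upper]) auto
    have "of_nat (nat \<lceil>(1 + \<eta>) * \<gamma>\<rceil>) \<le> ennreal ((1 + \<eta>) * \<gamma> + 1)"
    proof -
      have "0 \<le> (1 + \<eta>) * \<gamma>" using \<eta> \<gamma> by simp
      then have "real (nat \<lceil>(1 + \<eta>) * \<gamma>\<rceil>) \<le> (1 + \<eta>) * \<gamma> + 1" by linarith
      then show ?thesis unfolding ennreal_of_nat_eq_real_of_nat by (rule ennreal_leI)
    qed
    then show "(SUP P\<in>\<P>. mean_time (null_law U P) (threshold_family D \<gamma>)) \<le> ennreal ((1 + \<eta>) * \<gamma> + 1)"
      using \<P> by (intro SUP_least order_trans[OF mt(2)]) auto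
  next
    fix Q assume Q: "Q \<in> \<Q>"
    define r where "r = \<rho> Q"
    define i where "i = m Q"
    have r: "0 < r" "r < 1" "(\<integral>\<^sup>+x. inverse (e i x) \<partial>iid_n (n i) Q) \<le> ennreal r"
      using m\<rho>[OF Q] by (auto simp: r_def i_def)
    \<comment> \<open>\<open>c\<close> is the weight of bet \<open>i\<close> in the detector, so as
      long as the detector is below \<gamma> the product is at most
      \<open>\<gamma> / c\<close>.\<close>
    define c where "c = \<delta> * (1/2) ^ Suc i"
    have c: "0 < c" "c \<le> 1" using \<delta> by (auto simp: c_def power_le_one mult_le_one simp del: power_Suc)
    show "\<exists>A. \<forall>\<gamma>\<ge>2. enn2ereal (lorden_delay M U G \<P> Q (threshold_family D \<gamma>)) \<le>
        ereal (A + real (n (m Q)) / ln (1 / \<rho> Q) * ln \<gamma>)"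
    proof (intro exI allI impI)
      fix \<gamma> :: real assume \<gamma>: "2 \<le> \<gamma>"
      let ?T = "threshold_family D \<gamma>"
      define b where "b = \<gamma> / c"
      have b: "1 \<le> b" using \<gamma> c by (simp add: b_def pos_le_divide_eq)
      define C where "C = real (n i) * (ln b / ln (1 / r) + 1 + 1 / (1 - r))"
      have C0: "0 \<le> C" using r b by (simp add: C_def)
      have T: "ext_stopping_time F ?T"
        using threshold_family_alarm_time[of D \<gamma>] det by (simp add: alarm_time_def e_detector_def)
      have Tfin: "?T \<omega> \<noteq> \<infinity>" for \<omega> using bounded[of \<gamma> \<omega>] \<gamma> by (cases "?T \<omega>") auto
      have hit: "block_prod (e i) (n i) s k (fst \<omega>) \<le> ennreal b"
        if k: "1 \<le> k" and lt: "enat (s + k * n i) < ?T \<omega>" for s k \<omega>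
      proof -
        have "s + k * n i \<in> {1..s + k * n i}" using k n[of i] by (cases k) auto
        then have "D (s + k * n i) \<omega> < ennreal \<gamma>"
          using lt threshold_family_le_iff[of D \<gamma> \<omega> "s + k * n i"] by (meson not_le)
        moreover have "ennreal c * block_prod (e i) (n i) s k (fst \<omega>) \<le> D (s + k * n i) \<omega>"
          unfolding D_def c_def using \<delta> by (intro mixture_detector_ge_block_prod n k) auto
        ultimately have "block_prod (e i) (n i) s k (fst \<omega>) * ennreal c \<le> ennreal \<gamma>"
          by (simp add: mult.commute order.strict_implies_order order.strict_trans1)
        then have "block_prod (e i) (n i) s k (fst \<omega>) \<le> ennreal \<gamma> / ennreal c"
          using c by (intro le_divide_ennrealI) auto
        then show ?thesis using c \<gamma> by (simp add: b_def divide_ennreal)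
      qed
      have "lorden_delay M U G \<P> Q ?T \<le> ennreal C"
        unfolding lorden_delay_def
      proof (intro SUP_least)
        fix P \<nu> assume P: "P \<in> \<P>" and \<nu>: "\<nu> \<in> {1::nat..}"
        let ?R = "\<lambda>i. if i + 1 < \<nu> then P else Q"
        obtain s where s: "\<nu> = Suc s" using \<nu> by (cases \<nu>) auto
        have PQ: "P \<in> space (prob_algebra M)" "Q \<in> space (prob_algebra M)" using P Q \<P> \<Q> by auto
        have "AE \<omega> in obs_law U ?R. nn_cond_exp (obs_law U ?R) (F s)
            (\<lambda>\<omega>. ennreal_of_enat (?T \<omega> + 1 - enat (Suc s))) \<omega> \<le> ennreal C"
          unfolding C_def
          by (rule nn_cond_exp_delay_le[where e="e i" and Q=Q])
            (use e e0 n r T Tfin b hit s PQ in auto)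
        then show "esssup (change_law U P Q \<nu>) (nn_cond_exp (change_law U P Q \<nu>) (F (\<nu> - 1))
           (\<lambda>\<omega>. ennreal_of_enat (?T \<omega> + 1 - enat \<nu>))) \<le> ennreal C"
          unfolding change_law_eq s by (intro esssup_I) auto
      qed
      then have "enn2ereal (lorden_delay M U G \<P> Q ?T) \<le> enn2ereal (ennreal C)"
        by (simp add: less_eq_ennreal.rep_eq)
      also have "\<dots> = ereal C" using C0 by (simp add: enn2ereal_ennreal)
      also have "C = real (n (m Q)) * (ln (1 / c) / ln (1 / \<rho> Q) + 1 + 1 / (1 - \<rho> Q)) +
          real (n (m Q)) / ln (1 / \<rho> Q) * ln \<gamma>"
      proof -
        have "ln b = ln \<gamma> + ln (1 / c)" using c \<gamma> by (simp add: b_def ln_div)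
        then show ?thesis by (simp add: C_def r_def i_def add_divide_distrib algebra_simps)
      qed
      finally show "enn2ereal (lorden_delay M U G \<P> Q ?T) \<le> ereal
          (real (n (m Q)) * (ln (1 / c) / ln (1 / \<rho> Q) + 1 + 1 / (1 - \<rho> Q)) +
          real (n (m Q)) / ln (1 / \<rho> Q) * ln \<gamma>)" .
    qed
  qed
qed

end

lemma betting_family_detectors:
  assumes \<P>: "\<P> \<subseteq> space (prob_algebra M)" "\<P> \<noteq> {}" and \<Q>: "\<Q> \<subseteq> space (prob_algebra M)"
    and bet: "betting_family M \<P> \<Q> n e"
  shows "\<exists>B. \<forall>\<eta>>0. \<exists>(U :: 'b measure) G D. aux_randomization U G \<and> e_detector M U G \<P> D \<and>
    log_delay_family M U G \<P> \<Q> \<eta> B (threshold_family D)"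
proof -
  have "\<forall>Q\<in>\<Q>. \<exists>i \<rho>. 0 < \<rho> \<and> \<rho> < 1 \<and> (\<integral>\<^sup>+x. inverse (e i x) \<partial>iid_n (n i) Q) \<le> ennreal \<rho>"
    using bet by (auto simp: betting_family_def)
  \<comment> \<open>Bets and rates are selected before \<eta> is given, so the slopes do not depend
    on it.\<close>
  then obtain m \<rho> where m\<rho>: "\<And>Q. Q \<in> \<Q> \<Longrightarrow> 0 < \<rho> Q \<and> \<rho> Q < 1 \<and>
      (\<integral>\<^sup>+x. inverse (e (m Q) x) \<partial>iid_n (n (m Q)) Q) \<le> ennreal (\<rho> Q)"
    by metis
  \<comment> \<open>Trivial randomization: a point mass, at \<open>undefined\<close> because the
    auxiliary type is arbitrary.\<close>
  define U :: "'b measure" where "U = return (count_space UNIV) undefined"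
  define G :: "nat \<Rightarrow> 'b measure" where "G = (\<lambda>_. count_space UNIV)"
  have aux: "aux_randomization U G"
    by (auto simp: aux_randomization_def U_def G_def filtration_def intro!: prob_space_return)
  obtain P where "P \<in> space (prob_algebra M)" using \<P> by auto
  then have "space M \<noteq> {}"
    using prob_space.not_empty[of P] prob_algebraD[of P M] by auto
  then interpret change_model M U G using aux by unfold_locales
  show ?thesis
    using betting_family_log_delay[OF \<P> \<Q> bet m\<rho>] aux by blast
qed

section \<open>Bets from bounded testing functions\<close>

definition testing_family :: "'a measure \<Rightarrow> 'a measure set \<Rightarrow> 'a measure set \<Rightarrow> (nat \<Rightarrow> nat) \<Rightarrow>
    (nat \<Rightarrow> (nat \<Rightarrow> 'a) \<Rightarrow> real) \<Rightarrow> bool" where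
  "testing_family M \<P> \<Q> n h \<longleftrightarrow>
     (\<forall>m. 1 \<le> n m \<and> h m \<in> borel_measurable (iid_n (n m) M) \<and>
        (\<exists>C. \<forall>x\<in>space (iid_n (n m) M). \<bar>h m x\<bar> \<le> C) \<and>
        (\<forall>P\<in>\<P>. (\<integral>x. h m x \<partial>iid_n (n m) P) \<le> 0)) \<and>
     (\<forall>Q\<in>\<Q>. \<exists>m. 0 < (\<integral>x. h m x \<partial>iid_n (n m) Q))"

lemma iid_n_law:
  assumes "P \<in> space (prob_algebra M)"
  shows "prob_space (iid_n n P)" "sets (iid_n n P) = sets (iid_n n M)" "space (iid_n n P) = space (iid_n n M)"
proof -
  show "prob_space (iid_n n P)"
    unfolding iid_n_def using prob_algebraD(1)[OF assms] by (intro prob_space_PiM)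
  show s: "sets (iid_n n P) = sets (iid_n n M)"
    unfolding iid_n_def using prob_algebraD(2)[OF assms] by (intro sets_PiM_cong) auto
  show "space (iid_n n P) = space (iid_n n M)" using s by (rule sets_eq_imp_space_eq)
qed

lemma integrable_iid_n_bounded:
  fixes h :: "(nat \<Rightarrow> 'a) \<Rightarrow> real"
  assumes P: "P \<in> space (prob_algebra M)" and h: "h \<in> borel_measurable (iid_n n M)"
    and C: "\<And>x. x \<in> space (iid_n n M) \<Longrightarrow> \<bar>h x\<bar> \<le> C"
  shows "integrable (iid_n n P) h"
proof -
  interpret prob_space "iid_n n P" by (rule iid_n_law[OF P])
  have "h \<in> borel_measurable (iid_n n P)"
    using h by (subst measurable_cong_sets[OF iid_n_law(2)[OF P] refl])
  then show ?thesis
    using C by (intro integrable_const_bound[of _ C] AE_I2) (auto simp: iid_n_law(3)[OF P])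
qed

text \<open>The right-hand side times \<open>1 + x\<close> exceeds 1 by
  \<open>x^2 * (1 + 2 * x)\<close>. The coefficient 2 is the one that gives equality at the endpoint
  \<open>x = - 1 / 2\<close>.\<close>

lemma inverse_one_plus_le:
  fixes x :: real
  assumes "\<bar>x\<bar> \<le> 1 / 2"
  shows "inverse (1 + x) \<le> 1 - x + 2 * x\<^sup>2"
proof -
  have "1 \<le> (1 - x + 2 * x\<^sup>2) * (1 + x)"
  proof -
    have "(1 - x + 2 * x\<^sup>2) * (1 + x) - 1 = x\<^sup>2 * (1 + 2 * x)" by algebra
    moreover have "0 \<le> x\<^sup>2 * (1 + 2 * x)" using assms by (intro mult_nonneg_nonneg) auto
    ultimately show ?thesis by linarith
  qed
  then show ?thesis using assms by (simp add: inverse_eq_divide pos_divide_le_eq)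
qed

text \<open>The gain is linear in \<open>c\<close>, the loss quadratic: the inverse has mean below 1
  as soon as \<open>2 * c\<close> is positive and below the mean of \<open>h\<close>.\<close>

lemma bet_of_testing_function:
  fixes h :: "(nat \<Rightarrow> 'a) \<Rightarrow> real"
  assumes h: "h \<in> borel_measurable (iid_n n M)" and h1: "\<And>x. \<bar>h x\<bar> \<le> 1"
    and c: "0 < c" "c \<le> 1 / 2" and R: "R \<in> space (prob_algebra M)"
  shows "(\<integral>\<^sup>+x. ennreal (1 + c * h x) \<partial>iid_n n R) = ennreal (1 + c * (\<integral>x. h x \<partial>iid_n n R))"
    and "(\<integral>\<^sup>+x. inverse (ennreal (1 + c * h x)) \<partial>iid_n n R)
      \<le> ennreal (1 - c * (\<integral>x. h x \<partial>iid_n n R) + 2 * c\<^sup>2)"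
proof -
  interpret prob_space "iid_n n R" by (rule iid_n_law[OF R])
  have hi [simp]: "integrable (iid_n n R) h" by (rule integrable_iid_n_bounded[OF R h h1])
  have ch: "\<bar>c * h x\<bar> \<le> 1 / 2" for x
    using mult_mono[OF c(2) h1[of x]] c by (simp add: abs_mult)
  show "(\<integral>\<^sup>+x. ennreal (1 + c * h x) \<partial>iid_n n R) = ennreal (1 + c * (\<integral>x. h x \<partial>iid_n n R))"
  proof (subst nn_integral_eq_integral)
    show "AE x in iid_n n R. 0 \<le> 1 + c * h x"
    proof (intro AE_I2)
      fix x show "0 \<le> 1 + c * h x" using ch[of x] by linarith
    qed
  qed (auto simp: prob_space)
  have "(\<integral>\<^sup>+x. inverse (ennreal (1 + c * h x)) \<partial>iid_n n R)
      \<le> (\<integral>\<^sup>+x. ennreal (1 - c * h x + 2 * c\<^sup>2) \<partial>iid_n n R)"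
  proof (intro nn_integral_mono)
    fix x
    have "0 < 1 + c * h x" using ch[of x] by linarith
    then have "inverse (ennreal (1 + c * h x)) = ennreal (inverse (1 + c * h x))"
      by (simp add: inverse_ennreal)
    also have "inverse (1 + c * h x) \<le> 1 - c * h x + 2 * c\<^sup>2"
    proof -
      have "(c * h x)\<^sup>2 \<le> c\<^sup>2"
        using mult_mono[of "c\<^sup>2" "c\<^sup>2" "(h x)\<^sup>2" 1] h1[of x] by (simp add: power_mult_distrib abs_square_le_1)
      then show ?thesis using inverse_one_plus_le[OF ch[of x]] by linarith
    qed
    finally show "inverse (ennreal (1 + c * h x)) \<le> ennreal (1 - c * h x + 2 * c\<^sup>2)"
      by (simp add: ennreal_leI)
  qed
  also have "\<dots> = ennreal (1 - c * (\<integral>x. h x \<partial>iid_n n R) + 2 * c\<^sup>2)"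
  proof (subst nn_integral_eq_integral)
    show "AE x in iid_n n R. 0 \<le> 1 - c * h x + 2 * c\<^sup>2"
    proof (intro AE_I2)
      fix x show "0 \<le> 1 - c * h x + 2 * c\<^sup>2" using ch[of x] zero_le_power2[of c] by linarith
    qed
  qed (auto simp: prob_space)
  finally show "(\<integral>\<^sup>+x. inverse (ennreal (1 + c * h x)) \<partial>iid_n n R)
      \<le> ennreal (1 - c * (\<integral>x. h x \<partial>iid_n n R) + 2 * c\<^sup>2)" .
qed

text \<open>The right size of a bet depends on the mean of \<open>h\<close> under the alternative,
  which is unknown. Pairing every testing function with every \<open>(1/2) ^ Suc i\<close> keeps the
  family countable and provides a small enough bet for each alternative.\<close>

lemma betting_family_of_testing_family:
  assumes \<P>: "\<P> \<subseteq> space (prob_algebra M)" and \<Q>: "\<Q> \<subseteq> space (prob_algebra M)"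
    and test: "testing_family M \<P> \<Q> n h"
  obtains n' e where "betting_family M \<P> \<Q> n' e"
proof -
  have n: "1 \<le> n m" and h: "h m \<in> borel_measurable (iid_n (n m) M)"
    and hP: "P \<in> \<P> \<Longrightarrow> (\<integral>x. h m x \<partial>iid_n (n m) P) \<le> 0"
    and hQ: "Q \<in> \<Q> \<Longrightarrow> \<exists>m. 0 < (\<integral>x. h m x \<partial>iid_n (n m) Q)" for m P Q
    using test by (auto simp: testing_family_def)
  have "\<exists>C. \<forall>x\<in>space (iid_n (n m) M). \<bar>h m x\<bar> \<le> C" for m
    using test by (auto simp: testing_family_def)
  then obtain C0 where C0: "\<And>m x. x \<in> space (iid_n (n m) M) \<Longrightarrow> \<bar>h m x\<bar> \<le> C0 m" by metis
  define C where "C m = max 1 (C0 m)" for m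
  have C: "0 < C m" "\<And>x. x \<in> space (iid_n (n m) M) \<Longrightarrow> \<bar>h m x\<bar> \<le> C m" for m
    unfolding C_def by (simp, rule order_trans[OF C0 max.cobounded2])
  \<comment> \<open>On the sample space this is \<open>h / C\<close>; the clipping acts only off the
    space and makes the bound 1 valid at every argument.\<close>
  define g where "g m x = max (- 1) (min 1 (h m x / C m))" for m x
  have g1: "\<bar>g m x\<bar> \<le> 1" for m x unfolding g_def abs_le_iff by (simp add: max_def min_def)
  have gm: "g m \<in> borel_measurable (iid_n (n m) M)" for m
    unfolding g_def
    by (intro borel_measurable_max borel_measurable_min borel_measurable_const borel_measurable_divide h)
  have gI: "(\<integral>x. g m x \<partial>iid_n (n m) R) = (\<integral>x. h m x \<partial>iid_n (n m) R) / C m"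
    if R: "R \<in> space (prob_algebra M)" for m R
  proof -
    have "g m x = h m x / C m" if "x \<in> space (iid_n (n m) M)" for x
    proof -
      have "\<bar>h m x / C m\<bar> \<le> 1" using C(1)[of m] C(2)[OF that] by (simp add: abs_divide pos_divide_le_eq)
      then show ?thesis unfolding g_def by linarith
    qed
    then have "(\<integral>x. g m x \<partial>iid_n (n m) R) = (\<integral>x. h m x / C m \<partial>iid_n (n m) R)"
      by (intro Bochner_Integration.integral_cong) (auto simp: iid_n_law(3)[OF R])
    then show ?thesis by simp
  qed
  define c :: "nat \<Rightarrow> real" where "c i = (1/2) ^ Suc i" for i
  have c: "0 < c i" "c i \<le> 1/2" for i
    using power_le_one[of "1/2::real" i] by (auto simp: c_def)
  define n' where "n' j = n (fst (prod_decode j))" for j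
  define e where "e j x = ennreal (1 + c (snd (prod_decode j)) * g (fst (prod_decode j)) x)" for j x
  have "betting_family M \<P> \<Q> n' e"
    unfolding betting_family_def
  proof (intro conjI allI ballI)
    fix j
    define m where "m = fst (prod_decode j)"
    define i where "i = snd (prod_decode j)"
    have ej: "e j = (\<lambda>x. ennreal (1 + c i * g m x))" and n'j: "n' j = n m"
      by (auto simp: e_def m_def i_def n'_def)
    show "1 \<le> n' j" unfolding n'j by (rule n)
    show "e j \<in> borel_measurable (iid_n (n' j) M)" unfolding ej n'j
      by (intro measurable_compose[OF _ measurable_ennreal] borel_measurable_add borel_measurable_times
          borel_measurable_const gm)
    fix x
    have "\<bar>c i * g m x\<bar> \<le> 1/2" using mult_mono[OF c(2) g1] c(1)[of i] by (simp add: abs_mult)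
    then have "0 < 1 + c i * g m x" by linarith
    then show "e j x \<noteq> 0" "e j x \<noteq> \<infinity>" by (auto simp: ej ennreal_eq_0_iff)
  next
    fix j P assume P: "P \<in> \<P>"
    then have P': "P \<in> space (prob_algebra M)" using \<P> by auto
    define m where "m = fst (prod_decode j)"
    define i where "i = snd (prod_decode j)"
    have "c i * (\<integral>x. g m x \<partial>iid_n (n m) P) \<le> 0"
      using hP[OF P, of m] C(1)[of m] c(1)[of i] unfolding gI[OF P']
      by (intro mult_nonneg_nonpos divide_nonpos_pos) auto
    then have "(\<integral>\<^sup>+x. ennreal (1 + c i * g m x) \<partial>iid_n (n m) P) \<le> 1"
      unfolding bet_of_testing_function(1)[OF gm g1 c P'] by (simp add: ennreal_le_1)
    then show "(\<integral>\<^sup>+x. e j x \<partial>iid_n (n' j) P) \<le> 1" by (simp add: e_def n'_def m_def i_def)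
  next
    fix Q assume Q: "Q \<in> \<Q>"
    then have Q': "Q \<in> space (prob_algebra M)" using \<Q> by auto
    obtain m where m: "0 < (\<integral>x. h m x \<partial>iid_n (n m) Q)" using hQ[OF Q] by auto
    define \<mu> where "\<mu> = (\<integral>x. g m x \<partial>iid_n (n m) Q)"
    have \<mu>: "0 < \<mu>" using m C(1)[of m] by (simp add: \<mu>_def gI[OF Q'])
    \<comment> \<open>\<open>2 * c i\<close> equals \<open>(1/2) ^ i\<close>, so this is the
      condition under which the gain beats the loss.\<close>
    obtain i where i: "(1/2) ^ i < \<mu>" using real_arch_pow_inv[OF \<mu>, of "1/2"] by auto
    have ci: "2 * c i < \<mu>" using i by (simp add: c_def)
    have \<mu>1: "\<mu> \<le> 1"
    proof -
      interpret prob_space "iid_n (n m) Q" by (rule iid_n_law[OF Q'])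
      have "\<mu> \<le> (\<integral>x. 1 \<partial>iid_n (n m) Q)" unfolding \<mu>_def
      proof (intro integral_mono)
        show "integrable (iid_n (n m) Q) (g m)" by (rule integrable_iid_n_bounded[OF Q' gm g1])
        show "g m x \<le> 1" for x using g1[of m x] by linarith
      qed simp
      then show ?thesis by (simp add: prob_space)
    qed
    define \<rho> where "\<rho> = 1 - c i * \<mu> + 2 * (c i)\<^sup>2"
    have "c i * \<mu> \<le> 1 / 2 * 1" using c[of i] \<mu> \<mu>1 by (intro mult_mono) auto
    then have \<rho>0: "0 < \<rho>" unfolding \<rho>_def using zero_le_power2[of "c i"] by linarith
    have "c i * (2 * c i) < c i * \<mu>" using ci c(1) by (intro mult_strict_left_mono) auto
    then have \<rho>1: "\<rho> < 1" by (simp add: \<rho>_def power2_eq_square)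
    show "\<exists>j. \<exists>\<rho>>0. \<rho> < 1 \<and> (\<integral>\<^sup>+x. inverse (e j x) \<partial>iid_n (n' j) Q) \<le> ennreal \<rho>"
      using bet_of_testing_function(2)[OF gm g1 c Q', of m i] \<rho>0 \<rho>1
      by (intro exI[of _ "prod_encode (m, i)"] exI[of _ \<rho>])
        (simp add: e_def n'_def \<rho>_def \<mu>_def)
  qed
  then show ?thesis by (rule that)
qed

section \<open>Sequential tests\<close>

context
  fixes P :: "'a measure" and M :: "'a measure"
  assumes P: "P \<in> space (prob_algebra M)"
begin

lemma sets_iid: "sets (iid P) = sets (PiM UNIV (\<lambda>_. M))"
  and space_iid: "space (iid P) = space (PiM UNIV (\<lambda>_. M))"
  and prob_space_iid: "prob_space (iid P)"
  unfolding iid_def using sets_PiM_law[of "\<lambda>_. P", OF P] space_PiM_law[of "\<lambda>_. P", OF P]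
    prob_algebraD(1)[OF P] by (auto intro: prob_space_PiM)

lemma measurable_obs_filtration_iid:
  "f \<in> measurable (obs_filtration M t) N \<Longrightarrow> f \<in> measurable (iid P) N"
  using measurable_compose[OF measurable_ident_obs_filtration, of f M t N]
  by (subst measurable_cong_sets[OF sets_iid refl])

lemma distr_iid_restrict: "distr (iid P) (iid_n n M) (\<lambda>\<omega>. restrict \<omega> {..<n}) = iid_n n P"
proof -
  have "distr (iid P) (iid_n n M) (\<lambda>\<omega>. restrict \<omega> {..<n}) =
      distr (PiM UNIV (\<lambda>_. P)) (PiM {..<n} (\<lambda>_. P)) (\<lambda>\<omega>. \<lambda>i\<in>{..<n}. \<omega> i)"
    unfolding iid_def by (intro distr_cong) (auto simp: iid_n_law(2)[OF P] simp flip: iid_n_def)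
  also have "\<dots> = PiM {..<n} (\<lambda>_. P)"
    using distr_PiM_reindex[of UNIV "\<lambda>_. P" "\<lambda>i. i" "{..<n}"] prob_algebraD(1)[OF P] by simp
  finally show ?thesis by (simp add: iid_n_def)
qed

lemma measurable_restrict_iid: "(\<lambda>\<omega>. restrict \<omega> {..<n}) \<in> measurable (iid P) (iid_n n M)"
  unfolding iid_n_def by (rule measurable_obs_filtration_iid[OF measurable_restrict_obs_filtration])

lemma integral_iid_restrict:
  fixes h :: "(nat \<Rightarrow> 'a) \<Rightarrow> real"
  assumes "h \<in> borel_measurable (iid_n n M)"
  shows "(\<integral>x. h x \<partial>iid_n n P) = (\<integral>\<omega>. h (restrict \<omega> {..<n}) \<partial>iid P)"
  by (subst distr_iid_restrict[symmetric]) (rule integral_distr[OF measurable_restrict_iid assms])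

lemma nn_integral_iid_restrict:
  assumes "h \<in> borel_measurable (iid_n n M)"
  shows "(\<integral>\<^sup>+x. h x \<partial>iid_n n P) = (\<integral>\<^sup>+\<omega>. h (restrict \<omega> {..<n}) \<partial>iid P)"
  by (subst distr_iid_restrict[symmetric]) (use assms in \<open>simp add: nn_integral_distr measurable_restrict_iid\<close>)

end

lemma le_enat_finite: "x \<le> enat t \<Longrightarrow> \<exists>i. x = enat i"
  by (cases x) auto

lemma space_nonempty_of_law:
  assumes "P \<in> space (prob_algebra M)" shows "space M \<noteq> {}"
  using prob_space.not_empty[OF prob_algebraD(1)[OF assms]] prob_algebraD(3)[OF assms] by simp

text \<open>The functions are the indicators of rejection by time \<open>Suc m\<close>, minus
  \<alpha>: the level makes their null means nonpositive, and power one lets their means under an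
  alternative tend to \<open>1 - \<alpha>\<close>, which is positive.\<close>

lemma testing_family_of_sequentially_testable:
  assumes \<P>: "\<P> \<subseteq> space (prob_algebra M)" "\<P> \<noteq> {}" and \<Q>: "\<Q> \<subseteq> space (prob_algebra M)"
    and test: "sequentially_testable M \<P> \<Q>"
  obtains n h where "testing_family M \<P> \<Q> n h"
proof -
  from test obtain \<alpha> :: real and \<tau> where \<alpha>: "0 < \<alpha>" "\<alpha> < 1"
    and \<tau>: "ext_stopping_time (obs_filtration M) \<tau>"
    and level: "level_test \<P> \<alpha> \<tau>" and power: "power_one_test \<Q> \<tau>"
    unfolding sequentially_testable_def sequential_test_def by blast
  have ne: "space M \<noteq> {}" using \<P> space_nonempty_of_law by blast
  have pr: "Measurable.pred (obs_filtration M t) (\<lambda>\<omega>. \<tau> \<omega> \<le> enat t)" for t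
    using \<tau> by (simp add: ext_stopping_time_def)
  have "\<exists>H. H \<in> borel_measurable (PiM {..<t} (\<lambda>_. M)) \<and>
      (\<forall>\<omega>\<in>space (PiM UNIV (\<lambda>_. M)). of_bool (\<tau> \<omega> \<le> enat t) = (H (restrict \<omega> {..<t}) :: ennreal))" for t
    using obs_filtration_factor[OF borel_measurable_of_bool[OF pr] ne] by metis
  then obtain H :: "nat \<Rightarrow> (nat \<Rightarrow> 'a) \<Rightarrow> ennreal"
    where Hm: "\<And>t. H t \<in> borel_measurable (PiM {..<t} (\<lambda>_. M))"
    and H: "\<And>t \<omega>. \<omega> \<in> space (PiM UNIV (\<lambda>_. M)) \<Longrightarrow> of_bool (\<tau> \<omega> \<le> enat t) = H t (restrict \<omega> {..<t})"
    by metis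
  \<comment> \<open>\<open>H\<close> agrees with an indicator only on the sample space; asking for
    the value 1 keeps \<open>h\<close> bounded everywhere.\<close>
  define h where "h m y = indicator {y. H (Suc m) y = 1} y - \<alpha>" for m y
  have hm: "h m \<in> borel_measurable (iid_n (Suc m) M)" for m
  proof -
    have "{y\<in>space (iid_n (Suc m) M). H (Suc m) y = 1} \<in> sets (iid_n (Suc m) M)"
      using Hm[of "Suc m"] unfolding iid_n_def by measurable
    then have "(indicator {y. H (Suc m) y = 1} :: _ \<Rightarrow> real) \<in> borel_measurable (iid_n (Suc m) M)"
      by (subst borel_measurable_indicator_iff) (simp add: Int_def conj_commute)
    then show ?thesis unfolding h_def by (intro borel_measurable_diff) auto
  qed
  have hI: "(\<integral>x. h m x \<partial>iid_n (Suc m) R) = measure (iid R) {\<omega>\<in>space (iid R). \<tau> \<omega> \<le> enat (Suc m)} - \<alpha>"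
    if R: "R \<in> space (prob_algebra M)" for m R
  proof -
    interpret prob_space "iid R" by (rule prob_space_iid[OF R])
    let ?A = "{\<omega>\<in>space (iid R). \<tau> \<omega> \<le> enat (Suc m)}"
    have A: "?A \<in> sets (iid R)"
      using measurable_obs_filtration_iid[OF R pr[of "Suc m"]] by measurable
    have "(\<integral>x. h m x \<partial>iid_n (Suc m) R) = (\<integral>\<omega>. indicator ?A \<omega> - \<alpha> \<partial>iid R)"
      unfolding integral_iid_restrict[OF R hm]
    proof (intro Bochner_Integration.integral_cong refl)
      fix \<omega> assume \<omega>: "\<omega> \<in> space (iid R)"
      then have "of_bool (\<tau> \<omega> \<le> enat (Suc m)) = H (Suc m) (restrict \<omega> {..<Suc m})"
        by (intro H) (simp add: space_iid[OF R])
      then have "H (Suc m) (restrict \<omega> {..<Suc m}) = 1 \<longleftrightarrow> \<tau> \<omega> \<le> enat (Suc m)"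
        by (cases "\<tau> \<omega> \<le> enat (Suc m)") (metis of_bool_eq(2), metis of_bool_eq(1) zero_neq_one)
      then show "h m (restrict \<omega> {..<Suc m}) = indicator ?A \<omega> - \<alpha>"
        using \<omega> by (simp add: h_def indicator_def)
    qed
    also have "\<dots> = measure (iid R) ?A - \<alpha>"
      using A by (subst Bochner_Integration.integral_diff) (auto simp: prob_space emeasure_eq_measure)
    finally show ?thesis .
  qed
  have "testing_family M \<P> \<Q> Suc h"
    unfolding testing_family_def
  proof (intro conjI allI ballI)
    fix m
    show "1 \<le> Suc m" by simp
    show "h m \<in> borel_measurable (iid_n (Suc m) M)" by (rule hm)
    show "\<exists>C. \<forall>x\<in>space (iid_n (Suc m) M). \<bar>h m x\<bar> \<le> C"
      using \<alpha> by (intro exI[of _ 1]) (auto simp: h_def indicator_def)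
    fix P assume P: "P \<in> \<P>"
    then have P': "P \<in> space (prob_algebra M)" using \<P> by auto
    interpret prob_space "iid P" by (rule prob_space_iid[OF P'])
    have fin: "{\<omega>\<in>space (iid P). \<tau> \<omega> < \<infinity>} = (\<Union>t. {\<omega>\<in>space (iid P). \<tau> \<omega> \<le> enat t})"
    proof (intro equalityI subsetI)
      fix \<omega> assume "\<omega> \<in> {\<omega>\<in>space (iid P). \<tau> \<omega> < \<infinity>}"
      then show "\<omega> \<in> (\<Union>t. {\<omega>\<in>space (iid P). \<tau> \<omega> \<le> enat t})" by (cases "\<tau> \<omega>") auto
    next
      fix \<omega> assume "\<omega> \<in> (\<Union>t. {\<omega>\<in>space (iid P). \<tau> \<omega> \<le> enat t})"
      then show "\<omega> \<in> {\<omega>\<in>space (iid P). \<tau> \<omega> < \<infinity>}" by (auto dest: le_enat_finite)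
    qed
    have "{\<omega>\<in>space (iid P). \<tau> \<omega> \<le> enat t} \<in> sets (iid P)" for t
      using measurable_obs_filtration_iid[OF P' pr[of t]] by measurable
    then have "{\<omega>\<in>space (iid P). \<tau> \<omega> < \<infinity>} \<in> sets (iid P)" unfolding fin by auto
    then have "emeasure (iid P) {\<omega>\<in>space (iid P). \<tau> \<omega> \<le> enat (Suc m)}
        \<le> emeasure (iid P) {\<omega>\<in>space (iid P). \<tau> \<omega> < \<infinity>}"
      by (intro emeasure_mono) (auto dest: le_enat_finite)
    also have "\<dots> \<le> ennreal \<alpha>"
      using level P unfolding level_test_def by (meson SUP_upper order_trans)
    finally have "measure (iid P) {\<omega>\<in>space (iid P). \<tau> \<omega> \<le> enat (Suc m)} \<le> \<alpha>"
      using \<alpha> by (simp add: emeasure_eq_measure)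
    then show "(\<integral>x. h m x \<partial>iid_n (Suc m) P) \<le> 0" unfolding hI[OF P'] by simp
  next
    fix Q assume Q: "Q \<in> \<Q>"
    then have Q': "Q \<in> space (prob_algebra M)" using \<Q> by auto
    interpret prob_space "iid Q" by (rule prob_space_iid[OF Q'])
    define A where "A t = {\<omega>\<in>space (iid Q). \<tau> \<omega> \<le> enat (Suc t)}" for t
    have A: "A t \<in> sets (iid Q)" for t
      unfolding A_def using measurable_obs_filtration_iid[OF Q' pr[of "Suc t"]] by measurable
    have un: "(\<Union>t. A t) = {\<omega>\<in>space (iid Q). \<tau> \<omega> < \<infinity>}"
    proof (intro equalityI subsetI)
      fix \<omega> assume \<omega>: "\<omega> \<in> {\<omega>\<in>space (iid Q). \<tau> \<omega> < \<infinity>}"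
      then obtain t where "\<tau> \<omega> = enat t" by (cases "\<tau> \<omega>") auto
      then show "\<omega> \<in> (\<Union>t. A t)" using \<omega> by (auto simp: A_def intro!: exI[of _ t])
    qed (auto simp: A_def dest: le_enat_finite)
    have "(\<lambda>t. measure (iid Q) (A t)) \<longlonglongrightarrow> measure (iid Q) (\<Union>t. A t)"
      using A by (intro finite_Lim_measure_incseq) (auto simp: incseq_def A_def intro: order_trans)
    moreover have "measure (iid Q) (\<Union>t. A t) = 1"
      using power Q unfolding power_one_test_def un by (simp add: measure_def)
    ultimately have "(\<lambda>t. measure (iid Q) (A t)) \<longlonglongrightarrow> 1" by simp
    then have "\<forall>\<^sub>F t in sequentially. \<alpha> < measure (iid Q) (A t)" using \<alpha>(2) by (rule order_tendstoD)
    then obtain t where "\<alpha> < measure (iid Q) (A t)" by (auto simp: eventually_sequentially)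
    then show "\<exists>m. 0 < (\<integral>x. h m x \<partial>iid_n (Suc m) Q)"
      unfolding hI[OF Q'] A_def by (intro exI[of _ t]) simp
  qed
  then show ?thesis by (rule that)
qed

text \<open>Transfers the product formula from the randomized model to the plain law of the
  observations by attaching a one-point auxiliary space.\<close>

lemma nn_integral_block_prod_iid:
  assumes P: "P \<in> space (prob_algebra M)" and e: "e \<in> borel_measurable (iid_n n M)"
  shows "(\<integral>\<^sup>+\<omega>. block_prod e n 0 k \<omega> \<partial>iid P) = (\<integral>\<^sup>+x. e x \<partial>iid_n n P) ^ k"
proof -
  define U :: "unit measure" where "U = return (count_space UNIV) ()"
  define G :: "nat \<Rightarrow> unit measure" where "G = (\<lambda>_. count_space UNIV)"
  have aux: "aux_randomization U G"
    by (auto simp: aux_randomization_def U_def G_def filtration_def intro!: prob_space_return)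
  interpret change_model M U G using aux space_nonempty_of_law[OF P] by unfold_locales
  interpret U: prob_space U by (rule prob_U)
  interpret N: prob_space "null_law U P" unfolding null_law_eq by (intro prob_space_obs_law P)
  have bm: "(\<lambda>\<omega>. block_prod e n 0 k (fst \<omega>)) \<in> borel_measurable (iid P \<Otimes>\<^sub>M U)"
    using measurable_F_obs_law[of "\<lambda>_. P", OF P measurable_block_prod[OF e order_refl]]
    unfolding null_law_eq[symmetric] null_law_def .
  have "(\<integral>\<^sup>+\<omega>. block_prod e n 0 k \<omega> \<partial>iid P) = (\<integral>\<^sup>+\<omega>. block_prod e n 0 k (fst \<omega>) \<partial>null_law U P)"
    unfolding null_law_def using U.nn_integral_fst[OF bm] by (simp add: U.emeasure_space_1)
  also have "\<dots> = (\<integral>\<^sup>+x. e x \<partial>iid_n n P) ^ k"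
    using nn_integral_block_prod[of "\<lambda>_. P" 0 P e n "\<lambda>_. 1" k, OF P refl e]
    by (simp add: null_law_eq[symmetric] N.emeasure_space_1)
  finally show ?thesis .
qed

text \<open>With \<open>r = sqrt \<rho>\<close> the expression equals
  \<open>(k * r ^ k) ^ 2 + (k * r ^ k) * r ^ k\<close>, and both \<open>k * r ^ k\<close> and
  \<open>r ^ k\<close> tend to 0.\<close>

lemma square_times_power_tendsto_0:
  fixes \<rho> :: real
  assumes "0 < \<rho>" "\<rho> < 1"
  shows "(\<lambda>k. real (k * Suc k) * \<rho> ^ k) \<longlonglongrightarrow> 0"
proof -
  define r where "r = sqrt \<rho>"
  have r: "\<bar>r\<bar> < 1" and \<rho>: "\<rho> = r * r" using assms by (auto simp: r_def)
  have "(\<lambda>k. real k * r ^ k) \<longlonglongrightarrow> 0"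
    using powser_times_n_limit_0[of r] r by simp
  moreover have "(\<lambda>k. r ^ k) \<longlonglongrightarrow> 0" using LIMSEQ_abs_realpow_zero2[OF r] .
  ultimately have "(\<lambda>k. (real k * r ^ k) * (real k * r ^ k) + (real k * r ^ k) * r ^ k) \<longlonglongrightarrow> 0 * 0 + 0 * 0"
    by (intro tendsto_add tendsto_mult)
  moreover have "(real k * r ^ k) * (real k * r ^ k) + (real k * r ^ k) * r ^ k = real (k * Suc k) * \<rho> ^ k" for k
    unfolding \<rho> power_mult_distrib by (simp add: algebra_simps)
  ultimately show ?thesis by simp
qed

text \<open>The test rejects when the wealth of bet \<open>m\<close> after \<open>k\<close> blocks
  reaches \<open>k * (k + 1) / w m\<close>. Markov's inequality at each pair \<open>(m, k)\<close>
  and a union bound take the place of a maximal inequality: the reciprocals telescope to 1 over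
  \<open>k\<close>, and the \<open>w m\<close> sum to 1/2. Under an alternative the polynomial
  threshold is overtaken by the exponential growth of the wealth.\<close>

lemma sequentially_testable_of_betting_family:
  assumes \<P>: "\<P> \<subseteq> space (prob_algebra M)" and \<Q>: "\<Q> \<subseteq> space (prob_algebra M)"
    and bet: "betting_family M \<P> \<Q> n e"
  shows "sequentially_testable M \<P> \<Q>"
proof -
  have n: "1 \<le> n i" and e: "e i \<in> borel_measurable (iid_n (n i) M)"
    and e0: "e i x \<noteq> 0" "e i x \<noteq> \<infinity>" and e1: "P \<in> \<P> \<Longrightarrow> (\<integral>\<^sup>+x. e i x \<partial>iid_n (n i) P) \<le> 1" for i x P
    using bet by (auto simp: betting_family_def)
  define w where "w m = (1/2::real) * (1/2) ^ Suc m" for m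
  have w: "0 < w m" for m by (simp add: w_def)
  define b where "b m k = real (k * Suc k) / w m" for m k
  define hit where "hit m k \<omega> \<longleftrightarrow> ennreal (b m k) \<le> block_prod (e m) (n m) 0 k \<omega>" for m k \<omega>
  \<comment> \<open>A 0-1 process, introduced so that the first rejection time becomes a
    \<open>threshold_family\<close> at level 1.\<close>
  define D where "D t \<omega> = (of_bool (\<exists>m k. 1 \<le> k \<and> t = k * n m \<and> hit m k \<omega>) :: ennreal)" for t \<omega>
  define \<tau> where "\<tau> = threshold_family D 1"
  have D1: "ennreal 1 \<le> D t \<omega> \<longleftrightarrow> (\<exists>m k. 1 \<le> k \<and> t = k * n m \<and> hit m k \<omega>)" for t \<omega>
    unfolding D_def of_bool_def by (simp split: if_split)
  have hit_meas: "Measurable.pred (obs_filtration M t) (hit m k)" if "k * n m \<le> t" for m k t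
  proof -
    have [measurable]: "block_prod (e m) (n m) 0 k \<in> borel_measurable (obs_filtration M t)"
      using that by (intro measurable_block_prod_obs_filtration e) simp
    show ?thesis unfolding hit_def by measurable
  qed
  have stop: "sequential_test M \<tau>"
    unfolding sequential_test_def ext_stopping_time_def
  proof (intro conjI allI ballI)
    fix t
    have "Measurable.pred (obs_filtration M t) (\<lambda>\<omega>. 1 \<le> k \<and> s = k * n m \<and> hit m k \<omega>)"
      if "s \<in> {1..t}" for s m k
    proof (cases "1 \<le> k \<and> s = k * n m")
      case True
      then show ?thesis using hit_meas[of k m t] that by auto
    next
      case False
      then have "(\<lambda>\<omega>. 1 \<le> k \<and> s = k * n m \<and> hit m k \<omega>) = (\<lambda>_. False)" by auto
      then show ?thesis by simp
    qed
    then have "Measurable.pred (obs_filtration M t) (\<lambda>\<omega>. \<exists>m k. 1 \<le> k \<and> s = k * n m \<and> hit m k \<omega>)"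
      if "s \<in> {1..t}" for s
      using that by (intro pred_intros_countable(2))
    then show "Measurable.pred (obs_filtration M t) (\<lambda>\<omega>. \<tau> \<omega> \<le> enat t)"
      unfolding \<tau>_def threshold_family_le_iff D1
      by (rule pred_intros_finite(4)[OF finite_atLeastAtMost])
  next
    fix \<omega> show "1 \<le> \<tau> \<omega>"
      unfolding \<tau>_def threshold_family_def by (intro Inf_greatest) (auto simp: one_enat_def)
  qed
  have fin: "\<tau> \<omega> < \<infinity> \<longleftrightarrow> (\<exists>m k. hit m (Suc k) \<omega>)" for \<omega>
  proof
    assume "\<tau> \<omega> < \<infinity>"
    then obtain t where "\<tau> \<omega> \<le> enat t" by (cases "\<tau> \<omega>") auto
    then obtain m k where "1 \<le> k" "hit m k \<omega>"
      unfolding \<tau>_def threshold_family_le_iff D1 by blast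
    then show "\<exists>m k. hit m (Suc k) \<omega>" by (cases k) auto
  next
    assume "\<exists>m k. hit m (Suc k) \<omega>"
    then obtain m k where mk: "hit m (Suc k) \<omega>" by auto
    have "1 \<le> Suc k * n m" using n[of m] by simp
    then have "\<tau> \<omega> \<le> enat (Suc k * n m)"
      unfolding \<tau>_def threshold_family_le_iff D1 using mk
      by (intro bexI[of _ "Suc k * n m"] exI[of _ m] exI[of _ "Suc k"]) auto
    then show "\<tau> \<omega> < \<infinity>" by (auto dest: le_enat_finite)
  qed
  have level: "emeasure (iid P) {\<omega>\<in>space (iid P). \<tau> \<omega> < \<infinity>} \<le> ennreal (1/2)" if P: "P \<in> \<P>" for P
  proof -
    have P': "P \<in> space (prob_algebra M)" using P \<P> by auto
    define A where "A m k = {\<omega>\<in>space (iid P). hit m (Suc k) \<omega>}" for m k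
    have A [measurable]: "A m k \<in> sets (iid P)" for m k
      unfolding A_def using measurable_obs_filtration_iid[OF P' hit_meas[OF order_refl]] by measurable
    have bm: "block_prod (e m) (n m) 0 k \<in> borel_measurable (iid P)" for m k
      by (intro measurable_obs_filtration_iid[OF P' measurable_block_prod_obs_filtration[OF e order_refl]])
    have Ab: "emeasure (iid P) (A m k) \<le> ennreal (w m) * ennreal (1 / real (Suc k * Suc (Suc k)))" for m k
    proof -
      have bpos: "0 < b m (Suc k)" unfolding b_def using w[of m] by (intro divide_pos_pos) (auto simp del: of_nat_mult)
      have "ennreal (b m (Suc k)) * emeasure (iid P) (A m k) =
          (\<integral>\<^sup>+\<omega>. ennreal (b m (Suc k)) * indicator (A m k) \<omega> \<partial>iid P)"
        by (simp add: nn_integral_cmult_indicator)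
      also have "\<dots> \<le> (\<integral>\<^sup>+\<omega>. block_prod (e m) (n m) 0 (Suc k) \<omega> \<partial>iid P)"
        by (intro nn_integral_mono) (auto simp: indicator_def A_def hit_def)
      also have "\<dots> \<le> 1"
        unfolding nn_integral_block_prod_iid[OF P' e] by (intro power_le_one e1 P) auto
      finally have "emeasure (iid P) (A m k) * ennreal (b m (Suc k)) \<le> 1" by (simp add: mult.commute)
      then have "emeasure (iid P) (A m k) \<le> 1 / ennreal (b m (Suc k))"
        using bpos by (intro le_divide_ennrealI) auto
      also have "\<dots> = ennreal (1 / b m (Suc k))"
        using divide_ennreal[of 1 "b m (Suc k)"] bpos by simp
      also have "1 / b m (Suc k) = w m * (1 / real (Suc k * Suc (Suc k)))" by (simp add: b_def)
      also have "ennreal \<dots> = ennreal (w m) * ennreal (1 / real (Suc k * Suc (Suc k)))"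
        using w[of m] by (intro ennreal_mult) auto
      finally show ?thesis .
    qed
    have tel: "(\<Sum>k. ennreal (1 / real (Suc k * Suc (Suc k)))) = 1"
    proof -
      have "(\<lambda>k. 1 / real (Suc k) - 1 / real (Suc (Suc k))) sums (1 / real (Suc 0) - 0)"
        by (intro telescope_sums' LIMSEQ_Suc lim_1_over_n)
      moreover have "1 / real (Suc k) - 1 / real (Suc (Suc k)) = 1 / real (Suc k * Suc (Suc k))" for k
        by (simp add: field_simps)
      ultimately have "(\<lambda>k. 1 / real (Suc k * Suc (Suc k))) sums 1" by simp
      then have "(\<Sum>k. ennreal (1 / real (Suc k * Suc (Suc k)))) = ennreal 1"
        by (intro suminf_ennreal_eq) auto
      then show ?thesis by (simp only: ennreal_1)
    qed
    have "{\<omega>\<in>space (iid P). \<tau> \<omega> < \<infinity>} = (\<Union>m. \<Union>k. A m k)" unfolding fin A_def by auto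
    also have "emeasure (iid P) \<dots> \<le> (\<Sum>m. emeasure (iid P) (\<Union>k. A m k))"
      by (intro emeasure_subadditive_countably) auto
    also have "\<dots> \<le> (\<Sum>m. \<Sum>k. emeasure (iid P) (A m k))"
      by (intro suminf_le emeasure_subadditive_countably) auto
    also have "\<dots> \<le> (\<Sum>m. \<Sum>k. ennreal (w m) * ennreal (1 / real (Suc k * Suc (Suc k))))"
      by (intro suminf_le Ab) auto
    also have "\<dots> = (\<Sum>m. ennreal ((1/2) ^ Suc m) * ennreal (1/2))"
    proof -
      have "ennreal (w m) = ennreal ((1/2) ^ Suc m) * ennreal (1/2)" for m
        unfolding w_def by (subst mult.commute) (rule ennreal_mult, auto)
      then show ?thesis unfolding ennreal_suminf_cmult tel mult_1_right by presburger
    qed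
    also have "\<dots> = ennreal (1/2)" by (rule suminf_half_powers)
    finally show ?thesis .
  qed
  have power: "emeasure (iid Q) {\<omega>\<in>space (iid Q). \<tau> \<omega> < \<infinity>} = 1" if Q: "Q \<in> \<Q>" for Q
  proof -
    have Q': "Q \<in> space (prob_algebra M)" using Q \<Q> by auto
    interpret prob_space "iid Q" by (rule prob_space_iid[OF Q'])
    obtain m \<rho> where \<rho>: "0 < \<rho>" "\<rho> < 1" "(\<integral>\<^sup>+x. inverse (e m x) \<partial>iid_n (n m) Q) \<le> ennreal \<rho>"
      using bet Q unfolding betting_family_def by blast
    let ?i = "\<lambda>x. inverse (e m x)"
    have i: "?i \<in> borel_measurable (iid_n (n m) M)" using e[of m] by measurable
    have S: "{\<omega>\<in>space (iid Q). \<tau> \<omega> < \<infinity>} \<in> sets (iid Q)"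
    proof -
      have [measurable]: "Measurable.pred (iid Q) (hit m k)" for m k
        by (rule measurable_obs_filtration_iid[OF Q' hit_meas[OF order_refl]])
      show ?thesis unfolding fin by measurable
    qed
    define N where "N = space (iid Q) - {\<omega>\<in>space (iid Q). \<tau> \<omega> < \<infinity>}"
    have N: "N \<in> events" unfolding N_def using S by auto
    \<comment> \<open>Never rejecting means missing every single threshold, so the bound holds for
      all \<open>k\<close> and its limit 0 bounds the probability.\<close>
    have Nb: "prob N \<le> real (k * Suc k) * \<rho> ^ k / w m" if k: "1 \<le> k" for k
    proof -
      obtain k' where k': "k = Suc k'" using k by (cases k) auto
      have b0: "0 \<le> b m k" using w[of m] by (simp add: b_def)
      have "emeasure (iid Q) N = (\<integral>\<^sup>+\<omega>. indicator N \<omega> \<partial>iid Q)" using N by simp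
      also have "\<dots> \<le> (\<integral>\<^sup>+\<omega>. ennreal (b m k) * block_prod ?i (n m) 0 k \<omega> \<partial>iid Q)"
      proof (intro nn_integral_mono)
        fix \<omega>
        show "indicator N \<omega> \<le> ennreal (b m k) * block_prod ?i (n m) 0 k \<omega>"
        proof (cases "\<omega> \<in> N")
          case True
          then have "\<not> hit m k \<omega>" unfolding N_def fin k' by auto
          then have "block_prod (e m) (n m) 0 k \<omega> \<le> ennreal (b m k)" by (simp add: hit_def)
          then have "block_prod (e m) (n m) 0 k \<omega> * block_prod ?i (n m) 0 k \<omega>
              \<le> ennreal (b m k) * block_prod ?i (n m) 0 k \<omega>" by (intro mult_right_mono) auto
          then show ?thesis using True block_prod_inverse[of "e m", OF e0] by simp
        qed simp
      qed
      also have "\<dots> = ennreal (b m k) * (\<integral>\<^sup>+x. ?i x \<partial>iid_n (n m) Q) ^ k"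
        using measurable_obs_filtration_iid[OF Q' measurable_block_prod_obs_filtration[OF i order_refl]]
        by (subst nn_integral_cmult) (auto simp: nn_integral_block_prod_iid[OF Q' i])
      also have "\<dots> \<le> ennreal (b m k) * ennreal \<rho> ^ k"
        by (intro mult_left_mono power_mono \<rho>) auto
      also have "\<dots> = ennreal (b m k * \<rho> ^ k)"
        using b0 \<rho> by (simp add: ennreal_mult ennreal_power)
      finally have "prob N \<le> b m k * \<rho> ^ k" using b0 \<rho> by (simp add: emeasure_eq_measure)
      then show ?thesis by (simp add: b_def)
    qed
    have "(\<lambda>k. real (k * Suc k) * \<rho> ^ k / w m) \<longlonglongrightarrow> 0"
      using tendsto_divide[OF square_times_power_tendsto_0[OF \<rho>(1,2)] tendsto_const[of "w m"]] w[of m] by simp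
    then have "prob N \<le> 0" using Nb by (intro LIMSEQ_le_const) auto
    then have "prob {\<omega>\<in>space (iid Q). \<tau> \<omega> < \<infinity>} = 1"
      using prob_compl[OF S] prob_le_1[of "{\<omega>\<in>space (iid Q). \<tau> \<omega> < \<infinity>}"] unfolding N_def by linarith
    then show ?thesis by (simp add: emeasure_eq_measure)
  qed
  show ?thesis
    unfolding sequentially_testable_def level_test_def power_one_test_def
    using stop level power by (intro exI[of _ "1/2"] exI[of _ \<tau>]) (auto intro!: SUP_least)
qed

section \<open>Testing functions from alarm times\<close>

context change_model
begin

text \<open>Validity is applied to the constant times \<open>t < k\<close>; the truncated mean is
  the sum of its tail probabilities, each at least \<open>1 - t / k\<close>.\<close>

lemma mean_min_time_ge:
  assumes P: "P \<in> \<P>" "\<P> \<subseteq> space (prob_algebra M)" and k: "1 \<le> k"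
    and T: "optionally_ARL_valid M U G \<P> (real k) T"
  shows "ennreal ((real k + 1) / 2) \<le> (\<integral>\<^sup>+\<omega>. ennreal_of_enat (min (T \<omega>) (enat k)) \<partial>null_law U P)"
proof -
  let ?L = "null_law U P"
  have P': "P \<in> space (prob_algebra M)" using P by auto
  interpret prob_space ?L unfolding null_law_eq by (intro prob_space_obs_law P')
  have st: "ext_stopping_time F T" using T by (simp add: optionally_ARL_valid_def alarm_time_def)
  have m: "(\<lambda>\<omega>. min (T \<omega>) (enat k)) \<in> measurable ?L (count_space UNIV)"
    unfolding null_law_eq
    by (intro measurable_enat_obs_law[of "\<lambda>_. P"] P' ext_stopping_time_min st ext_stopping_time_const)
  have tail: "ennreal (1 - real t / real k) \<le> emeasure ?L {\<omega>\<in>space ?L. enat t < min (T \<omega>) (enat k)}"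
    if t: "t < k" for t
  proof -
    have pr: "Measurable.pred ?L (\<lambda>\<omega>. T \<omega> \<le> enat t)"
      unfolding null_law_eq
      by (rule measurable_F_obs_law[of "\<lambda>_. P", OF P' ext_stopping_time_enat(1)[OF st order_refl]])
    then have S: "{\<omega>\<in>space ?L. T \<omega> \<le> enat t} \<in> events" by measurable
    have "emeasure ?L {\<omega>\<in>space ?L. T \<omega> < \<infinity> \<and> T \<omega> \<le> enat t} \<le> mean_time ?L (\<lambda>_. enat t) / ennreal (real k)"
      using T P(1) ext_stopping_time_const[of "enat t"] unfolding optionally_ARL_valid_def by blast
    also have "{\<omega>\<in>space ?L. T \<omega> < \<infinity> \<and> T \<omega> \<le> enat t} = {\<omega>\<in>space ?L. T \<omega> \<le> enat t}"
      by (auto dest: le_enat_finite)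
    also have "mean_time ?L (\<lambda>_. enat t) / ennreal (real k) = ennreal (real t / real k)"
      using k by (simp add: mean_time_def emeasure_space_1 ennreal_of_nat_eq_real_of_nat divide_ennreal)
    finally have "prob {\<omega>\<in>space ?L. T \<omega> \<le> enat t} \<le> real t / real k"
      by (simp add: emeasure_eq_measure)
    then have "1 - real t / real k \<le> prob (space ?L - {\<omega>\<in>space ?L. T \<omega> \<le> enat t})"
      using prob_compl[OF S] by linarith
    also have "space ?L - {\<omega>\<in>space ?L. T \<omega> \<le> enat t} = {\<omega>\<in>space ?L. enat t < min (T \<omega>) (enat k)}"
      using t by auto
    finally show ?thesis by (simp add: emeasure_eq_measure ennreal_leI)
  qed
  have "(\<Sum>t<k. 1 - real t / real k) = (real k + 1) / 2"
  proof -
    have "2 * (\<Sum>t<j. real t) = real j * (real j - 1)" for j by (induction j) (auto simp: algebra_simps)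
    from this[of k] have "(\<Sum>t<k. real t) = real k * (real k - 1) / 2" by simp
    then show ?thesis using k by (simp add: sum_subtractf sum_divide_distrib[symmetric] field_simps)
  qed
  then have "ennreal ((real k + 1) / 2) = (\<Sum>t<k. ennreal (1 - real t / real k))"
    by (subst sum_ennreal) auto
  also have "\<dots> \<le> (\<Sum>t<k. emeasure ?L {\<omega>\<in>space ?L. enat t < min (T \<omega>) (enat k)})"
    by (intro sum_mono tail) auto
  also have "\<dots> \<le> (\<Sum>t. emeasure ?L {\<omega>\<in>space ?L. enat t < min (T \<omega>) (enat k)})"
    by (intro sum_le_suminf) auto
  also have "\<dots> = (\<integral>\<^sup>+\<omega>. ennreal_of_enat (min (T \<omega>) (enat k)) \<partial>?L)"
    by (rule nn_integral_enat_function[symmetric, OF m])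
  finally show ?thesis .
qed

text \<open>With the change at time 1 all observations already follow the alternative, and a mean
  never exceeds the essential supremum of a conditional mean given \<open>F 0\<close>. The law
  \<open>P\<close> witnesses that the supremum over null laws is not empty.\<close>

lemma mean_time_le_lorden_delay:
  assumes P: "P \<in> \<P>" "\<P> \<subseteq> space (prob_algebra M)" and Q: "Q \<in> space (prob_algebra M)"
    and T: "ext_stopping_time F T"
  shows "(\<integral>\<^sup>+\<omega>. ennreal_of_enat (T \<omega>) \<partial>null_law U Q) \<le> lorden_delay M U G \<P> Q T"
proof -
  let ?L = "null_law U Q"
  have L: "?L = change_law U P Q 1" by (simp add: null_law_eq change_law_eq)
  have L': "?L = obs_law U (\<lambda>_. Q)" by (rule null_law_eq)
  interpret prob_space ?L unfolding L' by (intro prob_space_obs_law Q)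
  interpret sigma_finite_subalgebra ?L "F 0" unfolding L' by (intro sigma_finite_subalgebra_F Q)
  have [measurable]: "T \<in> measurable ?L (count_space UNIV)"
    unfolding L' by (intro measurable_enat_obs_law[of "\<lambda>_. Q"] Q T)
  let ?f = "\<lambda>\<omega>. ennreal_of_enat (T \<omega> + 1 - enat 1)"
  have f: "T \<omega> + 1 - enat 1 = T \<omega>" for \<omega> by (cases "T \<omega>") (auto simp: one_enat_def)
  have "(\<integral>\<^sup>+\<omega>. ennreal_of_enat (T \<omega>) \<partial>?L) = (\<integral>\<^sup>+\<omega>. 1 * ?f \<omega> \<partial>?L)" unfolding f by simp
  also have "\<dots> = (\<integral>\<^sup>+\<omega>. 1 * nn_cond_exp ?L (F 0) ?f \<omega> \<partial>?L)"
    unfolding f by (intro nn_cond_exp_intg[symmetric]) auto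
  also have "\<dots> \<le> (\<integral>\<^sup>+\<omega>. esssup ?L (nn_cond_exp ?L (F 0) ?f) \<partial>?L)"
    by (intro nn_integral_mono_AE) (simp add: esssup_AE)
  also have "\<dots> = esssup ?L (nn_cond_exp ?L (F 0) ?f)" by (simp add: emeasure_space_1)
  also have "\<dots> \<le> lorden_delay M U G \<P> Q T"
    unfolding lorden_delay_def
    by (intro SUP_upper2[OF P(1)] SUP_upper2[of "1::nat"]) (simp_all add: L)
  finally show ?thesis .
qed

text \<open>Truncation at \<open>k\<close> makes the alarm time a bounded function of the first
  \<open>k\<close> observations and the randomization, and the latter is integrated out. The margin
  between \<open>(k + 1) / 2\<close> and \<open>k / 2\<close> yields the strict inequality under
  \<open>Q\<close>.\<close>

lemma alarm_testing_function:
  assumes \<P>: "\<P> \<subseteq> space (prob_algebra M)" "\<P> \<noteq> {}" and k: "1 \<le> k"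
    and T: "optionally_ARL_valid M U G \<P> (real k) T"
  obtains h where "h \<in> borel_measurable (iid_n k M)"
    and "\<exists>C. \<forall>x\<in>space (iid_n k M). \<bar>h x :: real\<bar> \<le> C"
    and "\<And>P. P \<in> \<P> \<Longrightarrow> (\<integral>x. h x \<partial>iid_n k P) \<le> 0"
    and "\<And>Q. Q \<in> space (prob_algebra M) \<Longrightarrow> lorden_delay M U G \<P> Q T < ennreal (real k / 2) \<Longrightarrow>
      0 < (\<integral>x. h x \<partial>iid_n k Q)"
proof -
  interpret U: prob_space U by (rule prob_U)
  have st: "ext_stopping_time F T" using T by (simp add: optionally_ARL_valid_def alarm_time_def)
  define f where "f \<omega> = ennreal_of_enat (min (T \<omega>) (enat k))" for \<omega>
  have fk: "f \<omega> \<le> of_nat k" for \<omega>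
  proof -
    have "f \<omega> \<le> ennreal_of_enat (enat k)" unfolding f_def by (subst ennreal_of_enat_le_iff) simp
    then show ?thesis by simp
  qed
  have "f \<in> borel_measurable (F k)"
  proof -
    \<comment> \<open>As a sum of tail indicators the truncated time involves only events known by
      time \<open>k\<close>.\<close>
    have "f \<omega> = (\<Sum>t<k. of_bool (enat t < T \<omega>))" for \<omega>
    proof (cases "T \<omega>")
      case (enat j)
      have "(\<Sum>t<k. of_bool (t < j) :: ennreal) = of_nat (card ({..<k} \<inter> {..<j}))"
        by (simp add: sum.If_cases of_bool_def lessThan_def)
      also have "{..<k} \<inter> {..<j} = {..<min j k}" by auto
      finally show ?thesis using enat by (simp add: f_def)
    qed (simp add: f_def)
    then have "f = (\<lambda>\<omega>. \<Sum>t<k. of_bool (enat t < T \<omega>))" by (rule ext)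
    moreover have "(\<lambda>\<omega>. \<Sum>t<k. of_bool (enat t < T \<omega>) :: ennreal) \<in> borel_measurable (F k)"
      by (intro borel_measurable_sum borel_measurable_of_bool ext_stopping_time_enat(2)[OF st]) auto
    ultimately show ?thesis by simp
  qed
  \<comment> \<open>\<open>G k\<close> is replaced by the whole of \<open>U\<close>, because the
    randomization is averaged under the law \<open>U\<close>.\<close>
  moreover have "(\<lambda>\<omega>. \<omega>) \<in> measurable (obs_filtration M k \<Otimes>\<^sub>M U) (F k)"
  proof -
    have "(\<lambda>u. u) \<in> measurable U (G k)"
      using sets_G by (auto simp: measurable_def dest: sets.sets_into_space)
    then have "(\<lambda>\<omega>. (fst \<omega>, snd \<omega>)) \<in> measurable (obs_filtration M k \<Otimes>\<^sub>M U) (F k)"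
      unfolding full_filtration_def by (intro measurable_Pair measurable_fst measurable_compose[OF measurable_snd])
    then show ?thesis by simp
  qed
  ultimately have fU: "f \<in> borel_measurable (obs_filtration M k \<Otimes>\<^sub>M U)"
    using measurable_compose by blast
  have "(\<lambda>x. \<integral>\<^sup>+u. f (x, u) \<partial>U) \<in> borel_measurable (obs_filtration M k)"
    using fU by (intro U.borel_measurable_nn_integral) simp
  from obs_filtration_factor[OF this space_nonempty] obtain H :: "_ \<Rightarrow> ennreal" where
    Hm: "H \<in> borel_measurable (PiM {..<k} (\<lambda>_. M))" and
    H: "\<And>x. x \<in> space (PiM UNIV (\<lambda>_. M)) \<Longrightarrow> (\<integral>\<^sup>+u. f (x, u) \<partial>U) = H (restrict x {..<k})"
    by blast
  \<comment> \<open>\<open>H\<close> is arbitrary off the sample space; the cap, which is inactive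
    on it, makes \<open>g\<close> bounded everywhere.\<close>
  define g where "g y = enn2real (min (H y) (of_nat k))" for y
  have gm: "g \<in> borel_measurable (iid_n k M)" unfolding g_def iid_n_def using Hm by measurable
  have g0: "0 \<le> g y" and gk: "g y \<le> real k" for y
  proof -
    show "0 \<le> g y" by (simp add: g_def)
    have "g y \<le> enn2real (of_nat k)"
      unfolding g_def by (intro enn2real_mono) (auto simp: of_nat_less_top)
    then show "g y \<le> real k" by simp
  qed
  have gI: "ennreal (\<integral>y. g y \<partial>iid_n k R) = (\<integral>\<^sup>+\<omega>. f \<omega> \<partial>null_law U R)" and gi: "integrable (iid_n k R) g"
    if R: "R \<in> space (prob_algebra M)" for R
  proof -
    have fL: "f \<in> borel_measurable (iid R \<Otimes>\<^sub>M U)"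
      using measurable_F_obs_law[of "\<lambda>_. R", OF R \<open>f \<in> borel_measurable (F k)\<close>]
      unfolding null_law_eq[symmetric] null_law_def .
    show gi: "integrable (iid_n k R) g"
      by (rule integrable_iid_n_bounded[OF R gm, of "real k"]) (use g0 gk in auto)
    have "ennreal (\<integral>y. g y \<partial>iid_n k R) = (\<integral>\<^sup>+y. ennreal (g y) \<partial>iid_n k R)"
      using gi g0 by (intro nn_integral_eq_integral[symmetric]) auto
    also have "\<dots> = (\<integral>\<^sup>+x. ennreal (g (restrict x {..<k})) \<partial>iid R)"
      using gm by (intro nn_integral_iid_restrict[OF R] measurable_compose[OF _ measurable_ennreal])
    also have "\<dots> = (\<integral>\<^sup>+x. (\<integral>\<^sup>+u. f (x, u) \<partial>U) \<partial>iid R)"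
    proof (intro nn_integral_cong)
      fix x assume "x \<in> space (iid R)"
      then have e: "(\<integral>\<^sup>+u. f (x, u) \<partial>U) = H (restrict x {..<k})" by (intro H) (simp add: space_iid[OF R])
      have "(\<integral>\<^sup>+u. f (x, u) \<partial>U) \<le> (\<integral>\<^sup>+u. of_nat k \<partial>U)" by (intro nn_integral_mono fk)
      then have "H (restrict x {..<k}) \<le> of_nat k" by (simp add: e U.emeasure_space_1)
      then have "min (H (restrict x {..<k})) (of_nat k) = H (restrict x {..<k})"
          "H (restrict x {..<k}) < top"
        using of_nat_less_top[of k] by (auto simp: min_def intro: le_less_trans)
      then show "ennreal (g (restrict x {..<k})) = (\<integral>\<^sup>+u. f (x, u) \<partial>U)" by (simp add: g_def e)
    qed
    also have "\<dots> = (\<integral>\<^sup>+\<omega>. f \<omega> \<partial>null_law U R)"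
      unfolding null_law_def using U.nn_integral_fst[OF fL] by simp
    finally show "ennreal (\<integral>y. g y \<partial>iid_n k R) = (\<integral>\<^sup>+\<omega>. f \<omega> \<partial>null_law U R)" .
  qed
  define h where "h y = (real k + 1) / 2 - g y" for y
  have hI: "(\<integral>y. h y \<partial>iid_n k R) = (real k + 1) / 2 - (\<integral>y. g y \<partial>iid_n k R)"
    if R: "R \<in> space (prob_algebra M)" for R
  proof -
    interpret prob_space "iid_n k R" by (rule iid_n_law[OF R])
    show ?thesis unfolding h_def using gi[OF R]
      by (subst Bochner_Integration.integral_diff) (auto simp: prob_space)
  qed
  have gI0: "0 \<le> (\<integral>y. g y \<partial>iid_n k R)" for R using g0 by simp
  show ?thesis
  proof (rule that[of h])
    show "h \<in> borel_measurable (iid_n k M)" unfolding h_def using gm by measurable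
    have "\<bar>h x\<bar> \<le> real k + 1" for x
      unfolding h_def abs_le_iff using g0[of x] gk[of x] by (auto simp: field_simps)
    then show "\<exists>C. \<forall>x\<in>space (iid_n k M). \<bar>h x\<bar> \<le> C" by blast
  next
    fix P assume P: "P \<in> \<P>"
    then have P': "P \<in> space (prob_algebra M)" using \<P> by auto
    have "ennreal ((real k + 1) / 2) \<le> ennreal (\<integral>y. g y \<partial>iid_n k P)"
      unfolding gI[OF P'] f_def by (rule mean_min_time_ge[OF P \<P>(1) k T])
    then show "(\<integral>x. h x \<partial>iid_n k P) \<le> 0"
      unfolding hI[OF P'] using gI0 by (simp add: ennreal_le_iff)
  next
    fix Q assume Q: "Q \<in> space (prob_algebra M)" and lt: "lorden_delay M U G \<P> Q T < ennreal (real k / 2)"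
    obtain P where P: "P \<in> \<P>" using \<P> by auto
    have "ennreal (\<integral>y. g y \<partial>iid_n k Q) \<le> (\<integral>\<^sup>+\<omega>. ennreal_of_enat (T \<omega>) \<partial>null_law U Q)"
      unfolding gI[OF Q] f_def by (intro nn_integral_mono) (subst ennreal_of_enat_le_iff, simp)
    also have "\<dots> \<le> lorden_delay M U G \<P> Q T" by (rule mean_time_le_lorden_delay[OF P \<P>(1) Q st])
    also note lt
    finally have "(\<integral>y. g y \<partial>iid_n k Q) < real k / 2" using gI0 by (simp add: ennreal_less_iff)
    then show "0 < (\<integral>x. h x \<partial>iid_n k Q)" unfolding hI[OF Q] by simp
  qed
qed

end

text \<open>One function is built per integer scale, without reference to \<open>Q\<close>. The
  scales in the fourth condition are integers, so the resulting family is countable.\<close>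

lemma testing_family_of_alarms:
  fixes U :: "'b measure"
  assumes \<P>: "\<P> \<subseteq> space (prob_algebra M)" "\<P> \<noteq> {}" and \<Q>: "\<Q> \<subseteq> space (prob_algebra M)"
    and aux: "aux_randomization U G" and T: "optionally_ARL_valid_family M U G \<P> T"
    and delay: "\<And>Q. Q \<in> \<Q> \<Longrightarrow> \<exists>k::nat. 3 \<le> k \<and> lorden_delay M U G \<P> Q (T (real k)) < ennreal (real k / 2)"
  obtains n h where "testing_family M \<P> \<Q> n h"
proof -
  have "space M \<noteq> {}" using \<P> space_nonempty_of_law by blast
  then interpret change_model M U G using aux by unfold_locales
  have "\<exists>h. h \<in> borel_measurable (iid_n (Suc j) M) \<and>
      (\<exists>C. \<forall>x\<in>space (iid_n (Suc j) M). \<bar>h x :: real\<bar> \<le> C) \<and>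
      (\<forall>P\<in>\<P>. (\<integral>x. h x \<partial>iid_n (Suc j) P) \<le> 0) \<and>
      (\<forall>Q\<in>space (prob_algebra M). lorden_delay M U G \<P> Q (T (real (Suc j))) < ennreal (real (Suc j) / 2) \<longrightarrow>
        0 < (\<integral>x. h x \<partial>iid_n (Suc j) Q))" for j
  proof -
    have "optionally_ARL_valid M U G \<P> (real (Suc j)) (T (real (Suc j)))"
      using T by (simp add: optionally_ARL_valid_family_def)
    from alarm_testing_function[OF \<P> _ this] show ?thesis by (metis le_add1 plus_1_eq_Suc)
  qed
  then obtain h where h: "\<And>j. h j \<in> borel_measurable (iid_n (Suc j) M) \<and>
      (\<exists>C. \<forall>x\<in>space (iid_n (Suc j) M). \<bar>h j x :: real\<bar> \<le> C) \<and>
      (\<forall>P\<in>\<P>. (\<integral>x. h j x \<partial>iid_n (Suc j) P) \<le> 0) \<and>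
      (\<forall>Q\<in>space (prob_algebra M). lorden_delay M U G \<P> Q (T (real (Suc j))) < ennreal (real (Suc j) / 2) \<longrightarrow>
        0 < (\<integral>x. h j x \<partial>iid_n (Suc j) Q))"
    by metis
  have "testing_family M \<P> \<Q> Suc h"
    unfolding testing_family_def
  proof (intro conjI allI ballI)
    fix Q assume Q: "Q \<in> \<Q>"
    obtain k :: nat where k: "3 \<le> k" "lorden_delay M U G \<P> Q (T (real k)) < ennreal (real k / 2)"
      using delay[OF Q] by auto
    then obtain j where "k = Suc j" by (cases k) auto
    then show "\<exists>m. 0 < (\<integral>x. h m x \<partial>iid_n (Suc m) Q)" using h[of j] k Q \<Q> by blast
  qed (use h in auto)
  then show ?thesis by (rule that)
qed

section \<open>Separation of closed mixtures\<close>

text \<open>Near-minimal vectors of a convex set play the role of its minimal-norm vector, which need not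
  exist because the set is not assumed to be closed.\<close>

lemma convex_separation_from_zero:
  fixes V :: "('i \<Rightarrow> real) set"
  assumes F: "finite F" and V: "V \<noteq> {}"
    and convex: "\<And>v w t. v \<in> V \<Longrightarrow> w \<in> V \<Longrightarrow> 0 \<le> t \<Longrightarrow> t \<le> 1 \<Longrightarrow>
      \<exists>u\<in>V. \<forall>i\<in>F. u i = v i + t * (w i - v i)"
    and far: "0 < \<delta>" "\<And>v. v \<in> V \<Longrightarrow> \<delta> \<le> (\<Sum>i\<in>F. (v i)\<^sup>2)"
    and bounded: "\<And>v i. v \<in> V \<Longrightarrow> i \<in> F \<Longrightarrow> \<bar>v i\<bar> \<le> b"
  obtains v \<kappa> where "v \<in> V" "0 < \<kappa>" "\<And>w. w \<in> V \<Longrightarrow> \<kappa> \<le> (\<Sum>i\<in>F. v i * w i)"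
proof -
  define \<Phi> where "\<Phi> v = (\<Sum>i\<in>F. (v i)\<^sup>2)" for v :: "'i \<Rightarrow> real"
  define s where "s = (INF v\<in>V. \<Phi> v)"
  have bdd: "bdd_below (\<Phi> ` V)" using far(2) by (intro bdd_belowI[of _ \<delta>]) (auto simp: \<Phi>_def)
  have "\<delta> \<le> s" unfolding s_def using V far(2) by (intro cINF_greatest) (auto simp: \<Phi>_def)
  then have s: "0 < s" using far(1) by simp
  have s_le: "s \<le> \<Phi> v" if "v \<in> V" for v unfolding s_def using bdd that by (rule cINF_lower)
  \<comment> \<open>\<open>R\<close> dominates the squared distance of any two points of
    \<open>V\<close>, and the added 1 keeps it positive. The step \<open>t\<close> and the tolerance
    \<open>t * s / 2\<close> for \<open>v\<close> are tuned so that each of the two error terms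
    below, divided by \<open>t\<close>, is at most \<open>s / 2\<close>.\<close>
  define R where "R = 1 + (\<Sum>i\<in>F. (2 * b)\<^sup>2)"
  have R: "1 \<le> R" unfolding R_def by (simp add: sum_nonneg)
  define t where "t = min 1 (s / (2 * R))"
  have t: "0 < t" "t \<le> 1" "t * R \<le> s / 2"
  proof -
    show "0 < t" "t \<le> 1" using s R by (auto simp: t_def)
    have "t * R \<le> s / (2 * R) * R" using R by (intro mult_right_mono) (auto simp: t_def)
    then show "t * R \<le> s / 2" using R by simp
  qed
  have "\<exists>v\<in>V. \<Phi> v < s + t * s / 2"
  proof -
    have "s < s + t * s / 2" using s t by simp
    then show ?thesis using cINF_less_iff[OF V bdd, of "s + t * s / 2"] unfolding s_def by blast
  qed
  then obtain v where v: "v \<in> V" "\<Phi> v < s + t * s / 2" by auto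
  have "s / 2 \<le> (\<Sum>i\<in>F. v i * w i)" if w: "w \<in> V" for w
  proof -
    obtain u where u: "u \<in> V" "\<And>i. i \<in> F \<Longrightarrow> u i = v i + t * (w i - v i)"
      using convex[OF v(1) w, of t] t by auto
    define X where "X = (\<Sum>i\<in>F. v i * w i)"
    define Y where "Y = (\<Sum>i\<in>F. (w i - v i)\<^sup>2)"
    \<comment> \<open>First-order condition at the near-minimizer: moving from \<open>v\<close>
      towards \<open>w\<close> cannot bring \<Phi> below its infimum \<open>s\<close>, which forces
      \<open>X \<ge> \<Phi> v - s / 2 \<ge> s / 2\<close>.\<close>
    have "\<Phi> u = (\<Sum>i\<in>F. (v i)\<^sup>2 + 2 * t * (v i * w i) - 2 * t * (v i)\<^sup>2 + t\<^sup>2 * (w i - v i)\<^sup>2)"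
      unfolding \<Phi>_def
      by (intro sum.cong refl) (simp add: u(2) power2_eq_square algebra_simps)
    also have "\<dots> = \<Phi> v + 2 * t * X - 2 * t * \<Phi> v + t\<^sup>2 * Y"
      by (simp add: \<Phi>_def X_def Y_def sum.distrib sum_subtractf sum_distrib_left)
    finally have e: "\<Phi> u = \<Phi> v + 2 * t * X - 2 * t * \<Phi> v + t\<^sup>2 * Y" .
    have "Y \<le> (\<Sum>i\<in>F. (2 * b)\<^sup>2)" unfolding Y_def
    proof (intro sum_mono)
      fix i assume i: "i \<in> F"
      have "\<bar>w i - v i\<bar> \<le> 2 * b" using bounded[OF v(1) i] bounded[OF w i] by linarith
      then show "(w i - v i)\<^sup>2 \<le> (2 * b)\<^sup>2"
        by (metis abs_ge_zero power2_abs power_mono)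
    qed
    then have "Y \<le> R" by (simp add: R_def)
    then have "t\<^sup>2 * Y \<le> t\<^sup>2 * R" by (intro mult_left_mono) auto
    also have "\<dots> = t * (t * R)" by (simp add: power2_eq_square)
    also have "\<dots> \<le> t * (s / 2)" using t by (intro mult_left_mono) auto
    finally have "t\<^sup>2 * Y \<le> t * (s / 2)" .
    moreover have "s \<le> \<Phi> u" by (rule s_le[OF u(1)])
    ultimately have "0 \<le> 2 * t * X - 2 * t * \<Phi> v + t * s"
      using e v(2) by (simp add: algebra_simps)
    then have "0 \<le> t * (2 * X - 2 * \<Phi> v + s)" by (simp add: algebra_simps)
    then have "0 \<le> 2 * X - 2 * \<Phi> v + s" using t(1) by (simp add: zero_le_mult_iff)
    then show ?thesis using s_le[OF v(1)] by (simp add: X_def)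
  qed
  moreover have "0 < s / 2" using s by simp
  ultimately show ?thesis using v(1) that by blast
qed

section \<open>Weak-* compactness and convex hulls\<close>

context
  fixes N :: "'b measure"
  assumes N: "space N \<noteq> {}"
begin

lemma bdd_meas_zero: "(\<lambda>_. 0) \<in> bdd_meas N"
  by (auto simp: bdd_meas_def intro!: boundedI[of _ 0])

lemma bdd_meas_add: "f \<in> bdd_meas N \<Longrightarrow> g \<in> bdd_meas N \<Longrightarrow> (\<lambda>x. f x + g x) \<in> bdd_meas N"
  unfolding bdd_meas_def by (auto intro!: bounded_plus_comp)

lemma bdd_meas_cmult: "f \<in> bdd_meas N \<Longrightarrow> (\<lambda>x. c * f x) \<in> bdd_meas N"
proof -
  assume f: "f \<in> bdd_meas N"
  then have "bounded ((\<lambda>y. c * y) ` f ` space N)"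
    by (intro bounded_linear_image bounded_linear_mult_right) (simp add: bdd_meas_def)
  then show ?thesis
    using f borel_measurable_times[OF borel_measurable_const, of f N c] by (simp add: bdd_meas_def image_image)
qed

lemma supremum_norm_ge:
  assumes "f \<in> bdd_meas N" "x \<in> space N"
  shows "\<bar>f x\<bar> \<le> supremum_norm N f"
proof -
  have "bounded (f ` space N)" using assms(1) by (simp add: bdd_meas_def)
  then obtain B where "\<And>y. y \<in> f ` space N \<Longrightarrow> \<bar>y\<bar> \<le> B" by (auto simp: bounded_iff)
  then have "bdd_above ((\<lambda>x. \<bar>f x\<bar>) ` space N)" by (intro bdd_aboveI[of _ B]) auto
  then show ?thesis unfolding supremum_norm_def using assms(2) by (intro cSUP_upper)
qed

lemma bdd_meas_sum:
  "finite I \<Longrightarrow> (\<And>i. i \<in> I \<Longrightarrow> f i \<in> bdd_meas N) \<Longrightarrow> (\<lambda>x. \<Sum>i\<in>I. c i * f i x) \<in> bdd_meas N"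
proof (induction I rule: finite_induct)
  case (insert i I)
  then have "(\<lambda>x. c i * f i x + (\<Sum>i\<in>I. c i * f i x)) \<in> bdd_meas N"
    by (intro bdd_meas_add bdd_meas_cmult) auto
  then show ?case using insert.hyps by simp
qed (simp add: bdd_meas_zero)

text \<open>The closed unit ball of the dual. The fixed norm bound, in place of the existential one
  in \<open>ba\<close>, is what makes it compact; expectations under probability laws belong to
  it.\<close>

definition ba_ball :: "(('b \<Rightarrow> real) \<Rightarrow> real) set" where
  "ba_ball = {\<phi> \<in> extensional (bdd_meas N).
     (\<forall>f\<in>bdd_meas N. \<forall>g\<in>bdd_meas N. \<phi> (\<lambda>x. f x + g x) = \<phi> f + \<phi> g) \<and>
     (\<forall>c. \<forall>f\<in>bdd_meas N. \<phi> (\<lambda>x. c * f x) = c * \<phi> f) \<and>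
     (\<forall>f\<in>bdd_meas N. \<bar>\<phi> f\<bar> \<le> supremum_norm N f)}"

lemma ba_ballD:
  assumes "\<phi> \<in> ba_ball" "f \<in> bdd_meas N"
  shows "g \<in> bdd_meas N \<Longrightarrow> \<phi> (\<lambda>x. f x + g x) = \<phi> f + \<phi> g"
    and "\<phi> (\<lambda>x. c * f x) = c * \<phi> f" and "\<bar>\<phi> f\<bar> \<le> supremum_norm N f"
  using assms by (auto simp: ba_ball_def)

lemma ba_ball_subset_ba: "ba_ball \<subseteq> ba N"
  unfolding ba_ball_def ba_def by (auto intro!: exI[of _ 1])

lemma topspace_weak_star: "topspace (weak_star N) = ba N"
  by (auto simp: weak_star_def ba_def PiE_def)

lemma continuous_map_evaluation:
  assumes "f \<in> bdd_meas N"
  shows "continuous_map (weak_star N) euclideanreal (\<lambda>\<phi>. \<phi> f)"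
    and "continuous_map (product_topology (\<lambda>_. euclideanreal) (bdd_meas N)) euclideanreal (\<lambda>\<phi>. \<phi> f)"
  unfolding weak_star_def
  using continuous_map_product_projection[OF assms, of "\<lambda>_. euclideanreal"]
  by (auto intro: continuous_map_from_subtopology)

text \<open>Banach-Alaoglu: linearity and the norm bound are closed conditions on evaluations, and
  they cut the ball out of a product of compact intervals, which is compact by Tychonoff.\<close>

lemma compactin_ba_ball: "compactin (weak_star N) ba_ball"
proof -
  let ?B = "bdd_meas N"
  let ?X = "product_topology (\<lambda>_. euclideanreal) ?B"
  note ev = continuous_map_evaluation(2)
  define S1 where "S1 = (\<lambda>(f, g). {\<phi>\<in>topspace ?X. \<phi> (\<lambda>x. f x + g x) - (\<phi> f + \<phi> g) \<in> {0}})"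
  define S2 where "S2 = (\<lambda>(c, f). {\<phi>\<in>topspace ?X. \<phi> (\<lambda>x. c * f x) - c * \<phi> f \<in> {0}})"
  define S3 where "S3 = (\<lambda>f. {\<phi>\<in>topspace ?X. \<bar>\<phi> f\<bar> \<in> {..supremum_norm N f}})"
  have ne: "?B \<noteq> {}" using bdd_meas_zero by auto
  have 1: "closedin ?X (\<Inter>p\<in>?B \<times> ?B. S1 p)"
  proof (rule closedin_INT)
    fix p assume "p \<in> ?B \<times> ?B"
    then obtain f g where p: "p = (f, g)" "f \<in> ?B" "g \<in> ?B" by auto
    show "closedin ?X (S1 p)"
      unfolding S1_def p(1) split
      by (rule closedin_continuous_map_preimage[OF continuous_map_diff[OF ev[OF bdd_meas_add[OF p(2,3)]]
            continuous_map_add[OF ev[OF p(2)] ev[OF p(3)]]]]) simp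
  qed (use ne in simp)
  have 2: "closedin ?X (\<Inter>p\<in>(UNIV :: real set) \<times> ?B. S2 p)"
  proof (rule closedin_INT)
    fix p assume "p \<in> (UNIV :: real set) \<times> ?B"
    then obtain c f where p: "p = (c, f)" "f \<in> ?B" by auto
    show "closedin ?X (S2 p)"
      unfolding S2_def p(1) split
      by (rule closedin_continuous_map_preimage[OF continuous_map_diff[OF ev[OF bdd_meas_cmult[OF p(2)]]
            continuous_map_real_mult_left[OF ev[OF p(2)]]]]) simp
  qed (use ne in simp)
  have 3: "closedin ?X (\<Inter>f\<in>?B. S3 f)"
  proof (rule closedin_INT)
    fix f assume "f \<in> ?B"
    then show "closedin ?X (S3 f)"
      unfolding S3_def
      by (intro closedin_continuous_map_preimage[OF continuous_map_real_abs[OF ev]]) simp_all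
  qed (use ne in simp)
  have eq: "ba_ball = (\<Inter>p\<in>?B \<times> ?B. S1 p) \<inter> (\<Inter>p\<in>(UNIV :: real set) \<times> ?B. S2 p) \<inter> (\<Inter>f\<in>?B. S3 f)"
    using ne unfolding ba_ball_def S1_def S2_def S3_def by (auto simp: PiE_def)
  have closed: "closedin ?X ba_ball" unfolding eq by (intro closedin_Int 1 2 3)
  have "compactin ?X (PiE ?B (\<lambda>f. {- supremum_norm N f..supremum_norm N f}))"
    by (subst compactin_PiE) auto
  moreover have "ba_ball \<subseteq> PiE ?B (\<lambda>f. {- supremum_norm N f..supremum_norm N f})"
    unfolding ba_ball_def by (auto simp: PiE_def abs_le_iff)
  ultimately have "compactin ?X ba_ball" using closed by (meson closed_compactin)
  then show ?thesis
    unfolding weak_star_def compactin_subtopology using ba_ball_subset_ba by auto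
qed

lemma functional_convex_hull_subset_ba_ball:
  assumes "\<Phi> \<subseteq> ba_ball"
  shows "functional_convex_hull N \<Phi> \<subseteq> ba_ball"
proof
  fix \<phi> assume "\<phi> \<in> functional_convex_hull N \<Phi>"
  then obtain S c where \<phi>: "\<phi> = (\<lambda>f\<in>bdd_meas N. \<Sum>\<psi>\<in>S. c \<psi> * \<psi> f)"
    and S: "finite S" "S \<subseteq> \<Phi>" "\<And>\<psi>. \<psi> \<in> S \<Longrightarrow> 0 \<le> c \<psi>" "sum c S = 1"
    unfolding functional_convex_hull_def by auto
  have S': "\<psi> \<in> ba_ball" if "\<psi> \<in> S" for \<psi> using that S assms by auto
  have "\<bar>\<Sum>\<psi>\<in>S. c \<psi> * \<psi> f\<bar> \<le> supremum_norm N f" if f: "f \<in> bdd_meas N" for f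
  proof -
    have "\<bar>\<Sum>\<psi>\<in>S. c \<psi> * \<psi> f\<bar> \<le> (\<Sum>\<psi>\<in>S. c \<psi> * supremum_norm N f)"
    proof (intro order_trans[OF sum_abs] sum_mono)
      fix \<psi> assume "\<psi> \<in> S"
      then show "\<bar>c \<psi> * \<psi> f\<bar> \<le> c \<psi> * supremum_norm N f"
        using S(3) ba_ballD(3)[OF S' f] by (simp add: abs_mult mult_left_mono)
    qed
    also have "\<dots> = supremum_norm N f" by (simp add: S(4) flip: sum_distrib_right)
    finally show ?thesis .
  qed
  moreover have "(\<Sum>\<psi>\<in>S. c \<psi> * \<psi> (\<lambda>x. f x + g x)) = (\<Sum>\<psi>\<in>S. c \<psi> * \<psi> f) + (\<Sum>\<psi>\<in>S. c \<psi> * \<psi> g)"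
    if "f \<in> bdd_meas N" "g \<in> bdd_meas N" for f g
  proof -
    have "(\<Sum>\<psi>\<in>S. c \<psi> * \<psi> (\<lambda>x. f x + g x)) = (\<Sum>\<psi>\<in>S. c \<psi> * \<psi> f + c \<psi> * \<psi> g)"
    proof (intro sum.cong refl)
      fix \<psi> assume "\<psi> \<in> S"
      then have "\<psi> (\<lambda>x. f x + g x) = \<psi> f + \<psi> g" by (intro ba_ballD(1) S' that)
      then show "c \<psi> * \<psi> (\<lambda>x. f x + g x) = c \<psi> * \<psi> f + c \<psi> * \<psi> g" by (simp add: distrib_left)
    qed
    then show ?thesis by (simp add: sum.distrib)
  qed
  moreover have "(\<Sum>\<psi>\<in>S. c \<psi> * \<psi> (\<lambda>x. a * f x)) = a * (\<Sum>\<psi>\<in>S. c \<psi> * \<psi> f)"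
    if "f \<in> bdd_meas N" for f a
  proof -
    have "(\<Sum>\<psi>\<in>S. c \<psi> * \<psi> (\<lambda>x. a * f x)) = (\<Sum>\<psi>\<in>S. a * (c \<psi> * \<psi> f))"
    proof (intro sum.cong refl)
      fix \<psi> assume "\<psi> \<in> S"
      then have "\<psi> (\<lambda>x. a * f x) = a * \<psi> f" by (intro ba_ballD(2) S' that)
      then show "c \<psi> * \<psi> (\<lambda>x. a * f x) = a * (c \<psi> * \<psi> f)" by simp
    qed
    then show ?thesis by (simp add: sum_distrib_left)
  qed
  ultimately show "\<phi> \<in> ba_ball"
    unfolding \<phi> ba_ball_def by (auto simp: bdd_meas_add bdd_meas_cmult)
qed

lemma functional_convex_hull_convex:
  assumes "\<phi> \<in> functional_convex_hull N \<Phi>" "\<psi> \<in> functional_convex_hull N \<Phi>" and t: "0 \<le> t" "t \<le> 1"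
  shows "\<exists>\<xi>\<in>functional_convex_hull N \<Phi>. \<forall>f\<in>bdd_meas N. \<xi> f = \<phi> f + t * (\<psi> f - \<phi> f)"
proof -
  obtain S c where \<phi>: "\<phi> = (\<lambda>f\<in>bdd_meas N. \<Sum>\<psi>\<in>S. c \<psi> * \<psi> f)"
    and S: "finite S" "S \<subseteq> \<Phi>" "\<And>\<psi>. \<psi> \<in> S \<Longrightarrow> 0 \<le> c \<psi>" "sum c S = 1"
    using assms(1) unfolding functional_convex_hull_def by auto
  obtain S' c' where \<psi>: "\<psi> = (\<lambda>f\<in>bdd_meas N. \<Sum>\<psi>\<in>S'. c' \<psi> * \<psi> f)"
    and S': "finite S'" "S' \<subseteq> \<Phi>" "\<And>\<psi>. \<psi> \<in> S' \<Longrightarrow> 0 \<le> c' \<psi>" "sum c' S' = 1"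
    using assms(2) unfolding functional_convex_hull_def by auto
  \<comment> \<open>The supports may overlap, so the weights are extended by zero and added on
    \<open>S \<union> S'\<close>.\<close>
  define d where "d x = (1 - t) * (if x \<in> S then c x else 0) + t * (if x \<in> S' then c' x else 0)" for x
  have sum_d: "(\<Sum>x\<in>S \<union> S'. d x * g x) = (1 - t) * (\<Sum>x\<in>S. c x * g x) + t * (\<Sum>x\<in>S'. c' x * g x)" for g
  proof -
    have 1: "(\<Sum>x\<in>S. c x * g x) = (\<Sum>x\<in>S \<union> S'. (if x \<in> S then c x else 0) * g x)"
      using S(1) S'(1) by (intro sum.mono_neutral_cong_left) auto
    have 2: "(\<Sum>x\<in>S'. c' x * g x) = (\<Sum>x\<in>S \<union> S'. (if x \<in> S' then c' x else 0) * g x)"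
      using S(1) S'(1) by (intro sum.mono_neutral_cong_left) auto
    show ?thesis unfolding 1 2 sum_distrib_left sum.distrib[symmetric]
      by (intro sum.cong refl) (simp add: d_def algebra_simps)
  qed
  have "sum d (S \<union> S') = 1" using sum_d[of "\<lambda>_. 1"] S(4) S'(4) by simp
  moreover have "0 \<le> d x" for x unfolding d_def using S(3) S'(3) t by auto
  ultimately have "(\<lambda>f\<in>bdd_meas N. \<Sum>x\<in>S \<union> S'. d x * x f) \<in> functional_convex_hull N \<Phi>"
    unfolding functional_convex_hull_def using S S' by blast
  moreover have "(\<Sum>x\<in>S \<union> S'. d x * x f) = \<phi> f + t * (\<psi> f - \<phi> f)" if "f \<in> bdd_meas N" for f
    unfolding sum_d \<phi> \<psi> using that by (simp add: algebra_simps)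
  ultimately show ?thesis by (intro bexI) auto
qed

lemma functional_convex_hull_superset:
  assumes "\<phi> \<in> \<Phi>" "\<Phi> \<subseteq> ba_ball"
  shows "\<phi> \<in> functional_convex_hull N \<Phi>"
proof -
  have "\<phi> = (\<lambda>f\<in>bdd_meas N. \<Sum>\<psi>\<in>{\<phi>}. 1 * \<psi> f)"
    using assms by (auto simp: ba_ball_def extensional_def fun_eq_iff)
  then show ?thesis unfolding functional_convex_hull_def using assms(1)
    by (auto intro!: exI[of _ "{\<phi>}"] exI[of _ "\<lambda>_. 1"])
qed

text \<open>The distance supplies for each pair of mixtures some function that separates this pair;
  wanted is one function for all pairs. Compactness of the product of the closures leaves finitely
  many functions \<open>Fs\<close>, so that differences of mixtures become vectors in a
  finite-dimensional convex set away from 0. The coordinates of a near-minimal vector are the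
  coefficients of \<open>g\<close>.\<close>

lemma separating_function:
  assumes \<Phi>: "\<Phi> \<subseteq> ba_ball" "\<Phi> \<noteq> {}" and \<Psi>: "\<Psi> \<subseteq> ba_ball" "\<Psi> \<noteq> {}"
    and pos: "0 < tv_set_dist N (weak_star N closure_of functional_convex_hull N \<Phi>)
      (weak_star N closure_of functional_convex_hull N \<Psi>)"
  obtains g \<kappa> where "g \<in> bdd_meas N" "0 < \<kappa>" "\<And>\<phi> \<psi>. \<phi> \<in> \<Phi> \<Longrightarrow> \<psi> \<in> \<Psi> \<Longrightarrow> \<phi> g + \<kappa> \<le> \<psi> g"
proof -
  let ?W = "weak_star N"
  define H1 where "H1 = functional_convex_hull N \<Phi>"
  define H2 where "H2 = functional_convex_hull N \<Psi>"
  let ?C1 = "?W closure_of H1" and ?C2 = "?W closure_of H2"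
  have H: "H1 \<subseteq> ba_ball" "H2 \<subseteq> ba_ball"
    unfolding H1_def H2_def using \<Phi> \<Psi> by (auto dest: functional_convex_hull_subset_ba_ball)
  have Hmem: "\<Phi> \<subseteq> H1" "\<Psi> \<subseteq> H2"
    unfolding H1_def H2_def using \<Phi> \<Psi> functional_convex_hull_superset by auto
  have "Hausdorff_space ?W"
    unfolding weak_star_def by (intro Hausdorff_space_subtopology) (simp add: Hausdorff_space_product_topology)
  then have cl: "closedin ?W ba_ball" using compactin_ba_ball by (rule compactin_imp_closedin)
  have comp: "compactin ?W (?W closure_of A)" if "A \<subseteq> ba_ball" for A
    using closed_compactin[OF compactin_ba_ball closure_of_minimal[OF that cl]] by simp
  obtain \<delta> where \<delta>: "0 < \<delta>" "ereal \<delta> < tv_set_dist N ?C1 ?C2"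
    using ereal_dense2[OF pos] unfolding H1_def H2_def by (metis ereal_less(2) zero_ereal_def)
  define B1 where "B1 = {f \<in> bdd_meas N. \<forall>x\<in>space N. 0 \<le> f x \<and> f x \<le> 1}"
  define O1 where "O1 f = {p \<in> topspace (prod_topology ?W ?W). fst p f - snd p f \<in> {\<delta><..}}" for f
  have open_O1: "openin (prod_topology ?W ?W) (O1 f)" if "f \<in> bdd_meas N" for f
    unfolding O1_def
    by (intro openin_continuous_map_preimage[of _ euclideanreal] continuous_map_diff
        continuous_map_compose[OF continuous_map_fst continuous_map_evaluation(1)[OF that], unfolded comp_def]
        continuous_map_compose[OF continuous_map_snd continuous_map_evaluation(1)[OF that], unfolded comp_def])
      auto
  have cover: "?C1 \<times> ?C2 \<subseteq> \<Union> (O1 ` B1)"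
  proof
    fix p assume p: "p \<in> ?C1 \<times> ?C2"
    then obtain \<mu> \<nu> where p': "p = (\<mu>, \<nu>)" "\<mu> \<in> ?C1" "\<nu> \<in> ?C2" by auto
    have "ereal \<delta> < tv_dist N \<mu> \<nu>"
      using \<delta>(2) p' unfolding tv_set_dist_def by (meson INF_lower less_le_trans)
    then obtain f where f: "f \<in> B1" "\<delta> < \<mu> f - \<nu> f"
      unfolding tv_dist_def less_SUP_iff B1_def by auto
    have "\<mu> \<in> topspace ?W" "\<nu> \<in> topspace ?W" using p' by (meson closure_of_subset_topspace subsetD)+
    then show "p \<in> \<Union> (O1 ` B1)" using f by (auto simp: O1_def p' topspace_prod_topology)
  qed
  have cp: "compactin (prod_topology ?W ?W) (?C1 \<times> ?C2)"
    using comp[OF H(1)] comp[OF H(2)] by (simp add: compactin_Times)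
  have op: "openin (prod_topology ?W ?W) X" if "X \<in> O1 ` B1" for X
    using that open_O1 by (auto simp: B1_def)
  have "\<exists>\<F>. finite \<F> \<and> \<F> \<subseteq> O1 ` B1 \<and> ?C1 \<times> ?C2 \<subseteq> \<Union> \<F>"
    by (rule compactinD[OF cp _ cover]) (rule op)
  then obtain \<F> where \<F>: "finite \<F>" "\<F> \<subseteq> O1 ` B1" "?C1 \<times> ?C2 \<subseteq> \<Union> \<F>"
    by (elim exE conjE)
  obtain Fs where Fs: "finite Fs" "Fs \<subseteq> B1" "\<F> = O1 ` Fs"
    using finite_subset_image[OF \<F>(1,2)] by auto
  have Fs_B: "f \<in> bdd_meas N" if "f \<in> Fs" for f using that Fs by (auto simp: B1_def)
  have Htop: "H1 \<subseteq> topspace ?W" "H2 \<subseteq> topspace ?W"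
    using H ba_ball_subset_ba by (auto simp: topspace_weak_star)
  \<comment> \<open>The closures served only for compactness; the rest of the argument takes place
    in the hulls.\<close>
  have sep: "\<exists>f\<in>Fs. \<delta> < \<mu> f - \<nu> f" if "\<mu> \<in> H1" "\<nu> \<in> H2" for \<mu> \<nu>
  proof -
    have "(\<mu>, \<nu>) \<in> ?C1 \<times> ?C2"
      using that closure_of_subset[OF Htop(1)] closure_of_subset[OF Htop(2)] by auto
    then obtain f where "f \<in> Fs" "(\<mu>, \<nu>) \<in> O1 f" using \<F>(3) Fs(3) by auto
    then show ?thesis by (auto simp: O1_def)
  qed
  \<comment> \<open>The sign is reversed against the cover so that \<open>g\<close> comes out larger
    on \<Psi>; the squared lengths are the same.\<close>
  define V where "V = {\<lambda>f. \<nu> f - \<mu> f | \<mu> \<nu>. \<mu> \<in> H1 \<and> \<nu> \<in> H2}"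
  obtain v \<kappa> where v: "v \<in> V" "0 < \<kappa>" "\<And>w. w \<in> V \<Longrightarrow> \<kappa> \<le> (\<Sum>f\<in>Fs. v f * w f)"
  proof (rule convex_separation_from_zero[of Fs V "\<delta>\<^sup>2" "\<Sum>f\<in>Fs. 2 * supremum_norm N f"])
    show "finite Fs" by fact
    show "V \<noteq> {}" unfolding V_def using Hmem \<Phi> \<Psi> by blast
    show "0 < \<delta>\<^sup>2" using \<delta> by simp
  next
    fix v assume "v \<in> V"
    then obtain \<mu> \<nu> where v: "v = (\<lambda>f. \<nu> f - \<mu> f)" "\<mu> \<in> H1" "\<nu> \<in> H2" by (auto simp: V_def)
    obtain f where f: "f \<in> Fs" "\<delta> < \<mu> f - \<nu> f" using sep v by blast
    have "\<delta>\<^sup>2 \<le> (\<mu> f - \<nu> f)\<^sup>2" using f \<delta> by (intro power_mono) auto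
    also have "\<dots> = (v f)\<^sup>2" by (simp add: v(1) power2_commute)
    also have "\<dots> \<le> (\<Sum>f\<in>Fs. (v f)\<^sup>2)" using f Fs(1) by (intro member_le_sum) auto
    finally show "\<delta>\<^sup>2 \<le> (\<Sum>f\<in>Fs. (v f)\<^sup>2)" .
  next
    fix v f assume "v \<in> V" and f: "f \<in> Fs"
    then obtain \<mu> \<nu> where v: "v = (\<lambda>f. \<nu> f - \<mu> f)" "\<mu> \<in> ba_ball" "\<nu> \<in> ba_ball" using H by (auto simp: V_def)
    have "\<bar>\<mu> f\<bar> \<le> supremum_norm N f" "\<bar>\<nu> f\<bar> \<le> supremum_norm N f"
      using v(2,3) Fs_B[OF f] by (auto intro: ba_ballD)
    then have "\<bar>v f\<bar> \<le> 2 * supremum_norm N f" unfolding v(1) by linarith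
    also have "\<dots> \<le> (\<Sum>f\<in>Fs. 2 * supremum_norm N f)"
    proof (rule member_le_sum[OF f _ Fs(1)])
      fix g assume "g \<in> Fs - {f}"
      then have "g \<in> bdd_meas N" using Fs_B by auto
      moreover obtain x where "x \<in> space N" using N by auto
      ultimately show "0 \<le> 2 * supremum_norm N g"
        using supremum_norm_ge[of g x] by linarith
    qed
    finally show "\<bar>v f\<bar> \<le> (\<Sum>f\<in>Fs. 2 * supremum_norm N f)" .
  next
    fix v w t assume "v \<in> V" "w \<in> V" and t: "0 \<le> t" "t \<le> (1::real)"
    then obtain \<mu> \<nu> \<mu>' \<nu>' where v: "v = (\<lambda>f. \<nu> f - \<mu> f)" "\<mu> \<in> H1" "\<nu> \<in> H2"
      and w: "w = (\<lambda>f. \<nu>' f - \<mu>' f)" "\<mu>' \<in> H1" "\<nu>' \<in> H2" by (auto simp: V_def)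
    obtain \<mu>'' where 1: "\<mu>'' \<in> H1" "\<forall>f\<in>bdd_meas N. \<mu>'' f = \<mu> f + t * (\<mu>' f - \<mu> f)"
      using functional_convex_hull_convex[OF v(2)[unfolded H1_def] w(2)[unfolded H1_def] t]
      unfolding H1_def by blast
    obtain \<nu>'' where 2: "\<nu>'' \<in> H2" "\<forall>f\<in>bdd_meas N. \<nu>'' f = \<nu> f + t * (\<nu>' f - \<nu> f)"
      using functional_convex_hull_convex[OF v(3)[unfolded H2_def] w(3)[unfolded H2_def] t]
      unfolding H2_def by blast
    show "\<exists>u\<in>V. \<forall>f\<in>Fs. u f = v f + t * (w f - v f)"
      using 1 2 Fs_B unfolding V_def v(1) w(1)
      by (intro bexI[of _ "\<lambda>f. \<nu>'' f - \<mu>'' f"]) (auto simp: algebra_simps)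
  qed (blast intro: that)
  define g where "g x = (\<Sum>f\<in>Fs. v f * f x)" for x
  have lin: "\<phi> (\<lambda>x. \<Sum>f\<in>A. v f * f x) = (\<Sum>f\<in>A. v f * \<phi> f)"
    if \<phi>: "\<phi> \<in> ba_ball" and A: "A \<subseteq> Fs" for \<phi> A
    using finite_subset[OF A Fs(1)] A
  proof (induction A rule: finite_induct)
    case empty
    have "\<phi> (\<lambda>x. 0 * (0::real)) = 0 * \<phi> (\<lambda>x. 0)" by (rule ba_ballD(2)[OF \<phi> bdd_meas_zero])
    then show ?case by simp
  next
    case (insert f A)
    have "(\<lambda>x. v f * f x) \<in> bdd_meas N" using insert Fs_B by (intro bdd_meas_cmult) auto
    moreover have "(\<lambda>x. \<Sum>f\<in>A. v f * f x) \<in> bdd_meas N"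
      using insert Fs_B by (intro bdd_meas_sum) auto
    ultimately have "\<phi> (\<lambda>x. v f * f x + (\<Sum>f\<in>A. v f * f x)) = \<phi> (\<lambda>x. v f * f x) + \<phi> (\<lambda>x. \<Sum>f\<in>A. v f * f x)"
      by (intro ba_ballD(1)[OF \<phi>])
    also have "\<phi> (\<lambda>x. v f * f x) = v f * \<phi> f"
      using insert.prems Fs_B by (intro ba_ballD(2)[OF \<phi>]) auto
    finally show ?case using insert by simp
  qed
  show ?thesis
  proof (rule that[of g \<kappa>])
    show "g \<in> bdd_meas N" unfolding g_def using Fs Fs_B by (intro bdd_meas_sum) auto
    show "0 < \<kappa>" by (rule v)
    fix \<phi> \<psi> assume \<phi>: "\<phi> \<in> \<Phi>" and \<psi>: "\<psi> \<in> \<Psi>"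
    have "(\<lambda>f. \<psi> f - \<phi> f) \<in> V" unfolding V_def using \<phi> \<psi> Hmem by blast
    then have "\<kappa> \<le> (\<Sum>f\<in>Fs. v f * (\<psi> f - \<phi> f))" by (rule v)
    also have "\<dots> = \<psi> g - \<phi> g"
      unfolding g_def using lin[of \<phi> Fs] lin[of \<psi> Fs] \<phi> \<psi> \<Phi> \<Psi>
      by (auto simp: sum_subtractf algebra_simps subset_iff)
    finally show "\<phi> g + \<kappa> \<le> \<psi> g" by simp
  qed
qed

end

text \<open>A one-sided bound on \<open>\<phi> f\<close> confines the value to a closed half-line.
  This survives mixtures because the half-line is convex, and weak-* limits because evaluation at
  \<open>f\<close> is continuous.\<close>

lemma tv_set_dist_ge:
  assumes N: "space N \<noteq> {}" and \<Phi>: "\<Phi> \<subseteq> ba_ball N" and \<Psi>: "\<Psi> \<subseteq> ba_ball N"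
    and f: "f \<in> bdd_meas N" "\<And>x. x \<in> space N \<Longrightarrow> 0 \<le> f x \<and> f x \<le> 1"
    and b: "\<And>\<phi>. \<phi> \<in> \<Phi> \<Longrightarrow> b \<le> \<phi> f" and a: "\<And>\<psi>. \<psi> \<in> \<Psi> \<Longrightarrow> \<psi> f \<le> a"
  shows "ereal (b - a) \<le> tv_set_dist N (weak_star N closure_of functional_convex_hull N \<Phi>)
    (weak_star N closure_of functional_convex_hull N \<Psi>)"
proof -
  have closure: "\<mu> f \<in> I" if "\<Theta> \<subseteq> ba_ball N" and I: "closed I" "convex I" and \<Theta>: "\<And>\<phi>. \<phi> \<in> \<Theta> \<Longrightarrow> \<phi> f \<in> I"
    and \<mu>: "\<mu> \<in> weak_star N closure_of functional_convex_hull N \<Theta>" for \<Theta> \<mu> and I :: "real set"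
  proof -
    let ?S = "{\<phi> \<in> topspace (weak_star N). \<phi> f \<in> I}"
    have "functional_convex_hull N \<Theta> \<subseteq> ?S"
    proof
      fix \<phi> assume \<phi>: "\<phi> \<in> functional_convex_hull N \<Theta>"
      then have "\<phi> \<in> topspace (weak_star N)"
        using functional_convex_hull_subset_ba_ball[OF N that(1)] ba_ball_subset_ba[OF N]
        by (auto simp: topspace_weak_star[OF N])
      moreover from \<phi> obtain S c where "\<phi> = (\<lambda>f\<in>bdd_meas N. \<Sum>\<psi>\<in>S. c \<psi> * \<psi> f)"
        and S: "finite S" "S \<subseteq> \<Theta>" "\<And>\<psi>. \<psi> \<in> S \<Longrightarrow> 0 \<le> c \<psi>" "sum c S = 1"
        unfolding functional_convex_hull_def by auto
      then have eq: "\<phi> f = (\<Sum>\<psi>\<in>S. c \<psi> *\<^sub>R \<psi> f)" using f by simp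
      have "\<phi> f \<in> I" unfolding eq using S \<Theta> by (intro convex_sum I) auto
      ultimately show "\<phi> \<in> ?S" by auto
    qed
    moreover have "closedin (weak_star N) ?S"
      using I by (intro closedin_continuous_map_preimage[OF continuous_map_evaluation(1)[OF N f(1)]]) simp
    ultimately show ?thesis using \<mu> closure_of_minimal by blast
  qed
  show ?thesis
    unfolding tv_set_dist_def
  proof (intro INF_greatest)
    fix \<mu> \<nu> assume \<mu>: "\<mu> \<in> weak_star N closure_of functional_convex_hull N \<Phi>"
      and \<nu>: "\<nu> \<in> weak_star N closure_of functional_convex_hull N \<Psi>"
    have "\<mu> f \<in> {b..}" using b by (intro closure[OF \<Phi> _ _ _ \<mu>]) auto
    moreover have "\<nu> f \<in> {..a}" using a by (intro closure[OF \<Psi> _ _ _ \<nu>]) auto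
    ultimately have "ereal (b - a) \<le> ereal (\<mu> f - \<nu> f)" by simp
    also have "\<dots> \<le> tv_dist N \<mu> \<nu>"
      unfolding tv_dist_def using f by (intro SUP_upper) auto
    finally show "ereal (b - a) \<le> tv_dist N \<mu> \<nu>" .
  qed
qed

section \<open>Between testing functions and separated subfamilies\<close>

lemma integrable_bdd_meas:
  assumes R: "R \<in> space (prob_algebra M)" and f: "f \<in> bdd_meas (iid_n n M)"
  shows "integrable (iid_n n R) f"
proof -
  obtain C where "\<And>y. y \<in> f ` space (iid_n n M) \<Longrightarrow> \<bar>y\<bar> \<le> C"
    using f by (auto simp: bdd_meas_def bounded_iff)
  then show ?thesis
    using f by (intro integrable_iid_n_bounded[OF R, of f n C]) (auto simp: bdd_meas_def)
qed

lemma space_iid_n_nonempty: "space M \<noteq> {} \<Longrightarrow> space (iid_n n M) \<noteq> {}"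
  by (auto simp: iid_n_def)

lemma expectation_functional_in_ba_ball:
  assumes R: "R \<in> space (prob_algebra M)"
  shows "expectation_functional (iid_n n M) (iid_n n R) \<in> ba_ball (iid_n n M)"
proof -
  let ?N = "iid_n n M"
  interpret prob_space "iid_n n R" by (rule iid_n_law[OF R])
  have N: "space ?N \<noteq> {}" by (intro space_iid_n_nonempty space_nonempty_of_law[OF R])
  note int = integrable_bdd_meas[OF R]
  have "\<bar>\<integral>x. f x \<partial>iid_n n R\<bar> \<le> supremum_norm ?N f" if f: "f \<in> bdd_meas ?N" for f
  proof -
    have "\<bar>\<integral>x. f x \<partial>iid_n n R\<bar> \<le> (\<integral>x. \<bar>f x\<bar> \<partial>iid_n n R)" by (rule integral_abs_bound)
    also have "\<dots> \<le> (\<integral>x. supremum_norm ?N f \<partial>iid_n n R)"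
      using int[OF f] supremum_norm_ge[OF N f]
      by (intro integral_mono_AE integrable_abs AE_I2) (auto simp: iid_n_law(3)[OF R])
    finally show ?thesis by (simp add: prob_space)
  qed
  then show ?thesis
    unfolding ba_ball_def[OF N] expectation_functional_def
    by (auto simp: bdd_meas_add[OF N] bdd_meas_cmult[OF N] int)
qed

text \<open>Positive means alone give no uniform gap. Classifying alternatives by a testing function
  and a lower bound \<open>1 / Suc i\<close> for its mean leaves countably many classes, each with a
  gap of its own.\<close>

lemma separated_subfamilies_of_testing_family:
  assumes \<P>: "\<P> \<subseteq> space (prob_algebra M)" "\<P> \<noteq> {}" and \<Q>: "\<Q> \<subseteq> space (prob_algebra M)" "\<Q> \<noteq> {}"
    and test: "testing_family M \<P> \<Q> n h"
  obtains A :: "nat \<Rightarrow> 'a measure set" and n' :: "nat \<Rightarrow> nat"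
    where "\<forall>m. A m \<noteq> {} \<and> A m \<subseteq> \<Q> \<and> 1 \<le> n' m" "\<Q> = (\<Union>m. A m)"
      "\<forall>m. 0 < tv_set_dist (iid_n (n' m) M) (closed_mixtures M (n' m) \<P>) (closed_mixtures M (n' m) (A m))"
proof -
  have ne: "space M \<noteq> {}" using \<P> space_nonempty_of_law by blast
  define A0 where "A0 m i = {Q\<in>\<Q>. 1 / real (Suc i) < (\<integral>x. h m x \<partial>iid_n (n m) Q)}" for m i
  have A0: "\<exists>m i. Q \<in> A0 m i" if Q: "Q \<in> \<Q>" for Q
  proof -
    obtain m where "0 < (\<integral>x. h m x \<partial>iid_n (n m) Q)" using test Q unfolding testing_family_def by blast
    then obtain i where "inverse (real (Suc i)) < (\<integral>x. h m x \<partial>iid_n (n m) Q)"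
      using reals_Archimedean by blast
    then have "Q \<in> A0 m i" using Q by (simp add: A0_def inverse_eq_divide)
    then show ?thesis by blast
  qed
  have dist: "0 < tv_set_dist (iid_n (n m) M) (closed_mixtures M (n m) \<P>) (closed_mixtures M (n m) (A0 m i))" for m i
  proof -
    let ?N = "iid_n (n m) M"
    let ?E = "\<lambda>R. expectation_functional ?N (iid_n (n m) R)"
    have N: "space ?N \<noteq> {}" by (rule space_iid_n_nonempty[OF ne])
    have hm: "h m \<in> borel_measurable ?N" and hP: "P \<in> \<P> \<Longrightarrow> (\<integral>x. h m x \<partial>iid_n (n m) P) \<le> 0" for P
      using test by (auto simp: testing_family_def)
    obtain C0 where C0: "\<And>x. x \<in> space ?N \<Longrightarrow> \<bar>h m x\<bar> \<le> C0"
      using test unfolding testing_family_def by meson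
    define C where "C = max 1 C0"
    have C: "0 < C" and hC: "\<And>x. x \<in> space ?N \<Longrightarrow> \<bar>h m x\<bar> \<le> C"
      using C0 by (auto simp: C_def le_max_iff_disj)
    \<comment> \<open>Rescaled into \<open>[0, 1]\<close> and reversed: \<open>tv_dist\<close>
      subtracts the value at its second argument, here the alternative, where \<open>h\<close> has
      the larger mean.\<close>
    define f where "f x = (if x \<in> space ?N then 1 / 2 - h m x / (2 * C) else 0)" for x
    have f01: "0 \<le> f x \<and> f x \<le> 1" if x: "x \<in> space ?N" for x
      using hC[OF x] C x by (simp add: f_def abs_le_iff field_simps)
    have f: "f \<in> bdd_meas ?N"
    proof -
      have "(\<lambda>x. 1 / 2 - h m x / (2 * C)) \<in> borel_measurable ?N" using hm by simp
      then have "f \<in> borel_measurable ?N" by (subst measurable_cong[of _ _ "\<lambda>x. 1 / 2 - h m x / (2 * C)"]) (auto simp: f_def)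
      moreover have "bounded (f ` space ?N)" using f01 by (intro boundedI[of _ 1]) auto
      ultimately show ?thesis by (auto simp: bdd_meas_def f_def)
    qed
    have E: "?E R f = 1 / 2 - (\<integral>x. h m x \<partial>iid_n (n m) R) / (2 * C)" if R: "R \<in> space (prob_algebra M)" for R
    proof -
      interpret prob_space "iid_n (n m) R" by (rule iid_n_law[OF R])
      have hi: "integrable (iid_n (n m) R) (h m)" by (rule integrable_iid_n_bounded[OF R hm hC])
      have "?E R f = (\<integral>x. 1 / 2 - h m x / (2 * C) \<partial>iid_n (n m) R)"
        unfolding expectation_functional_def using f
        by (auto intro!: Bochner_Integration.integral_cong simp: f_def iid_n_law(3)[OF R])
      also have "\<dots> = 1 / 2 - (\<integral>x. h m x \<partial>iid_n (n m) R) / (2 * C)"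
        using hi by (subst Bochner_Integration.integral_diff) (auto simp: prob_space)
      finally show ?thesis .
    qed
    define a where "a = 1 / 2 - 1 / real (Suc i) / (2 * C)"
    have "ereal (1 / 2 - a) \<le> tv_set_dist ?N (weak_star ?N closure_of functional_convex_hull ?N (?E ` \<P>))
        (weak_star ?N closure_of functional_convex_hull ?N (?E ` A0 m i))"
    proof (rule tv_set_dist_ge[OF N _ _ f f01])
      show "?E ` \<P> \<subseteq> ba_ball ?N" "?E ` A0 m i \<subseteq> ba_ball ?N"
        using \<P> \<Q> by (auto simp: A0_def intro!: expectation_functional_in_ba_ball)
      fix \<phi> assume "\<phi> \<in> ?E ` \<P>"
      then obtain P where "\<phi> = ?E P" "P \<in> \<P>" by auto
      then show "1 / 2 \<le> \<phi> f"
        using E[of P] hP[of P] C \<P> by (auto simp: divide_nonpos_pos)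
    next
      fix \<psi> assume "\<psi> \<in> ?E ` A0 m i"
      then obtain Q where Q: "\<psi> = ?E Q" "Q \<in> A0 m i" by auto
      then have "1 / real (Suc i) / (2 * C) \<le> (\<integral>x. h m x \<partial>iid_n (n m) Q) / (2 * C)"
        using C by (intro divide_right_mono) (auto simp: A0_def)
      moreover have "Q \<in> space (prob_algebra M)" using Q \<Q> by (auto simp: A0_def)
      ultimately show "\<psi> f \<le> a" using E[of Q] Q(1) by (simp add: a_def)
    qed
    moreover have "0 < 1 / 2 - a" using C by (simp add: a_def)
    ultimately show ?thesis
      unfolding closed_mixtures_def by (meson ereal_less(2) less_le_trans)
  qed
  obtain m0 i0 where mi: "A0 m0 i0 \<noteq> {}" using A0 \<Q>(2) by blast
  define p where "p j = (if A0 (fst (prod_decode j)) (snd (prod_decode j)) = {} then (m0, i0) else prod_decode j)" for j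
  define A where "A j = A0 (fst (p j)) (snd (p j))" for j
  have "\<forall>j. A j \<noteq> {} \<and> A j \<subseteq> \<Q> \<and> 1 \<le> n (fst (p j))"
    using mi test by (auto simp: A_def p_def A0_def testing_family_def)
  moreover have "\<Q> = (\<Union>j. A j)"
  proof
    show "\<Q> \<subseteq> (\<Union>j. A j)"
    proof
      fix Q assume "Q \<in> \<Q>"
      then obtain m i where Q: "Q \<in> A0 m i" using A0 by blast
      then have "p (prod_encode (m, i)) = (m, i)" by (auto simp: p_def)
      then have "Q \<in> A (prod_encode (m, i))" using Q by (simp add: A_def)
      then show "Q \<in> (\<Union>j. A j)" by blast
    qed
  qed (auto simp: A_def A0_def)
  moreover have "\<forall>j. 0 < tv_set_dist (iid_n (n (fst (p j))) M) (closed_mixtures M (n (fst (p j))) \<P>)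
      (closed_mixtures M (n (fst (p j))) (A j))"
    unfolding A_def using dist by blast
  ultimately show ?thesis by (rule that[of A "\<lambda>j. n (fst (p j))"])
qed

text \<open>Subtracting the supremum \<open>a\<close> of the null means from the separating function
  makes the null means nonpositive and leaves at least \<kappa> under every law of the
  class.\<close>

lemma testing_family_of_separated_subfamilies:
  assumes \<P>: "\<P> \<subseteq> space (prob_algebra M)" "\<P> \<noteq> {}" and \<Q>: "\<Q> \<subseteq> space (prob_algebra M)"
    and A: "\<And>m. A m \<noteq> {}" "\<Q> = (\<Union>m. A m)" and n: "\<And>m. 1 \<le> n m"
    and dist: "\<And>m. 0 < tv_set_dist (iid_n (n m) M) (closed_mixtures M (n m) \<P>) (closed_mixtures M (n m) (A m))"
  obtains h where "testing_family M \<P> \<Q> n h"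
proof -
  have ne: "space M \<noteq> {}" using \<P> space_nonempty_of_law by blast
  have "\<exists>h. h \<in> borel_measurable (iid_n (n m) M) \<and> (\<exists>C. \<forall>x\<in>space (iid_n (n m) M). \<bar>h x :: real\<bar> \<le> C) \<and>
      (\<forall>P\<in>\<P>. (\<integral>x. h x \<partial>iid_n (n m) P) \<le> 0) \<and> (\<forall>Q\<in>A m. 0 < (\<integral>x. h x \<partial>iid_n (n m) Q))" for m
  proof -
    let ?N = "iid_n (n m) M"
    let ?E = "\<lambda>R. expectation_functional ?N (iid_n (n m) R)"
    have N: "space ?N \<noteq> {}" by (rule space_iid_n_nonempty[OF ne])
    have AQ: "A m \<subseteq> space (prob_algebra M)" using A(2) \<Q> by auto
    have E: "?E ` S \<subseteq> ba_ball ?N" if "S \<subseteq> space (prob_algebra M)" for S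
      using that by (auto intro!: expectation_functional_in_ba_ball)
    obtain g \<kappa> where g: "g \<in> bdd_meas ?N" and \<kappa>: "0 < \<kappa>"
      and sep: "\<And>\<phi> \<psi>. \<phi> \<in> ?E ` \<P> \<Longrightarrow> \<psi> \<in> ?E ` A m \<Longrightarrow> \<phi> g + \<kappa> \<le> \<psi> g"
      using separating_function[OF N E[OF \<P>(1)] _ E[OF AQ] _ dist[of m, unfolded closed_mixtures_def]] \<P>(2) A(1)[of m]
      by blast
    have sep': "(\<integral>x. g x \<partial>iid_n (n m) P) + \<kappa> \<le> (\<integral>x. g x \<partial>iid_n (n m) Q)" if "P \<in> \<P>" "Q \<in> A m" for P Q
      using sep[of "?E P" "?E Q"] that g by (simp add: expectation_functional_def)
    define a where "a = (SUP P\<in>\<P>. \<integral>x. g x \<partial>iid_n (n m) P)"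
    obtain Q0 where Q0: "Q0 \<in> A m" using A(1)[of m] by blast
    have bdd: "bdd_above ((\<lambda>P. \<integral>x. g x \<partial>iid_n (n m) P) ` \<P>)"
      using sep'[OF _ Q0] by (intro bdd_aboveI[of _ "(\<integral>x. g x \<partial>iid_n (n m) Q0) - \<kappa>"]) (auto simp: le_diff_eq)
    have Pa: "(\<integral>x. g x \<partial>iid_n (n m) P) \<le> a" if "P \<in> \<P>" for P
      unfolding a_def using that bdd by (rule cSUP_upper)
    have Qa: "a \<le> (\<integral>x. g x \<partial>iid_n (n m) Q) - \<kappa>" if "Q \<in> A m" for Q
      unfolding a_def using \<P>(2) sep'[OF _ that] by (intro cSUP_least) (auto simp: le_diff_eq)
    have I: "(\<integral>x. g x - a \<partial>iid_n (n m) R) = (\<integral>x. g x \<partial>iid_n (n m) R) - a" if R: "R \<in> space (prob_algebra M)" for R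
    proof -
      interpret prob_space "iid_n (n m) R" by (rule iid_n_law[OF R])
      show ?thesis using integrable_bdd_meas[OF R g]
        by (subst Bochner_Integration.integral_diff) (auto simp: prob_space)
    qed
    show ?thesis
    proof (intro exI[of _ "\<lambda>x. g x - a"] conjI ballI)
      show "(\<lambda>x. g x - a) \<in> borel_measurable ?N"
        using g by (intro borel_measurable_diff) (simp_all add: bdd_meas_def)
      have "\<bar>g x - a\<bar> \<le> supremum_norm ?N g + \<bar>a\<bar>" if "x \<in> space ?N" for x
        using supremum_norm_ge[OF N g that] by linarith
      then show "\<exists>C. \<forall>x\<in>space ?N. \<bar>g x - a\<bar> \<le> C" by blast
    next
      fix P assume P: "P \<in> \<P>"
      then have "P \<in> space (prob_algebra M)" using \<P> by auto
      then show "(\<integral>x. g x - a \<partial>iid_n (n m) P) \<le> 0" using I Pa[OF P] by simp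
    next
      fix Q assume Q: "Q \<in> A m"
      then have "Q \<in> space (prob_algebra M)" using AQ by auto
      then show "0 < (\<integral>x. g x - a \<partial>iid_n (n m) Q)" using I Qa[OF Q] \<kappa> by simp
    qed
  qed
  then obtain h where h: "\<And>m. h m \<in> borel_measurable (iid_n (n m) M) \<and>
      (\<exists>C. \<forall>x\<in>space (iid_n (n m) M). \<bar>h m x :: real\<bar> \<le> C) \<and>
      (\<forall>P\<in>\<P>. (\<integral>x. h m x \<partial>iid_n (n m) P) \<le> 0) \<and> (\<forall>Q\<in>A m. 0 < (\<integral>x. h m x \<partial>iid_n (n m) Q))"
    by metis
  then have "testing_family M \<P> \<Q> n h"
    unfolding testing_family_def using n A(2) by blast
  then show ?thesis by (rule that)
qed

section \<open>The equivalence\<close>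

lemma log_delay_familyD:
  assumes "log_delay_family M U G \<P> \<Q> \<eta> B T"
  shows "optionally_ARL_valid_family M U G \<P> T"
    and "1 \<le> \<gamma> \<Longrightarrow> ennreal \<gamma> \<le> (INF P\<in>\<P>. mean_time (null_law U P) (T \<gamma>))"
    and "1 \<le> \<gamma> \<Longrightarrow> (SUP P\<in>\<P>. mean_time (null_law U P) (T \<gamma>)) \<le> ennreal ((1 + \<eta>) * \<gamma> + 1)"
    and "Q \<in> \<Q> \<Longrightarrow> \<exists>A. \<forall>\<gamma>\<ge>2. enn2ereal (lorden_delay M U G \<P> Q (T \<gamma>)) \<le> ereal (A + B Q * ln \<gamma>)"
  using assms by (auto simp: log_delay_family_def)

text \<open>The real bound dominates a nonnegative delay and is therefore nonnegative itself, so the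
  truncation of negative reals by \<open>ennreal\<close> does no harm.\<close>

lemma log_delay_family_delay_bound:
  assumes "log_delay_family M U G \<P> \<Q> \<eta> B T" "Q \<in> \<Q>"
  obtains A where "\<And>\<gamma>. 2 \<le> \<gamma> \<Longrightarrow> lorden_delay M U G \<P> Q (T \<gamma>) \<le> ennreal (A + B Q * ln \<gamma>)"
proof -
  obtain A where A: "\<And>\<gamma>. 2 \<le> \<gamma> \<Longrightarrow> enn2ereal (lorden_delay M U G \<P> Q (T \<gamma>)) \<le> ereal (A + B Q * ln \<gamma>)"
    using log_delay_familyD(4)[OF assms] by blast
  have "lorden_delay M U G \<P> Q (T \<gamma>) \<le> ennreal (A + B Q * ln \<gamma>)" if "2 \<le> \<gamma>" for \<gamma>
  proof -
    have "0 \<le> ereal (A + B Q * ln \<gamma>)"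
      using order_trans[OF enn2ereal_nonneg A[OF that]] .
    then have "ereal (A + B Q * ln \<gamma>) = enn2ereal (ennreal (A + B Q * ln \<gamma>))"
      by (simp add: enn2ereal_ennreal)
    then show ?thesis using A[OF that] by (simp add: less_eq_ennreal.rep_eq)
  qed
  then show ?thesis by (rule that)
qed

lemma log_over_linear_tendsto_0:
  fixes A b :: real
  shows "((\<lambda>\<gamma>. (A + b * ln \<gamma>) / \<gamma>) \<longlongrightarrow> 0) at_top"
proof -
  have "((\<lambda>\<gamma>. A / \<gamma> + b * (ln \<gamma> / \<gamma>)) \<longlongrightarrow> 0 + b * 0) at_top"
    by (intro tendsto_add tendsto_mult tendsto_const ln_x_over_x_tendsto_0 tendsto_divide_0[OF tendsto_const]
        filterlim_at_top_imp_at_infinity filterlim_ident)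
  then show ?thesis by (simp add: add_divide_distrib)
qed

lemma log_delay_family_sublinear:
  assumes "log_delay_family M U G \<P> \<Q> \<eta> B T" "Q \<in> \<Q>"
  shows "((\<lambda>\<gamma>. lorden_delay M U G \<P> Q (T \<gamma>) / ennreal \<gamma>) \<longlongrightarrow> 0) at_top"
proof -
  obtain A where A: "\<And>\<gamma>. 2 \<le> \<gamma> \<Longrightarrow> lorden_delay M U G \<P> Q (T \<gamma>) \<le> ennreal (A + B Q * ln \<gamma>)"
    using log_delay_family_delay_bound[OF assms] by blast
  have "((\<lambda>\<gamma>. ennreal ((A + B Q * ln \<gamma>) / \<gamma>)) \<longlongrightarrow> ennreal 0) at_top"
    by (intro tendsto_ennrealI log_over_linear_tendsto_0)
  then have lim: "((\<lambda>\<gamma>. ennreal ((A + B Q * ln \<gamma>) / \<gamma>)) \<longlongrightarrow> 0) at_top" by simp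
  show ?thesis
  proof (rule tendsto_sandwich[OF _ _ tendsto_const lim])
    show "\<forall>\<^sub>F \<gamma> in at_top. lorden_delay M U G \<P> Q (T \<gamma>) / ennreal \<gamma> \<le> ennreal ((A + B Q * ln \<gamma>) / \<gamma>)"
      using eventually_ge_at_top[of "2::real"]
    proof eventually_elim
      case (elim \<gamma>)
      have "lorden_delay M U G \<P> Q (T \<gamma>) / ennreal \<gamma> \<le> ennreal (A + B Q * ln \<gamma>) / ennreal \<gamma>"
        by (intro divide_right_mono_ennreal A elim)
      also have "\<dots> \<le> ennreal ((A + B Q * ln \<gamma>) / \<gamma>)"
      proof (cases "0 \<le> A + B Q * ln \<gamma>")
        case True
        then show ?thesis using elim by (simp add: divide_ennreal)
      next
        case False
        then show ?thesis by (simp add: ennreal_neg)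
      qed
      finally show ?case .
    qed
  qed simp
qed

text \<open>A sublinear delay is eventually below \<gamma>, and \<gamma> is at most every null mean
  of the alarm time.\<close>

lemma log_delay_family_efficient:
  assumes "log_delay_family M U G \<P> \<Q> \<eta> B T" "Q \<in> \<Q>"
  shows "\<forall>\<^sub>F \<gamma> in at_top. lorden_delay M U G \<P> Q (T \<gamma>) < (INF P\<in>\<P>. mean_time (null_law U P) (T \<gamma>))"
proof -
  have "\<forall>\<^sub>F \<gamma> in at_top. lorden_delay M U G \<P> Q (T \<gamma>) / ennreal \<gamma> < 1"
    using log_delay_family_sublinear[OF assms] by (rule order_tendstoD) simp
  with eventually_ge_at_top[of "1::real"] show ?thesis
  proof eventually_elim
    case (elim \<gamma>)
    have "lorden_delay M U G \<P> Q (T \<gamma>) < ennreal \<gamma>"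
    proof (rule ccontr)
      assume "\<not> ?thesis"
      then have "ennreal \<gamma> / ennreal \<gamma> \<le> lorden_delay M U G \<P> Q (T \<gamma>) / ennreal \<gamma>"
        by (intro divide_right_mono_ennreal) simp
      then show False using elim by (simp add: divide_ennreal)
    qed
    also have "\<dots> \<le> (INF P\<in>\<P>. mean_time (null_law U P) (T \<gamma>))"
      by (rule log_delay_familyD(2)[OF assms(1) elim(1)])
    finally show ?case .
  qed
qed

theorem theorem4p5:
  fixes M :: "'a measure" and \<P> \<Q> :: "'a measure set"
  assumes "\<P> \<subseteq> space (prob_algebra M)" and "\<P> \<noteq> {}"
    and "\<Q> \<subseteq> space (prob_algebra M)" and "\<Q> \<noteq> {}"
  defines "cond_i \<equiv> sequentially_testable M \<P> \<Q>"
    and "cond_ii \<equiv> (\<exists>B. \<forall>\<eta>>0. \<exists>(U :: 'b measure) G T.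
          aux_randomization U G \<and> log_delay_family M U G \<P> \<Q> \<eta> B T)"
    and "cond_iii \<equiv> (\<exists>(U :: 'b measure) G T.
          aux_randomization U G \<and> optionally_ARL_valid_family M U G \<P> T \<and>
          (\<forall>Q\<in>\<Q>. ((\<lambda>\<gamma>. lorden_delay M U G \<P> Q (T \<gamma>) / ennreal \<gamma>) \<longlongrightarrow> 0) at_top))"
    and "cond_iv \<equiv> (\<exists>(U :: 'b measure) G T.
          aux_randomization U G \<and> optionally_ARL_valid_family M U G \<P> T \<and>
          (\<forall>Q\<in>\<Q>. \<exists>k::nat. 3 \<le> k \<and> lorden_delay M U G \<P> Q (T (real k)) < ennreal (real k / 2)))"
    and "cond_v \<equiv> (\<exists>(A :: nat \<Rightarrow> 'a measure set) (n :: nat \<Rightarrow> nat).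
          (\<forall>m. A m \<noteq> {} \<and> A m \<subseteq> \<Q> \<and> 1 \<le> n m) \<and> \<Q> = (\<Union>m. A m) \<and>
          (\<forall>m. 0 < tv_set_dist (iid_n (n m) M)
                 (closed_mixtures M (n m) \<P>) (closed_mixtures M (n m) (A m))))"
  shows "(cond_i \<longleftrightarrow> cond_ii) \<and> (cond_i \<longleftrightarrow> cond_iii) \<and> (cond_i \<longleftrightarrow> cond_iv) \<and> (cond_i \<longleftrightarrow> cond_v) \<and>
    (cond_i \<longrightarrow>
       (\<exists>B. \<forall>\<eta>>0. \<exists>(U :: 'b measure) G D.
          aux_randomization U G \<and> e_detector M U G \<P> D \<and>
          log_delay_family M U G \<P> \<Q> \<eta> B (threshold_family D))) \<and>
    (cond_i \<longrightarrow>
       (\<exists>(U :: 'b measure) G T.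
          aux_randomization U G \<and> optionally_ARL_valid_family M U G \<P> T \<and>
          (\<forall>P\<in>\<P>. \<forall>\<gamma>\<ge>1. mean_time (null_law U P) (T \<gamma>) < \<infinity>) \<and>
          (\<forall>Q\<in>\<Q>. \<forall>\<^sub>F \<gamma> in at_top.
             lorden_delay M U G \<P> Q (T \<gamma>) < (INF P\<in>\<P>. mean_time (null_law U P) (T \<gamma>)))))"
proof -
  note \<P> = assms(1,2) and \<Q> = assms(3,4)
  \<comment> \<open>The alarm conditions form a cycle \<open>testing\<close>,
    \<open>detector\<close>, \<open>cond_ii\<close>, \<open>cond_iii\<close>,
    \<open>cond_iv\<close>, \<open>testing\<close>; \<open>cond_i\<close> and \<open>cond_v\<close>
    are tied to \<open>testing\<close> in both directions.\<close>
  define testing where "testing \<longleftrightarrow> (\<exists>n h. testing_family M \<P> \<Q> n h)"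
  define detector where "detector \<longleftrightarrow> (\<exists>B. \<forall>\<eta>>0. \<exists>(U :: 'b measure) G D.
    aux_randomization U G \<and> e_detector M U G \<P> D \<and> log_delay_family M U G \<P> \<Q> \<eta> B (threshold_family D))"
  have i_testing: "cond_i \<Longrightarrow> testing"
    unfolding cond_i_def testing_def using testing_family_of_sequentially_testable[OF \<P> \<Q>(1)] by blast
  have bet: "testing \<Longrightarrow> \<exists>n e. betting_family M \<P> \<Q> n e"
    unfolding testing_def using betting_family_of_testing_family[OF \<P>(1) \<Q>(1)] by blast
  have testing_i: "testing \<Longrightarrow> cond_i"
    unfolding cond_i_def using bet sequentially_testable_of_betting_family[OF \<P>(1) \<Q>(1)] by blast
  have testing_detector: "testing \<Longrightarrow> detector"
    unfolding detector_def using bet betting_family_detectors[OF \<P> \<Q>(1)] by blast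
  have detector_ii: "detector \<Longrightarrow> cond_ii" unfolding detector_def cond_ii_def by blast
  have ii_iii: "cond_iii" if cond_ii
  proof -
    obtain B and U :: "'b measure" and G T where
      "aux_randomization U G" and T: "log_delay_family M U G \<P> \<Q> 1 B T"
      using \<open>cond_ii\<close> unfolding cond_ii_def by (meson zero_less_one)
    then show cond_iii
      unfolding cond_iii_def using log_delay_familyD(1)[OF T] log_delay_family_sublinear[OF T] by blast
  qed
  have iii_iv: "cond_iv" if cond_iii
  proof -
    obtain U :: "'b measure" and G T where T: "aux_randomization U G" "optionally_ARL_valid_family M U G \<P> T"
      and lim: "\<And>Q. Q \<in> \<Q> \<Longrightarrow> ((\<lambda>\<gamma>. lorden_delay M U G \<P> Q (T \<gamma>) / ennreal \<gamma>) \<longlongrightarrow> 0) at_top"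
      using \<open>cond_iii\<close> unfolding cond_iii_def by blast
    have "\<exists>k::nat. 3 \<le> k \<and> lorden_delay M U G \<P> Q (T (real k)) < ennreal (real k / 2)" if Q: "Q \<in> \<Q>" for Q
    proof -
      \<comment> \<open>The limit over real \<gamma> is restricted to integers; any ratio below 1/2
        at an integer from 3 on gives the fourth condition.\<close>
      have "((\<lambda>k. lorden_delay M U G \<P> Q (T (real k)) / ennreal (real k)) \<longlongrightarrow> 0) sequentially"
        by (rule filterlim_compose[OF lim[OF Q] filterlim_real_sequentially])
      then have "\<forall>\<^sub>F k in sequentially. lorden_delay M U G \<P> Q (T (real k)) / ennreal (real k) < ennreal (1 / 2)"
        by (rule order_tendstoD) (rule ennreal_less_zero_iff[THEN iffD2], simp)
      with eventually_ge_at_top[of "3::nat"]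
      have "\<forall>\<^sub>F k in sequentially. 3 \<le> k \<and>
          lorden_delay M U G \<P> Q (T (real k)) / ennreal (real k) < ennreal (1 / 2)"
        by eventually_elim simp
      then obtain k :: nat where k: "3 \<le> k"
        "lorden_delay M U G \<P> Q (T (real k)) / ennreal (real k) < ennreal (1 / 2)"
        by (auto simp: eventually_sequentially)
      have "lorden_delay M U G \<P> Q (T (real k)) < ennreal (real k / 2)"
      proof (rule ccontr)
        assume "\<not> ?thesis"
        then have "ennreal (real k / 2) / ennreal (real k) \<le>
            lorden_delay M U G \<P> Q (T (real k)) / ennreal (real k)"
          by (intro divide_right_mono_ennreal) simp
        moreover have "ennreal (real k / 2) / ennreal (real k) = ennreal (1 / 2)"
          using k by (subst divide_ennreal) auto
        ultimately show False using k by simp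
      qed
      then show ?thesis using k by blast
    qed
    then show cond_iv unfolding cond_iv_def using T by blast
  qed
  have iv_testing: "cond_iv \<Longrightarrow> testing"
    unfolding cond_iv_def testing_def using testing_family_of_alarms[OF \<P> \<Q>(1)] by metis
  have v_testing: "cond_v \<Longrightarrow> testing"
    unfolding cond_v_def testing_def using testing_family_of_separated_subfamilies[OF \<P> \<Q>(1)] by metis
  have testing_v: "testing \<Longrightarrow> cond_v"
    unfolding cond_v_def testing_def using separated_subfamilies_of_testing_family[OF \<P> \<Q>] by metis
  have detector_last: "\<exists>(U :: 'b measure) G T.
      aux_randomization U G \<and> optionally_ARL_valid_family M U G \<P> T \<and>
      (\<forall>P\<in>\<P>. \<forall>\<gamma>\<ge>1. mean_time (null_law U P) (T \<gamma>) < \<infinity>) \<and>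
      (\<forall>Q\<in>\<Q>. \<forall>\<^sub>F \<gamma> in at_top.
         lorden_delay M U G \<P> Q (T \<gamma>) < (INF P\<in>\<P>. mean_time (null_law U P) (T \<gamma>)))" if cond_ii
  proof -
    \<comment> \<open>Any positive \<eta> would serve; finiteness of the means comes from the upper
      bound \<open>(1 + \<eta>) * \<gamma> + 1\<close>.\<close>
    obtain B and U :: "'b measure" and G T where
      aux: "aux_randomization U G" and T: "log_delay_family M U G \<P> \<Q> 1 B T"
      using \<open>cond_ii\<close> unfolding cond_ii_def by (meson zero_less_one)
    have "mean_time (null_law U P) (T \<gamma>) < \<infinity>" if "P \<in> \<P>" "1 \<le> \<gamma>" for P \<gamma>
      using order_trans[OF SUP_upper[OF that(1)] log_delay_familyD(3)[OF T that(2)]]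
      by (rule le_less_trans) simp
    then show ?thesis
      using aux log_delay_familyD(1)[OF T] log_delay_family_efficient[OF T] by blast
  qed
  have "cond_i \<longleftrightarrow> testing" "cond_ii \<longleftrightarrow> testing" "cond_iii \<longleftrightarrow> testing" "cond_iv \<longleftrightarrow> testing"
    "cond_v \<longleftrightarrow> testing" "testing \<longrightarrow> detector" "testing \<longrightarrow> cond_ii"
    using i_testing testing_i testing_detector detector_ii ii_iii iii_iv iv_testing v_testing testing_v
    by blast+
  then show ?thesis using detector_last unfolding detector_def by blast
qed

end
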